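(* Let $X$ and $Y$ be Hausdorff sequentially complete locally convex spaces over $\mathbb{C}$. Suppose that $\mathcal{A}$ is a closed MLO in $X$, $C,C_{2}\in L(X)$, $C_{1}\in L(Y,X)$, $C\mathcal{A}\subseteq\mathcal{A}C$, $\omega_{0}'\geq\max(\mathrm{abs}(|a|),\mathrm{abs}(k),0)$, the functions $b(t)$ and $k_{1}(t)$ satisfy (P1) with $\omega_{0}\geq\max(0,\mathrm{abs}(|b|))$, the function $k_{1}(t)$ is continuous for $t\geq 0$ and $|k_{1}(t)|=O(e^{\omega_{0}t}P(t))$ for $t\geq 0$, where $P(t)=\sum_{j=0}^{l}a_{j}t^{\zeta_{j}}$, $t\geq 0$ ($l\in\mathbb{N}$, $a_{j}\geq 0$ and $\zeta_{j}\geq 0$ for $0\leq j\leq l$). Let $f:\{\lambda\in\mathbb{C}:\Re\lambda>\omega_{0}\}\to\{\lambda\in\mathbb{C}:\Re\lambda>\omega_{0}'\}$ and $G:\{\lambda\in\mathbb{C}:\Re\lambda>\omega_{0}\}\to\mathbb{C}$ be two given functions, let $\tilde{a}(\lambda)\neq 0$ for $\Re\lambda>\omega_{0}'$, and let $$ \tilde{b}(\lambda)=\frac{1}{\tilde{a}(f(\lambda))}\quad\text{and}\quad\widetilde{k_{1}}(\lambda)=G(\lambda)\tilde{k}(f(\lambda)),\qquad\Re\lambda>\omega_{0}. $$ (i) Suppose, further, that $\mathcal{A}$ is a subgenerator of a global mild $(a,k)$-regularized $C_{1}$-existence family $(R_{1}(t))_{t\geq 0}\subseteq L(Y,X)$ such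 that $\{e^{-\omega t}R_{1}(t):t\geq 0\}\subseteq L(Y,X)$ is equicontinuous for each $\omega>\omega_{0}'$, and that there exists a strongly continuous operator family $(S_{0}(t))_{t\geq 0}\subseteq L(Y,X)$ such that $\{e^{-\omega_{0}t}S_{0}(t):t\geq 0\}\subseteq L(Y,X)$ is equicontinuous and $$ \int_{0}^{\infty}e^{-\lambda t}S_{0}(t)y\,dt=G(\lambda)\int_{0}^{\infty}e^{-sf(\lambda)}R_{1}(s)y\,ds,\quad y\in Y,\ \Re\lambda>\omega_{0}. $$ Then $\mathcal{A}^{-1}$ is a subgenerator of a global mild $(b,k_{1})$-regularized $C_{1}$-existence family $(S_{1}(t)\equiv k_{1}(t)C_{1}-S_{0}(t))_{t\geq 0}\subseteq L(Y,X)$ and the operator family $\{e^{-\omega_{0}t}(P(t))^{-1}S_{1}(t):t>0\}\subseteq L(Y,X)$ is equicontinuous. (ii) Suppose, further, that $\mathcal{A}$ is a subgenerator of a global mild $(a,k)$-regularized $C_{2}$-uniqueness family $(R_{2}(t))_{t\geq 0}\subseteq L(X)$ such that $\{e^{-\omega t}R_{2}(t):t\geq 0\}\subseteq L(X)$ is equicontinuous for each $\omega>\omega_{0}'$, and that there exists a strongly continuous operator family $(S_{0}(t))_{t\geq 0}\subseteq L(X)$ such that $\{e^{-\omega_{0}t}S_{0}(t):t\geq 0\}\subseteq L(X)$ is equicontinuous and $$ \int_{0}^{\infty}e^{-\lambda t}S_{0}(t)x\,dt=G(\lambda)\int_{0}^{\infty}e^{-sf(\lambda)}R_{2}(s)x\,ds,\quad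 x\in X,\ \Re\lambda>\omega_{0}. $$ Then $\mathcal{A}^{-1}$ is a subgenerator of a global mild $(b,k_{1})$-regularized $C_{2}$-uniqueness family $(S_{2}(t)\equiv k_{1}(t)C_{2}-S_{0}(t))_{t\geq 0}\subseteq L(X)$ and the operator family $\{e^{-\omega_{0}t}(P(t))^{-1}S_{2}(t):t>0\}\subseteq L(X)$ is equicontinuous. (iii) Suppose, further, that $\mathcal{A}$ is a subgenerator of a global $(a,k)$-regularized $C$-resolvent family $(R(t))_{t\geq 0}\subseteq L(X)$ such that $\{e^{-\omega t}R(t):t\geq 0\}\subseteq L(X)$ is equicontinuous for each $\omega>\omega_{0}'$, and that there exists a strongly continuous operator family $(S_{0}(t))_{t\geq 0}\subseteq L(X)$ such that $\{e^{-\omega_{0}t}S_{0}(t):t\geq 0\}\subseteq L(X)$ is equicontinuous and $$ \int_{0}^{\infty}e^{-\lambda t}S_{0}(t)x\,dt=G(\lambda)\int_{0}^{\infty}e^{-sf(\lambda)}R(s)x\,ds,\quad x\in X,\ \Re\lambda>\omega_{0}. $$ Then $\mathcal{A}^{-1}$ is a subgenerator of a global $(b,k_{1})$-regularized $C$-resolvent family $(S(t)\equiv k_{1}(t)C-S_{0}(t))_{t\geq 0}\subseteq L(X)$ and the operator family $\{e^{-\omega_{0}t}(P(t))^{-1}S(t):t>0\}\subseteq L(X)$ is equicontinuous.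
   Context: MLOs: a map $\mathcal{A}:X\to P(X)$ is a multivalued linear operator (MLO) in $X$ if $D(\mathcal{A}):=\{x:\mathcal{A}x\neq\emptyset\}$ is a linear subspace, $\mathcal{A}x+\mathcal{A}y\subseteq\mathcal{A}(x+y)$ and $\lambda\mathcal{A}x\subseteq\mathcal{A}(\lambda x)$ for $x,y\in D(\mathcal{A})$, $\lambda\in\mathbb{C}$; it is identified with its graph in $X\times X$ (a linear subspace), is closed if the graph is closed, and inclusions are inclusions of graphs. $\mathcal{A}^{-1}=\{(y,x):(x,y)\in\mathcal{A}\}$. (P1) for a scalar function $k$ on $[0,\infty)$: $k$ is locally integrable and there is $\beta\in\mathbb{R}$ such that $\tilde{k}(\lambda):=\lim_{c\to\infty}\int_{0}^{c}e^{-\lambda t}k(t)\,dt$ exists for all $\Re\lambda>\beta$; $\mathrm{abs}(k):=\inf\{\Re\lambda:\tilde{k}(\lambda)\text{ exists}\}$. The tilde denotes the Laplace transform. The functions $|a|$ and $k$ are also Laplace transformable in this sense. Families: whenever an $(a,k)$-regularized family is spoken of, it is assumed that $k\in C([0,\infty))$, $k\neq 0$, $a\in L^{1}_{loc}([0,\infty))$, $a\neq 0$ (and likewise for $(b,k_1)$). "Global" means defined for all $t\geq 0$. Let $\mathcal{M}$ be an MLO in $X$. A strongly continuous $(R_{1}(t))_{t\ge 0}\subseteq L(Y,X)$ is a mild $(a,k)$-regularized $C_{1}$-existence family with a subgenerator $\mathcal{M}$ if $\bigl(\int_{0}^{t}a(t-s)R_{1}(s)y\,ds,\ R_{1}(t)y-k(t)C_{1}y\bigr)\in\mathcal{M}$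 for all $t\geq 0$, $y\in Y$. A strongly continuous $(R_{2}(t))_{t\ge 0}\subseteq L(X)$ is a mild $(a,k)$-regularized $C_{2}$-uniqueness family with a subgenerator $\mathcal{M}$ if $\int_{0}^{t}a(t-s)R_{2}(s)y\,ds=R_{2}(t)x-k(t)C_{2}x$ for all $t\geq 0$ and $(x,y)\in\mathcal{M}$. If $C\mathcal{M}\subseteq\mathcal{M}C$, a strongly continuous $(R(t))_{t\geq 0}\subseteq L(X)$ is an $(a,k)$-regularized $C$-resolvent family with a subgenerator $\mathcal{M}$ if it is a mild $(a,k)$-regularized $C$-uniqueness family with subgenerator $\mathcal{M}$, $R(t)C=CR(t)$ and $R(t)\mathcal{M}\subseteq\mathcal{M}R(t)$ for all $t\geq 0$. No injectivity of $C,C_1,C_2$ is assumed.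
   Formalization: In (i)–(iii), equicontinuity of the family e^{-ω0 t}P(t)^{-1}S(t) over all t>0 is claimed only if P(0)>0; in general it is claimed for t≥δ, for each δ>0. As printed it fails when P(0)=0 (e.g. A={(0,0)}, a=k=b=1, k1=P=t, f=1/λ, G=1/λ^3, R(t)=tI, S0=I). *)

theory Defs
  imports "HOL-Analysis.Analysis"
begin

section \<open>Sequentially complete locally convex spaces over the complex field\<close>

class scaleC =
  fixes scaleC :: "complex \<Rightarrow> 'a \<Rightarrow> 'a"  (infixr \<open>*\<^sub>C\<close> 75)

text \<open>
  Hausdorff locally convex complex vector spaces. The superclass \<^class>\<open>real_vector\<close> is the
  underlying real space; it makes the library's integral of simple functions available.
  In the last axiom, convexity of \<open>V\<close> is written out because \<^const>\<open>convex\<close> cannot be used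
  inside a class specification.
\<close>

class complex_lcs = real_vector + topological_ab_group_add + t2_space + scaleC +
  assumes scaleC_add_right: "c *\<^sub>C (x + y) = c *\<^sub>C x + c *\<^sub>C y"
    and scaleC_add_left: "(c + d) *\<^sub>C x = c *\<^sub>C x + d *\<^sub>C x"
    and scaleC_scaleC: "c *\<^sub>C d *\<^sub>C x = (c * d) *\<^sub>C x"
    and scaleC_one: "1 *\<^sub>C x = x"
    and scaleR_scaleC: "r *\<^sub>R x = complex_of_real r *\<^sub>C x"
    and tendsto_scaleC_Pair: "LIM z (nhds c \<times>\<^sub>F nhds x). fst z *\<^sub>C snd z :> nhds (c *\<^sub>C x)"
    and locally_convex:
      "open U \<Longrightarrow> 0 \<in> U \<Longrightarrow>
        \<exists>V. open V \<and> 0 \<in> V \<and> V \<subseteq> U \<and>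
          (\<forall>x\<in>V. \<forall>y\<in>V. \<forall>u\<ge>0. \<forall>v\<ge>0. u + v = 1 \<longrightarrow> u *\<^sub>R x + v *\<^sub>R y \<in> V)"

class sc_lcs = complex_lcs +
  assumes sequentially_complete:
    "(\<And>U. open U \<Longrightarrow> 0 \<in> U \<Longrightarrow> \<exists>N. \<forall>m\<ge>N. \<forall>n\<ge>N. X m - X n \<in> U) \<Longrightarrow> convergent X"

instantiation complex :: sc_lcs
begin

definition scaleC_complex :: "complex \<Rightarrow> complex \<Rightarrow> complex"
  where "scaleC_complex c x = c * x"

instance
proof
  show "LIM z (nhds c \<times>\<^sub>F nhds x). fst z *\<^sub>C snd z :> nhds (c *\<^sub>C x)" for c x :: complex
    unfolding scaleC_complex_def by (rule tendsto_mult_Pair)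
next
  fix U :: "complex set"
  assume "open U" "0 \<in> U"
  then obtain e where "e > 0" "ball 0 e \<subseteq> U"
    by (meson open_contains_ball)
  then show "\<exists>V. open V \<and> 0 \<in> V \<and> V \<subseteq> U \<and>
      (\<forall>x\<in>V. \<forall>y\<in>V. \<forall>u\<ge>0. \<forall>v\<ge>0. u + v = 1 \<longrightarrow> u *\<^sub>R x + v *\<^sub>R y \<in> V)"
    using convex_ball[of "0::complex" e] unfolding convex_def
    by (intro exI[of _ "ball 0 e"]) auto
next
  fix X :: "nat \<Rightarrow> complex"
  assume *: "\<And>U. open U \<Longrightarrow> 0 \<in> U \<Longrightarrow> \<exists>N. \<forall>m\<ge>N. \<forall>n\<ge>N. X m - X n \<in> U"
  have "Cauchy X"
  proof (rule CauchyI)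
    fix e :: real
    assume "e > 0"
    then show "\<exists>N. \<forall>m\<ge>N. \<forall>n\<ge>N. norm (X m - X n) < e"
      using *[of "ball 0 e"] by simp
  qed
  then show "convergent X"
    by (rule Cauchy_convergent)
qed (simp_all add: scaleC_complex_def algebra_simps scaleR_conv_of_real)

end


section \<open>Continuous linear operators\<close>

definition cont_linear :: "('y::complex_lcs \<Rightarrow> 'x::complex_lcs) \<Rightarrow> bool" where
  "cont_linear T \<longleftrightarrow>
     (\<forall>x y. T (x + y) = T x + T y) \<and> (\<forall>c x. T (c *\<^sub>C x) = c *\<^sub>C T x) \<and> continuous_on UNIV T"

text \<open>For families of linear operators, equicontinuity is tested at the origin.\<close>

definition equicontinuous :: "('y::complex_lcs \<Rightarrow> 'x::complex_lcs) set \<Rightarrow> bool" where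
  "equicontinuous F \<longleftrightarrow>
     (\<forall>U. open U \<and> 0 \<in> U \<longrightarrow> (\<exists>V. open V \<and> 0 \<in> V \<and> (\<forall>T\<in>F. T ` V \<subseteq> U)))"

definition strongly_continuous_family ::
    "(real \<Rightarrow> 'y::complex_lcs \<Rightarrow> 'x::complex_lcs) \<Rightarrow> bool" where
  "strongly_continuous_family R \<longleftrightarrow>
     (\<forall>t\<ge>0. cont_linear (R t)) \<and> (\<forall>y. continuous_on {0..} (\<lambda>t. R t y))"


section \<open>Integration in locally convex spaces\<close>

definition seminorm :: "('x::complex_lcs \<Rightarrow> real) \<Rightarrow> bool" where
  "seminorm p \<longleftrightarrow> (\<forall>x y. p (x + y) \<le> p x + p y) \<and> (\<forall>c x. p (c *\<^sub>C x) = cmod c * p x)"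

text \<open>
  The Bochner integral, with the norm replaced by all continuous seminorms: one sequence of
  simple functions has to serve all of them. Measurability is expressed by almost everywhere
  convergence of that sequence.
\<close>

definition has_lcs_integral ::
    "'m measure \<Rightarrow> ('m \<Rightarrow> 'x::complex_lcs) \<Rightarrow> 'x \<Rightarrow> bool" where
  "has_lcs_integral M F v \<longleftrightarrow>
     (\<exists>s. (\<forall>n::nat. Bochner_Integration.simple_bochner_integrable M (s n)) \<and>
          (AE t in M. (\<lambda>n. s n t) \<longlonglongrightarrow> F t) \<and>
          (\<forall>p. seminorm p \<and> continuous_on UNIV p \<longrightarrow>
             (\<lambda>n. \<integral>\<^sup>+ t. ennreal (p (F t - s n t)) \<partial>M) \<longlonglongrightarrow> 0) \<and>
          (\<lambda>n. Bochner_Integration.simple_bochner_integral M (s n)) \<longlonglongrightarrow> v)"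

definition lcs_integral :: "'m measure \<Rightarrow> ('m \<Rightarrow> 'x::complex_lcs) \<Rightarrow> 'x" where
  "lcs_integral M F = (THE v. has_lcs_integral M F v)"

definition lcs_convolution ::
    "(real \<Rightarrow> complex) \<Rightarrow> (real \<Rightarrow> 'x::complex_lcs) \<Rightarrow> real \<Rightarrow> 'x" where
  "lcs_convolution a F t = lcs_integral (lebesgue_on {0..t}) (\<lambda>s. a (t - s) *\<^sub>C F s)"

definition lcs_laplace :: "(real \<Rightarrow> 'x::complex_lcs) \<Rightarrow> complex \<Rightarrow> 'x" where
  "lcs_laplace F z =
     Lim at_top (\<lambda>c. lcs_integral (lebesgue_on {0..c}) (\<lambda>t. exp (- z * complex_of_real t) *\<^sub>C F t))"


section \<open>Scalar kernels and their Laplace transforms\<close>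

definition locally_integrable :: "(real \<Rightarrow> complex) \<Rightarrow> bool" where
  "locally_integrable k \<longleftrightarrow> (\<forall>c\<ge>0. k absolutely_integrable_on {0..c})"

definition has_laplace :: "(real \<Rightarrow> complex) \<Rightarrow> complex \<Rightarrow> complex \<Rightarrow> bool" where
  "has_laplace k z v \<longleftrightarrow>
     ((\<lambda>c. integral {0..c} (\<lambda>t. exp (- z * complex_of_real t) * k t)) \<longlongrightarrow> v) at_top"

definition laplace :: "(real \<Rightarrow> complex) \<Rightarrow> complex \<Rightarrow> complex" where
  "laplace k z = (THE v. has_laplace k z v)"

definition P1 :: "(real \<Rightarrow> complex) \<Rightarrow> bool" where
  "P1 k \<longleftrightarrow> locally_integrable k \<and> (\<exists>\<beta>. \<forall>z. Re z > \<beta> \<longrightarrow> (\<exists>v. has_laplace k z v))"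

text \<open>
  The abscissa of convergence lives in \<^typ>\<open>ereal\<close>: it may be minus infinity, and it is plus
  infinity if the transform exists nowhere.
\<close>

definition laplace_abs :: "(real \<Rightarrow> complex) \<Rightarrow> ereal" where
  "laplace_abs k = Inf {ereal (Re z) | z. \<exists>v. has_laplace k z v}"

abbreviation modulus :: "(real \<Rightarrow> complex) \<Rightarrow> real \<Rightarrow> complex" where
  "modulus a \<equiv> (\<lambda>t. complex_of_real (cmod (a t)))"

text \<open>
  Standing assumptions on the pair of kernels of a regularized family. The first kernel is an
  element of a Lebesgue space, so being nonzero means not vanishing almost everywhere.
\<close>

definition kernel_pair :: "(real \<Rightarrow> complex) \<Rightarrow> (real \<Rightarrow> complex) \<Rightarrow> bool" where
  "kernel_pair a k \<longleftrightarrow>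
     locally_integrable a \<and> \<not> (AE t in lebesgue_on {0..}. a t = 0) \<and>
     continuous_on {0..} k \<and> (\<exists>t\<ge>0. k t \<noteq> 0)"

text \<open>Real powers on the nonnegative half-line with \<open>0\<close> to the power \<open>0\<close> equal to \<open>1\<close>, whereas
  \<open>0 powr 0 = 0\<close>.\<close>

definition rpow :: "real \<Rightarrow> real \<Rightarrow> real" where
  "rpow t z = (if z = 0 then 1 else t powr z)"


section \<open>Multivalued linear operators\<close>

text \<open>
  A multivalued operator is represented by its graph \<open>A\<close>, so that its value at \<open>x\<close> is \<open>A `` {x}\<close>,
  its domain is \<^term>\<open>Domain A\<close> and its inverse is \<^term>\<open>converse A\<close>.
\<close>

definition mlo :: "('x::complex_lcs \<times> 'x) set \<Rightarrow> bool" where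
  "mlo A \<longleftrightarrow>
     0 \<in> Domain A \<and>
     (\<forall>x\<in>Domain A. \<forall>y\<in>Domain A. x + y \<in> Domain A) \<and>
     (\<forall>c. \<forall>x\<in>Domain A. c *\<^sub>C x \<in> Domain A) \<and>
     (\<forall>x\<in>Domain A. \<forall>y\<in>Domain A. \<forall>u\<in>A `` {x}. \<forall>v\<in>A `` {y}. u + v \<in> A `` {x + y}) \<and>
     (\<forall>c. \<forall>x\<in>Domain A. \<forall>u\<in>A `` {x}. c *\<^sub>C u \<in> A `` {c *\<^sub>C x})"

definition graph_of :: "('x \<Rightarrow> 'x) \<Rightarrow> ('x \<times> 'x) set" where
  "graph_of T = {(x, T x) | x. True}"

text \<open>
  The inclusion of \<open>T A\<close> in \<open>A T\<close>; relation composition applies its left argument first.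
\<close>

definition commutes_with :: "('x \<Rightarrow> 'x) \<Rightarrow> ('x \<times> 'x) set \<Rightarrow> bool" where
  "commutes_with T A \<longleftrightarrow> A O graph_of T \<subseteq> graph_of T O A"


section \<open>Regularized families\<close>

definition mild_existence_family ::
    "('x::complex_lcs \<times> 'x) set \<Rightarrow> (real \<Rightarrow> complex) \<Rightarrow> (real \<Rightarrow> complex) \<Rightarrow>
     ('y::complex_lcs \<Rightarrow> 'x) \<Rightarrow> (real \<Rightarrow> 'y \<Rightarrow> 'x) \<Rightarrow> bool" where
  "mild_existence_family M a k C1 R \<longleftrightarrow>
     mlo M \<and> strongly_continuous_family R \<and>
     (\<forall>t\<ge>0. \<forall>y. (lcs_convolution a (\<lambda>s. R s y) t, R t y - k t *\<^sub>C C1 y) \<in> M)"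

definition mild_uniqueness_family ::
    "('x::complex_lcs \<times> 'x) set \<Rightarrow> (real \<Rightarrow> complex) \<Rightarrow> (real \<Rightarrow> complex) \<Rightarrow>
     ('x \<Rightarrow> 'x) \<Rightarrow> (real \<Rightarrow> 'x \<Rightarrow> 'x) \<Rightarrow> bool" where
  "mild_uniqueness_family M a k C2 R \<longleftrightarrow>
     mlo M \<and> strongly_continuous_family R \<and>
     (\<forall>t\<ge>0. \<forall>(x, y)\<in>M. lcs_convolution a (\<lambda>s. R s y) t = R t x - k t *\<^sub>C C2 x)"

definition resolvent_family ::
    "('x::complex_lcs \<times> 'x) set \<Rightarrow> (real \<Rightarrow> complex) \<Rightarrow> (real \<Rightarrow> complex) \<Rightarrow>
     ('x \<Rightarrow> 'x) \<Rightarrow> (real \<Rightarrow> 'x \<Rightarrow> 'x) \<Rightarrow> bool" where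
  "resolvent_family M a k C R \<longleftrightarrow>
     commutes_with C M \<and> mild_uniqueness_family M a k C R \<and>
     (\<forall>t\<ge>0. R t \<circ> C = C \<circ> R t \<and> commutes_with (R t) M)"

text \<open>
  Equicontinuity of the operators \<open>exp (- \<omega> t) S t / P t\<close> for \<open>t\<close> away from \<open>0\<close>, and for all
  \<open>t > 0\<close> if \<open>P 0 > 0\<close>. If \<open>P 0 = 0\<close>, the weight \<open>1 / P t\<close> blows up at \<open>0\<close>, and equicontinuity on
  all of \<open>{0<..}\<close> may fail: for \<open>A = {(0, 0)}\<close> in the complex plane, \<open>a = k = b = 1\<close>, \<open>C = I\<close>,
  \<open>k1 t = P t = t\<close>, \<open>f z = 1 / z\<close>, \<open>G z = 1 / z^3\<close>, every strongly continuous family is a mild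
  uniqueness family with subgenerator \<open>A\<close>; if \<open>R t = t I\<close> and \<open>S0 t = I\<close>, the two families have
  Laplace transforms \<open>1 / z^2\<close> and \<open>1 / z = G z * (1 / (f z)^2)\<close>, but
  \<open>S t / P t = (1 - 1 / t) I\<close> is unbounded near \<open>0\<close>.
\<close>

definition weighted_equicontinuous ::
    "real \<Rightarrow> (real \<Rightarrow> real) \<Rightarrow> (real \<Rightarrow> 'y::complex_lcs \<Rightarrow> 'x::complex_lcs) \<Rightarrow> bool" where
  "weighted_equicontinuous \<omega> P S \<longleftrightarrow>
     (\<forall>\<delta>>0. equicontinuous {(\<lambda>y. (exp (- \<omega> * t) * inverse (P t)) *\<^sub>R S t y) | t. t \<ge> \<delta>}) \<and>
     (P 0 > 0 \<longrightarrow> equicontinuous {(\<lambda>y. (exp (- \<omega> * t) * inverse (P t)) *\<^sub>R S t y) | t. t > 0})"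

end

theory Submission
  imports Defs
begin

text \<open>
  Applied to the Laplace transforms at \<open>f z\<close>, membership in a closed operator \<open>A\<close> is inherited from
  the family \<open>R\<close>, and multiplying by \<open>G z\<close> and dividing by the transform of \<open>a\<close> at \<open>f z\<close> turns it
  into the transformed equation for \<open>A\<inverse>\<close> and \<open>S\<close>. By Hahn-Banach, a closed subspace is the
  intersection of the kernels of the continuous functionals vanishing on it, so every vector-valued
  identity can be tested on functionals. This leaves scalar facts: the convolution theorem,
  absolute convergence right of the abscissa, and uniqueness of the transform for continuous
  functions.
\<close>

section \<open>Sublinear functionals\<close>

text \<open>\<open>f\<close> is an arbitrary map between half-planes, so information flows one way:
  the equation for \<open>R\<close> is evaluated at the points \<open>f z\<close>, and uniqueness of
  the transform is applied on the side of \<open>S0\<close>. If the pair \<open>\<phi>\<close>,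
  \<open>\<psi>\<close> vanishes on \<open>A\<close>, the existence inclusion becomes
  \<open>conv a g1 + g2 = k c\<close>, where \<open>g1\<close>, \<open>g2\<close> are the orbit of
  \<open>R\<close> under \<open>\<phi>\<close>, \<open>\<psi>\<close> and
  \<open>c = \<psi> (C1 y)\<close>. Its transform is \<open>conv b (k1 c - s2) = s1\<close> with the
  same orbits of \<open>S0\<close>, which is the inclusion for the inverse because
  \<open>S1 - k1 C1 = - S0\<close>. The uniqueness property is the same scalar equation for the
  functionals \<open>- \<phi>\<close> and \<open>\<phi>\<close> on two orbits. The obstacle is that
  \<open>lcs_integral\<close> is a description and \<open>lcs_laplace\<close> a limit: a functional
  passes through them only after existence is proved, without a norm and with sequential
  completeness alone. Hence integrands are kept in the form integrable scalar times continuous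
  function. Convolution calls for absolutely convergent transforms; these come from the abscissa of
  the modulus for \<open>a\<close> and \<open>b\<close> and from the growth bound for
  \<open>k1\<close>, while \<open>k\<close> has a convergent one.\<close>

definition sublinear :: "('a::real_vector \<Rightarrow> real) \<Rightarrow> bool" where
  "sublinear p \<longleftrightarrow> (\<forall>x y. p (x + y) \<le> p x + p y) \<and> (\<forall>c\<ge>0. \<forall>x. p (c *\<^sub>R x) = c * p x)"

lemma sublinear_add: "sublinear p \<Longrightarrow> p (x + y) \<le> p x + p y"
  and sublinear_scale: "sublinear p \<Longrightarrow> 0 \<le> c \<Longrightarrow> p (c *\<^sub>R x) = c * p x"
  by (auto simp: sublinear_def)

lemma sublinear_zero: "sublinear p \<Longrightarrow> p 0 = 0"
  using sublinear_scale[of p 0 0] by simp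

lemma sublinear_neg: "sublinear p \<Longrightarrow> - p (- x) \<le> p x"
  using sublinear_add[of p x "- x"] sublinear_zero[of p] by simp

text \<open>Zorn's lemma for the reversed pointwise order. The lower bound of a nonempty chain is
  its pointwise infimum, which is finite because every sublinear functional below \<open>p\<close>
  is at least \<open>- p (- x)\<close>.\<close>

lemma sublinear_minimal:
  assumes p: "sublinear p"
  obtains m where "sublinear m" "m \<le> p" "\<And>s. sublinear s \<Longrightarrow> s \<le> m \<Longrightarrow> s = m"
proof -
  define B where "B = {s. sublinear s \<and> s \<le> p}"
  have po: "partial_order_on B (relation_of (\<lambda>x y. y \<le> x) B)"
    by (rule partial_order_on_relation_ofI) auto
  have "\<exists>u\<in>B. \<forall>a\<in>C. u \<le> a" if C: "C \<in> Chains (relation_of (\<lambda>x y. y \<le> x) B)" for C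
  proof (cases "C = {}")
    case True
    then show ?thesis using p by (auto simp: B_def)
  next
    case False
    have CB: "C \<subseteq> B" using C by (rule Chains_relation_of)
    have tot: "a \<le> b \<or> b \<le> a" if "a \<in> C" "b \<in> C" for a b
      using C that unfolding Chains_def relation_of_def by blast
    define u where "u x = (INF s\<in>C. s x)" for x
    have lb: "- p (- x) \<le> s x" if "s \<in> C" for s x
    proof -
      have "s (- x) \<le> p (- x)" "sublinear s" using that CB by (auto simp: B_def le_fun_def)
      then show ?thesis using sublinear_neg[of s x] by linarith
    qed
    have bdd: "bdd_below ((\<lambda>s. s x) ` C)" for x
      by (rule bdd_belowI[of _ "- p (- x)"]) (use lb in auto)
    have u_le: "u x \<le> s x" if "s \<in> C" for s x
      unfolding u_def by (rule cINF_lower[OF bdd that])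
    have u_ge: "c \<le> u x" if "\<And>s. s \<in> C \<Longrightarrow> c \<le> s x" for c x
      unfolding u_def by (rule cINF_greatest) (use False that in auto)
    have "sublinear u"
      unfolding sublinear_def
    proof (intro conjI allI impI)
      fix x y
      \<comment> \<open>This is where the chain property enters: the smaller of \<open>s\<close> and
        \<open>s'\<close> bounds both terms, so its own subadditivity suffices.\<close>
      have *: "u (x + y) \<le> s x + s' y" if "s \<in> C" "s' \<in> C" for s s'
      proof -
        have sub: "sublinear s" "sublinear s'" using that CB by (auto simp: B_def)
        from tot[OF that] show ?thesis
        proof
          assume "s \<le> s'"
          then have "s y \<le> s' y" by (simp add: le_fun_def)
          then show ?thesis using u_le[OF that(1), of "x + y"] sublinear_add[OF sub(1), of x y] by linarith
        next
          assume "s' \<le> s"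
          then have "s' x \<le> s x" by (simp add: le_fun_def)
          then show ?thesis using u_le[OF that(2), of "x + y"] sublinear_add[OF sub(2), of x y] by linarith
        qed
      qed
      have "u (x + y) - s x \<le> u y" if "s \<in> C" for s
        by (rule u_ge) (use *[OF that] in force)
      then have "u (x + y) - u y \<le> u x"
        by (intro u_ge) force
      then show "u (x + y) \<le> u x + u y" by simp
    next
      fix c :: real and x assume c: "0 \<le> c"
      have sc: "s (c *\<^sub>R x) = c * s x" if "s \<in> C" for s
        using that CB c by (auto simp: B_def sublinear_scale)
      show "u (c *\<^sub>R x) = c * u x"
      proof (cases "c = 0")
        case True
        have "s 0 = 0" if "s \<in> C" for s using that CB by (auto simp: B_def sublinear_zero)
        then have "(\<lambda>s. s 0) ` C = (\<lambda>_. 0) ` C" by (intro image_cong refl)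
        then have "(\<lambda>s. s 0) ` C = {0}" using \<open>C \<noteq> {}\<close> by (simp add: image_constant_conv)
        then have "u 0 = 0" unfolding u_def by (simp only: cInf_singleton)
        then show ?thesis using True by simp
      next
        case False
        then have c: "c > 0" using c by simp
        show ?thesis
        proof (rule antisym)
          have "u (c *\<^sub>R x) / c \<le> u x"
            by (rule u_ge) (use u_le sc c in \<open>fastforce simp: field_simps\<close>)
          then show "u (c *\<^sub>R x) \<le> c * u x" using c by (simp add: field_simps)
          show "c * u x \<le> u (c *\<^sub>R x)"
            by (rule u_ge) (use u_le sc c in force)
        qed
      qed
    qed
    moreover obtain s where "s \<in> C" using False by blast
    then have "s \<le> p" "u \<le> s" using CB u_le by (auto simp: B_def intro: le_funI)
    then have "u \<le> p" by (rule order_trans[rotated])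
    ultimately show ?thesis using u_le by (auto simp: B_def le_fun_def)
  qed
  from predicate_Zorn[OF po this] obtain m where "m \<in> B" "\<forall>a\<in>B. a \<le> m \<longrightarrow> a = m" by blast
  then show ?thesis using that[of m] by (auto simp: B_def)
qed

text \<open>The greatest sublinear functional below \<open>p\<close> whose value at
  \<open>- v\<close> is at most \<open>- p v\<close>: if \<open>q\<close> is another, then
  \<open>q x \<le> q (x + t v) + t q (- v)\<close> for \<open>t \<ge> 0\<close>.\<close>

definition tilt :: "('a::real_vector \<Rightarrow> real) \<Rightarrow> 'a \<Rightarrow> 'a \<Rightarrow> real" where
  "tilt p v x = (INF t\<in>{0..}. p (x + t *\<^sub>R v) - t * p v)"

lemma tilt_le:
  assumes p: "sublinear p" and "t \<ge> 0"
  shows "tilt p v x \<le> p (x + t *\<^sub>R v) - t * p v"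
  unfolding tilt_def
proof (rule cINF_lower)
  show "bdd_below ((\<lambda>t. p (x + t *\<^sub>R v) - t * p v) ` {0..})"
  proof (rule bdd_belowI[of _ "- p (- x)"])
    fix y assume "y \<in> (\<lambda>t. p (x + t *\<^sub>R v) - t * p v) ` {0..}"
    then obtain t where "0 \<le> t" and y: "y = p (x + t *\<^sub>R v) - t * p v" by auto
    have "p (t *\<^sub>R v) \<le> p (x + t *\<^sub>R v) + p (- x)"
      using sublinear_add[OF p, of "x + t *\<^sub>R v" "- x"] by simp
    then show "- p (- x) \<le> y" using sublinear_scale[OF p \<open>0 \<le> t\<close>] y by simp
  qed
qed (use \<open>t \<ge> 0\<close> in auto)

lemma tilt_ge: "(\<And>t. t \<ge> 0 \<Longrightarrow> c \<le> p (x + t *\<^sub>R v) - t * p v) \<Longrightarrow> c \<le> tilt p v x"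
  unfolding tilt_def by (rule cINF_greatest) auto

lemma sublinear_tilt:
  assumes p: "sublinear p"
  shows "sublinear (tilt p v)" "tilt p v \<le> p"
proof -
  show "tilt p v \<le> p"
    using tilt_le[OF p, of 0 v] by (simp add: le_fun_def)
  show "sublinear (tilt p v)"
    unfolding sublinear_def
  proof (intro conjI allI impI)
    fix x y
    have *: "tilt p v (x + y) \<le> (p (x + s *\<^sub>R v) - s * p v) + (p (y + t *\<^sub>R v) - t * p v)"
      if "s \<ge> 0" "t \<ge> 0" for s t
    proof -
      have "x + y + (s + t) *\<^sub>R v = (x + s *\<^sub>R v) + (y + t *\<^sub>R v)" by (simp add: algebra_simps)
      then have "p (x + y + (s + t) *\<^sub>R v) \<le> p (x + s *\<^sub>R v) + p (y + t *\<^sub>R v)"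
        using sublinear_add[OF p] by metis
      then show ?thesis
        using tilt_le[OF p, of "s + t" v "x + y"] that by (simp add: algebra_simps)
    qed
    have "tilt p v (x + y) - (p (x + s *\<^sub>R v) - s * p v) \<le> tilt p v y" if "s \<ge> 0" for s
      by (rule tilt_ge) (use *[OF that] in force)
    then have "tilt p v (x + y) - tilt p v y \<le> tilt p v x"
      by (intro tilt_ge) force
    then show "tilt p v (x + y) \<le> tilt p v x + tilt p v y" by simp
  next
    fix c :: real and x assume "0 \<le> c"
    show "tilt p v (c *\<^sub>R x) = c * tilt p v x"
    proof (cases "c = 0")
      case True
      have "tilt p v 0 = 0"
      proof (rule antisym)
        show "tilt p v 0 \<le> 0" using tilt_le[OF p, of 0 v 0] sublinear_zero[OF p] by simp
        show "0 \<le> tilt p v 0" by (rule tilt_ge) (simp add: sublinear_scale[OF p])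
      qed
      then show ?thesis using True by simp
    next
      case False
      then have c: "c > 0" using \<open>0 \<le> c\<close> by simp
      \<comment> \<open>The substitution of \<open>c * t\<close> for \<open>t\<close> permutes the
        index set of the infimum, which yields both inequalities below.\<close>
      have eq: "p (c *\<^sub>R x + (c * t) *\<^sub>R v) - c * t * p v = c * (p (x + t *\<^sub>R v) - t * p v)" for t
      proof -
        have "c *\<^sub>R x + (c * t) *\<^sub>R v = c *\<^sub>R (x + t *\<^sub>R v)" by (simp add: algebra_simps)
        then show ?thesis using sublinear_scale[OF p, of c "x + t *\<^sub>R v"] c by (simp only:) (simp add: algebra_simps)
      qed
      show ?thesis
      proof (rule antisym)
        have "tilt p v (c *\<^sub>R x) / c \<le> tilt p v x"
        proof (rule tilt_ge)
          fix t :: real assume "t \<ge> 0"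
          then show "tilt p v (c *\<^sub>R x) / c \<le> p (x + t *\<^sub>R v) - t * p v"
            using tilt_le[OF p, of "c * t" v "c *\<^sub>R x"] eq[of t] c by (simp add: field_simps)
        qed
        then show "tilt p v (c *\<^sub>R x) \<le> c * tilt p v x" using c by (simp add: field_simps)
        show "c * tilt p v x \<le> tilt p v (c *\<^sub>R x)"
        proof (rule tilt_ge)
          fix t :: real assume "t \<ge> 0"
          then show "c * tilt p v x \<le> p (c *\<^sub>R x + t *\<^sub>R v) - t * p v"
            using tilt_le[OF p, of "t / c" v x] eq[of "t / c"] c by (simp add: field_simps)
        qed
      qed
    qed
  qed
qed

text \<open>A minimal sublinear functional is unchanged by every tilt, and this forces additivity.\<close>

lemma Hahn_Banach_sublinear:
  fixes p :: "'a::real_vector \<Rightarrow> real"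
  assumes p: "sublinear p"
  obtains u where "linear u" "u \<le> p" "u v = p v"
proof -
  \<comment> \<open>Minimality is taken below \<open>tilt p v\<close> instead of \<open>p\<close>;
    this fixes the value at \<open>v\<close>, since
    \<open>tilt p v (- v) \<le> - p v\<close>.\<close>
  obtain m where m: "sublinear m" "m \<le> tilt p v" and min: "\<And>s. sublinear s \<Longrightarrow> s \<le> m \<Longrightarrow> s = m"
    by (rule sublinear_minimal[OF sublinear_tilt(1)[OF p]]) blast
  have tilt: "tilt m w = m" for w
    using min sublinear_tilt[OF m(1)] by blast
  \<comment> \<open>With parameter 1, \<open>tilt m y x = m x\<close> gives
    \<open>m x \<le> m (x + y) - m y\<close>, the reverse of subadditivity.\<close>
  have add: "m (x + y) = m x + m y" for x y
    using tilt_le[OF m(1), of 1 y x] sublinear_add[OF m(1), of x y] by (simp add: tilt)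
  have neg: "m (- x) = - m x" for x
    using add[of x "- x"] sublinear_zero[OF m(1)] by simp
  have "m (c *\<^sub>R x) = c * m x" for c x
  proof (cases "c \<ge> 0")
    case True then show ?thesis by (rule sublinear_scale[OF m(1)])
  next
    case False
    then have "m (c *\<^sub>R x) = - m ((- c) *\<^sub>R x)" using neg[of "c *\<^sub>R x"] by simp
    also have "\<dots> = c * m x" using sublinear_scale[OF m(1), of "- c" x] False by simp
    finally show ?thesis .
  qed
  then have lin: "linear m" by (intro linearI) (auto simp: add)
  have le: "m \<le> p" using m(2) sublinear_tilt(2)[OF p, of v] by (rule order_trans)
  have "m (- v) \<le> tilt p v (- v)" using m(2) by (simp add: le_fun_def)
  also have "\<dots> \<le> - p v" using tilt_le[OF p, of 1 v "- v"] sublinear_zero[OF p] by simp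
  finally have "m v = p v" using le_funD[OF le, of v] neg[of v] by linarith
  then show ?thesis using that lin le by blast
qed

section \<open>Complex scalar multiplication: continuity and algebraic rules\<close>

lemma tendsto_scaleC:
  fixes g :: "'a \<Rightarrow> 'x::complex_lcs"
  assumes "(f \<longlongrightarrow> c) F" "(g \<longlongrightarrow> x) F"
  shows "((\<lambda>t. f t *\<^sub>C g t) \<longlongrightarrow> c *\<^sub>C x) F"
  using filterlim_compose[OF tendsto_scaleC_Pair filterlim_Pair[OF assms]] by simp

lemma continuous_on_scaleC:
  fixes g :: "'a::topological_space \<Rightarrow> 'x::complex_lcs"
  assumes "continuous_on S f" "continuous_on S g"
  shows "continuous_on S (\<lambda>t. f t *\<^sub>C g t)"
  using assms unfolding continuous_on_def by (blast intro: tendsto_scaleC)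

lemma scaleC_zero_left: "0 *\<^sub>C (x::'x::complex_lcs) = 0"
  using scaleR_scaleC[of 0 x] by simp

lemma scaleC_zero_right: "c *\<^sub>C (0::'x::complex_lcs) = 0"
  using scaleC_add_right[of c "0::'x" 0] by simp

lemma scaleC_minus_right: "c *\<^sub>C (- x) = - (c *\<^sub>C (x::'x::complex_lcs))"
  using scaleC_add_right[of c x "- x"] by (simp add: scaleC_zero_right eq_neg_iff_add_eq_0 add.commute)

lemma scaleC_minus_left: "(- c) *\<^sub>C x = - (c *\<^sub>C (x::'x::complex_lcs))"
  using scaleC_add_left[of c "- c" x] by (simp add: scaleC_zero_left eq_neg_iff_add_eq_0 add.commute)

lemma scaleC_diff_right: "c *\<^sub>C (x - y) = c *\<^sub>C x - c *\<^sub>C (y::'x::complex_lcs)"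
  using scaleC_add_right[of c x "- y"] by (simp add: scaleC_minus_right)

lemma scaleC_diff_left: "(c - d) *\<^sub>C x = c *\<^sub>C x - d *\<^sub>C (x::'x::complex_lcs)"
  using scaleC_add_left[of c "- d" x] by (simp add: scaleC_minus_left)

lemma scaleR_scaleC_commute: "r *\<^sub>R c *\<^sub>C x = c *\<^sub>C r *\<^sub>R (x::'x::complex_lcs)"
  by (simp add: scaleR_scaleC scaleC_scaleC mult.commute)

section \<open>Seminorms\<close>

definition cont_seminorm :: "('x::complex_lcs \<Rightarrow> real) \<Rightarrow> bool" where
  "cont_seminorm p \<longleftrightarrow> seminorm p \<and> continuous_on UNIV p"

lemma seminorm_add: "seminorm p \<Longrightarrow> p (x + y) \<le> p x + p y"
  and seminorm_scaleC: "seminorm p \<Longrightarrow> p (c *\<^sub>C x) = cmod c * p x"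
  by (auto simp: seminorm_def)

lemma seminorm_scaleR: "seminorm p \<Longrightarrow> p (r *\<^sub>R x) = \<bar>r\<bar> * p x"
  by (simp add: scaleR_scaleC seminorm_scaleC)

lemma seminorm_zero: "seminorm p \<Longrightarrow> p 0 = 0"
  using seminorm_scaleR[of p 0 0] by simp

lemma seminorm_minus: "seminorm p \<Longrightarrow> p (- x) = p x"
  using seminorm_scaleR[of p "-1" x] by simp

lemma seminorm_nonneg: "seminorm p \<Longrightarrow> 0 \<le> p x"
  using seminorm_add[of p x "- x"] seminorm_zero[of p] seminorm_minus[of p x] by simp

lemma seminorm_diff: "seminorm p \<Longrightarrow> p (x - y) \<le> p x + p y"
  using seminorm_add[of p x "- y"] seminorm_minus[of p y] by simp

lemma seminorm_triangle_diff: "seminorm p \<Longrightarrow> \<bar>p x - p y\<bar> \<le> p (x - y)"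
  using seminorm_add[of p "x - y" y] seminorm_add[of p "y - x" x] seminorm_minus[of p "x - y"] by simp

lemma seminorm_sublinear: "seminorm p \<Longrightarrow> sublinear p"
  by (auto simp: sublinear_def seminorm_add seminorm_scaleR)

text \<open>The inequality for \<open>inverse c\<close> is the reverse inequality for
  \<open>c\<close>, so homogeneity needs to be checked in one direction.\<close>

lemma seminormI:
  assumes add: "\<And>x y. p (x + y) \<le> p x + p y"
    and scale: "\<And>c x. p (c *\<^sub>C x) \<le> cmod c * p x"
    and nonneg: "\<And>x. 0 \<le> p x"
  shows "seminorm p"
  unfolding seminorm_def
proof (intro conjI allI add antisym scale)
  fix c x
  show "cmod c * p x \<le> p (c *\<^sub>C x)"
  proof (cases "c = 0")
    case False
    have "p (inverse c *\<^sub>C c *\<^sub>C x) \<le> cmod (inverse c) * p (c *\<^sub>C x)" by (rule scale)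
    then have "p x \<le> p (c *\<^sub>C x) / cmod c"
      using False by (simp add: scaleC_scaleC scaleC_one norm_inverse divide_inverse mult.commute)
    then show ?thesis using False by (simp add: pos_le_divide_eq mult.commute)
  qed (use nonneg in auto)
qed

lemma cont_seminormI:
  fixes p :: "'x::complex_lcs \<Rightarrow> real"
  assumes p: "seminorm p" and V: "open V" "0 \<in> V" "\<And>x. x \<in> V \<Longrightarrow> p x \<le> 1"
  shows "cont_seminorm p"
  unfolding cont_seminorm_def
proof (intro conjI p)
  show "continuous_on UNIV p"
    unfolding continuous_on_def
  proof (intro ballI tendstoI)
    fix x :: 'x and e :: real assume e: "e > 0"
    \<comment> \<open>The factor \<open>2 / e\<close> turns the bound 1 on \<open>V\<close> into
      \<open>e / 2\<close>, which leaves room for the strict inequality.\<close>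
    have "((\<lambda>y. complex_of_real (2 / e) *\<^sub>C (y - x)) \<longlongrightarrow> complex_of_real (2 / e) *\<^sub>C (x - x)) (at x)"
      by (intro tendsto_scaleC tendsto_diff tendsto_const tendsto_ident_at)
    then have "((\<lambda>y. complex_of_real (2 / e) *\<^sub>C (y - x)) \<longlongrightarrow> 0) (at x)" by (simp add: scaleC_zero_right)
    then have "\<forall>\<^sub>F y in at x. complex_of_real (2 / e) *\<^sub>C (y - x) \<in> V"
      using V(1,2) by (rule topological_tendstoD)
    then show "\<forall>\<^sub>F y in at x. dist (p y) (p x) < e"
    proof eventually_elim
      case (elim y)
      then have "(2 / e) * p (y - x) \<le> 1"
        using V(3)[OF elim] e seminorm_scaleC[OF p, of "complex_of_real (2 / e)" "y - x"]
        by (simp del: of_real_divide)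
      then have "p (y - x) \<le> e / 2" using e by (simp add: field_simps)
      then show ?case using seminorm_triangle_diff[OF p, of y x] e by (simp add: dist_real_def)
    qed
  qed
qed

lemma open_seminorm_ball: "cont_seminorm p \<Longrightarrow> open {x. p x < e}"
  by (auto simp: cont_seminorm_def intro!: open_Collect_less continuous_on_const)

text \<open>The seminorm is the Minkowski functional of \<open>H\<close>, the balanced core of a
  convex neighbourhood \<open>V\<close>. Joint continuity of scalar multiplication at the origin
  puts an open \<open>N\<close> inside \<open>H\<close>, and \<open>N\<close> makes \<open>H\<close>
  absorbing and the functional continuous.\<close>

lemma cont_seminorm_in_neighbourhood:
  fixes U :: "'x::complex_lcs set"
  assumes "open U" "0 \<in> U"
  obtains p where "cont_seminorm p" "\<And>x. p x < 1 \<Longrightarrow> x \<in> U"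
proof -
  obtain V where V: "open V" "0 \<in> V" "V \<subseteq> U"
    and conv: "\<And>x y u v. x \<in> V \<Longrightarrow> y \<in> V \<Longrightarrow> u \<ge> 0 \<Longrightarrow> v \<ge> 0 \<Longrightarrow> u + v = (1::real) \<Longrightarrow> u *\<^sub>R x + v *\<^sub>R y \<in> V"
    using locally_convex[OF assms] by metis
  define H where "H = {x. \<forall>c. cmod c \<le> 1 \<longrightarrow> c *\<^sub>C x \<in> V}"
  have H0: "0 \<in> H" using V by (simp add: H_def scaleC_zero_right)
  have Hconv: "u *\<^sub>R x + v *\<^sub>R y \<in> H" if "x \<in> H" "y \<in> H" "u \<ge> 0" "v \<ge> 0" "u + v = (1::real)" for x y u v
    using that conv by (auto simp: H_def scaleC_add_right scaleR_scaleC_commute[symmetric])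
  have Hbal: "c *\<^sub>C x \<in> H" if "x \<in> H" "cmod c \<le> 1" for c x
  proof -
    have "cmod (d * c) \<le> 1" if "cmod d \<le> 1" for d
      using that \<open>cmod c \<le> 1\<close> by (simp add: norm_mult mult_le_one)
    then show ?thesis using \<open>x \<in> H\<close> by (auto simp: H_def scaleC_scaleC)
  qed
  obtain N where N: "open N" "0 \<in> N" "N \<subseteq> H"
  proof -
    have "\<forall>\<^sub>F z in nhds (0::complex) \<times>\<^sub>F nhds (0::'x). fst z *\<^sub>C snd z \<in> V"
      using tendsto_scaleC_Pair[of 0 "0::'x"] V by (auto simp: tendsto_def scaleC_zero_right filterlim_def le_filter_def eventually_filtermap intro: eventually_nhds_in_open)
    then obtain P Q where PQ: "eventually P (nhds 0)" "eventually Q (nhds (0::'x))"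
      "\<And>c x. P c \<Longrightarrow> Q x \<Longrightarrow> c *\<^sub>C x \<in> V"
      unfolding eventually_prod_filter by auto
    obtain r where r: "r > 0" "\<And>c. cmod c < r \<Longrightarrow> P c"
      using PQ(1) unfolding eventually_nhds_metric by (auto simp: dist_norm)
    obtain M where M: "open M" "0 \<in> M" "\<And>x. x \<in> M \<Longrightarrow> Q x"
      using PQ(2) unfolding eventually_nhds by blast
    \<comment> \<open>Stretching by \<open>2 / r\<close> lets scalars of modulus at most
      \<open>r / 2\<close>, hence below \<open>r\<close>, stand for the whole unit disc.\<close>
    define h where "h x = complex_of_real (2 / r) *\<^sub>C x" for x :: 'x
    have "continuous_on UNIV h"
      unfolding h_def by (intro continuous_on_scaleC continuous_on_const continuous_on_id)
    then have op: "open (h -` M)" using M(1) open_vimage by blast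
    have "h -` M \<subseteq> H"
    proof (clarsimp simp: H_def)
      fix x c assume x: "h x \<in> M" and c: "cmod c \<le> 1"
      have "c * complex_of_real (r / 2) * complex_of_real (2 / r) = c" using r(1) by simp
      moreover have "(c * complex_of_real (r / 2)) *\<^sub>C h x
          = (c * complex_of_real (r / 2) * complex_of_real (2 / r)) *\<^sub>C x"
        by (simp only: h_def scaleC_scaleC)
      ultimately have "c *\<^sub>C x = (c * complex_of_real (r / 2)) *\<^sub>C h x" by (simp only:)
      moreover have "cmod (c * complex_of_real (r / 2)) < r"
        using c r(1) mult_right_mono[OF c, of "r/2"] by (simp add: norm_mult del: of_real_divide)
      ultimately show "c *\<^sub>C x \<in> V" using PQ(3) r(2) M(3)[OF x] by auto
    qed
    then show thesis using that[OF op] M(2) by (simp add: h_def scaleC_zero_right)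
  qed
  define T where "T x = {t::real. t > 0 \<and> (1 / t) *\<^sub>R x \<in> H}" for x
  define p where "p x = Inf (T x)" for x
  have Tne: "T x \<noteq> {}" for x
  proof -
    have "((\<lambda>n. complex_of_real (1 / real (Suc n)) *\<^sub>C x) \<longlongrightarrow> complex_of_real 0 *\<^sub>C x) sequentially"
      by (intro tendsto_scaleC tendsto_of_real tendsto_const) (use LIMSEQ_inverse_real_of_nat in \<open>simp add: inverse_eq_divide\<close>)
    then have "\<forall>\<^sub>F n in sequentially. complex_of_real (1 / real (Suc n)) *\<^sub>C x \<in> N"
      using N by (intro topological_tendstoD[OF _ N(1)]) (auto simp: scaleC_zero_left)
    then obtain n where "(1 / real (Suc n)) *\<^sub>R x \<in> N"
      by (auto simp: eventually_sequentially scaleR_scaleC)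
    then show ?thesis using N by (auto simp: T_def intro!: exI[of _ "real (Suc n)"])
  qed
  have bdd: "bdd_below (T x)" for x by (rule bdd_belowI[of _ 0]) (auto simp: T_def)
  have p_le: "p x \<le> t" if "t \<in> T x" for x t unfolding p_def by (rule cInf_lower[OF that bdd])
  have p_ge: "c \<le> p x" if "\<And>t. t \<in> T x \<Longrightarrow> c \<le> t" for x c
    unfolding p_def by (rule cInf_greatest[OF Tne that])
  have sem: "seminorm p"
  proof (rule seminormI)
    fix x y
    have *: "p (x + y) \<le> s + t" if "s \<in> T x" "t \<in> T y" for s t
    proof (rule p_le)
      have pos: "s > 0" "t > 0" using that by (auto simp: T_def)
      \<comment> \<open>\<open>(x + y) / (s + t)\<close> as a convex combination of
        \<open>x / s\<close> and \<open>y / t\<close>.\<close>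
      have "(s / (s + t)) *\<^sub>R (1 / s) *\<^sub>R x + (t / (s + t)) *\<^sub>R (1 / t) *\<^sub>R y \<in> H"
        using that pos by (intro Hconv) (auto simp: T_def add_divide_distrib[symmetric])
      then show "s + t \<in> T (x + y)" using pos by (simp add: T_def scaleR_add_right)
    qed
    have "p (x + y) - s \<le> p y" if "s \<in> T x" for s
      by (rule p_ge) (use *[OF that] in force)
    then have "p (x + y) - p y \<le> p x" by (intro p_ge) force
    then show "p (x + y) \<le> p x + p y" by simp
  next
    fix c x
    show "p (c *\<^sub>C x) \<le> cmod c * p x"
    proof (cases "c = 0")
      case True
      have "p 0 \<le> e" if "e > 0" for e by (rule p_le) (use that H0 in \<open>auto simp: T_def\<close>)
      then have "p 0 \<le> 0" by (rule field_le_epsilon[of "p 0" 0, simplified])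
      then show ?thesis using True by (simp add: scaleC_zero_left)
    next
      case False
      have "p (c *\<^sub>C x) / cmod c \<le> p x"
      proof (rule p_ge)
        fix t assume t: "t \<in> T x"
        have "(c / of_real (cmod c)) *\<^sub>C (1 / t) *\<^sub>R x \<in> H"
          using t False by (intro Hbal) (auto simp: T_def norm_divide)
        then have "cmod c * t \<in> T (c *\<^sub>C x)"
          using t False by (simp add: T_def scaleR_scaleC scaleC_scaleC mult.commute)
        then show "p (c *\<^sub>C x) / cmod c \<le> t" using False p_le by (simp add: field_simps)
      qed
      then show ?thesis using False by (simp add: field_simps)
    qed
  next
    show "0 \<le> p x" for x by (rule p_ge) (auto simp: T_def)
  qed
  have "cont_seminorm p"
  proof (rule cont_seminormI[OF sem N(1,2)])
    show "p x \<le> 1" if "x \<in> N" for x by (rule p_le) (use that N in \<open>auto simp: T_def\<close>)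
  qed
  moreover have "x \<in> U" if "p x < 1" for x
  proof -
    have "\<not> (\<forall>t\<in>T x. 1 \<le> t)" using p_ge[of x 1] that by auto
    then obtain t where t: "t \<in> T x" "t < 1" by force
    \<comment> \<open>Since \<open>t < 1\<close> and \<open>H\<close> is balanced,
      \<open>x = t (x / t)\<close> lies in \<open>H\<close>, and the scalar 1 in the definition of
      \<open>H\<close> puts it in \<open>V\<close>.\<close>
    have "complex_of_real t *\<^sub>C (1 / t) *\<^sub>R x \<in> H" using t by (intro Hbal) (auto simp: T_def)
    then have "1 *\<^sub>C x \<in> H" using t by (simp add: T_def scaleR_scaleC scaleC_scaleC)
    then have "1 *\<^sub>C 1 *\<^sub>C x \<in> V" unfolding H_def by force
    then show ?thesis using V by (auto simp: scaleC_one)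
  qed
  ultimately show ?thesis using that by blast
qed

lemma tendsto_seminorms:
  fixes f :: "'a \<Rightarrow> 'x::complex_lcs"
  assumes "\<And>p. cont_seminorm p \<Longrightarrow> ((\<lambda>t. p (f t - x)) \<longlongrightarrow> 0) F"
  shows "(f \<longlongrightarrow> x) F"
proof (rule topological_tendstoI)
  fix S assume S: "open S" "x \<in> S"
  have "open ((\<lambda>y. x + y) -` S)"
    using S by (intro open_vimage continuous_on_add continuous_on_const continuous_on_id)
  then obtain p where p: "cont_seminorm p" "\<And>y. p y < 1 \<Longrightarrow> y \<in> (\<lambda>y. x + y) -` S"
    using cont_seminorm_in_neighbourhood[of "(\<lambda>y. x + y) -` S"] S by auto
  have "\<forall>\<^sub>F t in F. p (f t - x) < 1"
    using order_tendstoD(2)[OF assms[OF p(1)], of 1] by simp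
  then show "\<forall>\<^sub>F t in F. f t \<in> S"
    by eventually_elim (use p(2) in force)
qed

lemma cont_seminorm_tendsto:
  assumes p: "cont_seminorm p" and f: "(f \<longlongrightarrow> x) F"
  shows "((\<lambda>t. p (f t - x)) \<longlongrightarrow> 0) F"
proof -
  have "isCont p 0" using p by (simp add: cont_seminorm_def continuous_on_eq_continuous_at)
  moreover have "((\<lambda>t. f t - x) \<longlongrightarrow> 0) F" using tendsto_diff[OF f tendsto_const[of x]] by simp
  ultimately have "((\<lambda>t. p (f t - x)) \<longlongrightarrow> p 0) F" by (rule isCont_tendsto_compose)
  then show ?thesis using p by (simp add: cont_seminorm_def seminorm_zero)
qed

section \<open>Separation of closed subspaces\<close>

lemma cont_linear_add: "cont_linear T \<Longrightarrow> T (x + y) = T x + T y"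
  and cont_linear_scaleC: "cont_linear T \<Longrightarrow> T (c *\<^sub>C x) = c *\<^sub>C T x"
  and cont_linear_continuous: "cont_linear T \<Longrightarrow> continuous_on UNIV T"
  by (auto simp: cont_linear_def)

lemma cont_linear_zero: "cont_linear T \<Longrightarrow> T 0 = 0"
  using cont_linear_add[of T 0 0] by simp

lemma cont_linear_minus: "cont_linear T \<Longrightarrow> T (- x) = - T x"
  using cont_linear_add[of T x "- x"] by (simp add: cont_linear_zero eq_neg_iff_add_eq_0 add.commute)

lemma cont_linear_diff: "cont_linear T \<Longrightarrow> T (x - y) = T x - T y"
  using cont_linear_add[of T x "- y"] by (simp add: cont_linear_minus)

lemma cont_linear_scaleR: "cont_linear T \<Longrightarrow> T (r *\<^sub>R x) = r *\<^sub>R T x"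
  by (simp add: scaleR_scaleC cont_linear_scaleC)

lemma cont_linear_compose: "cont_linear S \<Longrightarrow> cont_linear T \<Longrightarrow> cont_linear (\<lambda>x. S (T x))"
  unfolding cont_linear_def by (auto intro: continuous_on_compose2[of UNIV S])

lemma cont_linear_seminorm:
  assumes "cont_linear T" "cont_seminorm p"
  shows "cont_seminorm (\<lambda>x. p (T x))"
  using assms unfolding cont_seminorm_def seminorm_def cont_linear_def
  by (auto intro: continuous_on_compose2[of UNIV p])

lemma cont_seminorm_cmod: "cont_seminorm cmod"
  unfolding cont_seminorm_def seminorm_def
  by (auto simp: scaleC_complex_def norm_mult norm_triangle_ineq intro: continuous_on_norm continuous_on_id)

text \<open>The only complex-linear functional with real part \<open>u\<close>.\<close>

definition complexify :: "('x::complex_lcs \<Rightarrow> real) \<Rightarrow> 'x \<Rightarrow> complex" where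
  "complexify u x = Complex (u x) (- u (\<i> *\<^sub>C x))"

lemma complexify:
  fixes u :: "'x::complex_lcs \<Rightarrow> real"
  assumes u: "linear u" and le_p: "\<And>x. u x \<le> p x" and p: "cont_seminorm p"
  shows "cont_linear (complexify u)" "cmod (complexify u x) \<le> p x"
proof -
  let ?\<phi> = "complexify u"
  have sem: "seminorm p" using p by (simp add: cont_seminorm_def)
  have uadd: "u (x + y) = u x + u y" and uscale: "u (r *\<^sub>R x) = r * u x" for x y r
    using u by (auto simp: linear_add linear_scale)
  have add: "?\<phi> (x + y) = ?\<phi> x + ?\<phi> y" for x y
    by (simp add: complexify_def complex_eq_iff uadd scaleC_add_right)
  have scale: "?\<phi> (c *\<^sub>C x) = c *\<^sub>C ?\<phi> x" for c x
  proof -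
    have split: "c *\<^sub>C x = Re c *\<^sub>R x + Im c *\<^sub>R (\<i> *\<^sub>C x)" for c and x :: 'x
      using scaleC_add_left[of "of_real (Re c)" "of_real (Im c) * \<i>" x] complex_eq[of c]
      by (simp add: scaleR_scaleC scaleC_scaleC mult.commute)
    have "\<i> *\<^sub>C c *\<^sub>C x = (\<i> * c) *\<^sub>C x" by (simp add: scaleC_scaleC)
    also have "\<dots> = - Im c *\<^sub>R x + Re c *\<^sub>R (\<i> *\<^sub>C x)" by (subst split) simp
    finally have "u (\<i> *\<^sub>C c *\<^sub>C x) = - Im c * u x + Re c * u (\<i> *\<^sub>C x)" by (simp only: uadd uscale)
    moreover have "u (c *\<^sub>C x) = Re c * u x + Im c * u (\<i> *\<^sub>C x)" by (subst split) (simp only: uadd uscale)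
    ultimately show ?thesis by (simp add: complexify_def complex_eq_iff scaleC_complex_def)
  qed
  show le: "cmod (?\<phi> x) \<le> p x" for x
  proof (cases "?\<phi> x = 0")
    case True then show ?thesis using seminorm_nonneg[OF sem] by simp
  next
    case False
    \<comment> \<open>A rotation by a unimodular scalar makes the value real and nonnegative; there
      it equals \<open>u\<close>, and \<open>p\<close> does not see the rotation.\<close>
    define c where "c = of_real (cmod (?\<phi> x)) / ?\<phi> x"
    have c: "cmod c = 1" using False by (simp add: c_def norm_divide)
    have "?\<phi> (c *\<^sub>C x) = of_real (cmod (?\<phi> x))" using False by (simp add: scale scaleC_complex_def c_def)
    then have "u (c *\<^sub>C x) = cmod (?\<phi> x)" by (simp add: complexify_def complex_eq_iff)
    moreover have "u (c *\<^sub>C x) \<le> p x" using le_p[of "c *\<^sub>C x"] seminorm_scaleC[OF sem, of c x] c by simp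
    ultimately show ?thesis by simp
  qed
  have "continuous_on UNIV ?\<phi>"
    unfolding continuous_on_def
  proof (intro ballI)
    fix x
    have lim: "((\<lambda>y. p (y - x)) \<longlongrightarrow> 0) (at x)" by (rule cont_seminorm_tendsto[OF p tendsto_ident_at])
    have le': "norm (?\<phi> y - ?\<phi> x) \<le> p (y - x)" for y
      using add[of "y - x" x] le[of "y - x"] by simp
    have "((\<lambda>y. ?\<phi> y - ?\<phi> x) \<longlongrightarrow> 0) (at x)"
      by (rule Lim_null_comparison[OF always_eventually lim]) (intro allI le')
    then show "(?\<phi> \<longlongrightarrow> ?\<phi> x) (at x within UNIV)" using LIM_zero_iff by blast
  qed
  then show "cont_linear ?\<phi>" by (auto simp: cont_linear_def add scale)
qed

lemma Hahn_Banach_seminorm: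
  fixes p :: "'x::complex_lcs \<Rightarrow> real"
  assumes p: "cont_seminorm p"
  obtains \<phi> :: "'x \<Rightarrow> complex" where "cont_linear \<phi>" "\<And>x. cmod (\<phi> x) \<le> p x" "\<phi> v = of_real (p v)"
proof -
  have sem: "seminorm p" using p by (simp add: cont_seminorm_def)
  obtain u where u: "linear u" "u \<le> p" "u v = p v"
    by (rule Hahn_Banach_sublinear[OF seminorm_sublinear[OF sem]])
  have \<phi>: "cont_linear (complexify u)" "\<And>x. cmod (complexify u x) \<le> p x"
    using complexify[OF u(1) _ p] u(2) by (auto simp: le_fun_def)
  have Re: "Re (complexify u v) = p v" using u(3) by (simp add: complexify_def)
  \<comment> \<open>The real part already exhausts the bound \<open>p v\<close> on the
    modulus.\<close>
  then have "Im (complexify u v) = 0"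
    using cmod_power2[of "complexify u v"] power_mono[OF \<phi>(2)[of v], of 2] by (auto simp: power2_eq_square mult_le_0_iff)
  then have "complexify u v = of_real (p v)" using Re by (simp add: complex_eq_iff)
  then show ?thesis using that \<phi> by blast
qed

lemma eq_zero_if_functionals_vanish:
  fixes v :: "'x::complex_lcs"
  assumes "\<And>\<phi> :: 'x \<Rightarrow> complex. cont_linear \<phi> \<Longrightarrow> \<phi> v = 0"
  shows "v = 0"
proof (rule ccontr)
  assume "v \<noteq> 0"
  then obtain U where U: "open U" "0 \<in> U" "v \<notin> U" using t1_space[of 0 v] by auto
  obtain p where p: "cont_seminorm p" "\<And>x. p x < 1 \<Longrightarrow> x \<in> U"
    by (rule cont_seminorm_in_neighbourhood[OF U(1,2)]) blast
  obtain \<phi> :: "'x \<Rightarrow> complex" where "cont_linear \<phi>" "\<phi> v = of_real (p v)" by (rule Hahn_Banach_seminorm[OF p(1), where v = v]) blast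
  then have "p v = 0" using assms by force
  then show False using p(2)[of v] U(3) by simp
qed

lemma eqI_functionals:
  fixes v w :: "'x::complex_lcs"
  assumes "\<And>\<phi> :: 'x \<Rightarrow> complex. cont_linear \<phi> \<Longrightarrow> \<phi> v = \<phi> w"
  shows "v = w"
  using eq_zero_if_functionals_vanish[of "v - w"] assms by (simp add: cont_linear_diff)

text \<open>
  The product of two \<^class>\<open>complex_lcs\<close> types is not an instance of that class, because the
  library already declares products as topological monoids for normed spaces only. Hence the
  functional on the product is given by its two components; it is obtained from the quotient
  seminorm modulo the subspace.
\<close>

lemma closed_subspace_Times_memI:
  fixes A :: "('x::complex_lcs \<times> 'y::complex_lcs) set"
  assumes cl: "closed A" and zero: "(0, 0) \<in> A"
    and add: "\<And>x y x' y'. (x, y) \<in> A \<Longrightarrow> (x', y') \<in> A \<Longrightarrow> (x + x', y + y') \<in> A"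
    and scale: "\<And>c x y. (x, y) \<in> A \<Longrightarrow> (c *\<^sub>C x, c *\<^sub>C y) \<in> A"
    and ann: "\<And>\<phi> :: 'x \<Rightarrow> complex. \<And>\<psi> :: 'y \<Rightarrow> complex. cont_linear \<phi> \<Longrightarrow> cont_linear \<psi> \<Longrightarrow>
      (\<And>x y. (x, y) \<in> A \<Longrightarrow> \<phi> x + \<psi> y = 0) \<Longrightarrow> \<phi> v + \<psi> w = 0"
  shows "(v, w) \<in> A"
proof (rule ccontr)
  assume vw: "(v, w) \<notin> A"
  have "open (- A)" "(v, w) \<in> - A" using cl vw by auto
  then obtain V W where VW: "open V" "open W" "v \<in> V" "w \<in> W" "V \<times> W \<subseteq> - A"
    by (rule open_prod_elim) auto
  have "open ((\<lambda>y. v - y) -` V)" "open ((\<lambda>y. w - y) -` W)"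
    using VW by (auto intro!: open_vimage continuous_on_diff continuous_on_const continuous_on_id)
  with VW obtain p p' where p: "cont_seminorm p" "\<And>x. p x < 1 \<Longrightarrow> v - x \<in> V"
    and p': "cont_seminorm p'" "\<And>x. p' x < 1 \<Longrightarrow> w - x \<in> W"
    using cont_seminorm_in_neighbourhood[of "(\<lambda>y. v - y) -` V"]
      cont_seminorm_in_neighbourhood[of "(\<lambda>y. w - y) -` W"] by (metis diff_zero vimageD vimageI)
  have sem: "seminorm p" "seminorm p'" using p p' by (auto simp: cont_seminorm_def)
  define P where "P z = p (fst z) + p' (snd z)" for z
  have P: "sublinear P"
    unfolding sublinear_def
  proof (intro conjI allI impI)
    fix z z'
    show "P (z + z') \<le> P z + P z'"
      using seminorm_add[OF sem(1), of "fst z" "fst z'"] seminorm_add[OF sem(2), of "snd z" "snd z'"] by (simp add: P_def)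
  qed (simp add: P_def seminorm_scaleR[OF sem(1)] seminorm_scaleR[OF sem(2)] algebra_simps)
  have Pnn: "0 \<le> P z" for z using seminorm_nonneg[OF sem(1)] seminorm_nonneg[OF sem(2)] by (simp add: P_def)
  have addA: "a + b \<in> A" if "a \<in> A" "b \<in> A" for a b using add[of "fst a" "snd a" "fst b" "snd b"] that
    by (simp add: plus_prod_def)
  have scaleA: "r *\<^sub>R a \<in> A" if "a \<in> A" for a r using scale[of "fst a" "snd a" "of_real r"] that
    by (simp add: scaleR_prod_def scaleR_scaleC)
  define q where "q x = (INF a\<in>A. P (x - a))" for x
  have bdd: "bdd_below ((\<lambda>a. P (x - a)) ` A)" for x
    by (rule bdd_belowI[of _ 0]) (auto simp: Pnn)
  have q_le: "q x \<le> P (x - a)" if "a \<in> A" for x a unfolding q_def by (rule cINF_lower[OF bdd that])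
  have q_ge: "c \<le> q x" if "\<And>a. a \<in> A \<Longrightarrow> c \<le> P (x - a)" for x c
    unfolding q_def by (rule cINF_greatest) (use zero that in auto)
  have q0: "q z = 0" if "z \<in> A" for z
    using q_le[OF that, of z] q_ge[of 0 z] Pnn sublinear_zero[OF P] by (auto intro: antisym)
  have q_scale: "q (c *\<^sub>R x) \<le> c * q x" if c: "c > 0" for c x
  proof -
    have "q (c *\<^sub>R x) / c \<le> q x"
    proof (rule q_ge)
      fix a assume "a \<in> A"
      then have "q (c *\<^sub>R x) \<le> c * P (x - a)"
        using q_le[OF scaleA, of a "c *\<^sub>R x" c] sublinear_scale[OF P, of c "x - a"] c by (simp add: scaleR_diff_right)
      then show "q (c *\<^sub>R x) / c \<le> P (x - a)" using c by (simp add: field_simps)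
    qed
    then show ?thesis using c by (simp add: field_simps)
  qed
  have q: "sublinear q"
    unfolding sublinear_def
  proof (intro conjI allI impI)
    fix x y
    have *: "q (x + y) \<le> P (x - a) + P (y - b)" if "a \<in> A" "b \<in> A" for a b
      using q_le[OF addA[OF that], of "x + y"] sublinear_add[OF P, of "x - a" "y - b"] by (simp add: algebra_simps)
    have "q (x + y) - P (x - a) \<le> q y" if "a \<in> A" for a
      by (rule q_ge) (use *[OF that] in force)
    then have "q (x + y) - q y \<le> q x" by (intro q_ge) force
    then show "q (x + y) \<le> q x + q y" by simp
  next
    fix c :: real and x assume "0 \<le> c"
    show "q (c *\<^sub>R x) = c * q x"
    proof (cases "c = 0")
      case True
      then show ?thesis using q0[OF zero] by (simp add: zero_prod_def)
    next
      case False
      then have c: "c > 0" using \<open>0 \<le> c\<close> by simp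
      have "q x \<le> (1 / c) * q (c *\<^sub>R x)" using q_scale[of "1 / c" "c *\<^sub>R x"] c by simp
      then show ?thesis using q_scale[OF c, of x] c by (simp add: field_simps)
    qed
  qed
  obtain u where u: "linear u" "u \<le> q" "u (v, w) = q (v, w)" by (rule Hahn_Banach_sublinear[OF q])
  define u1 where "u1 x = u (x, 0)" for x
  define u2 where "u2 y = u (0, y)" for y
  have u12: "u (x, y) = u1 x + u2 y" for x y
    using linear_add[OF u(1), of "(x, 0)" "(0, y)"] by (simp add: u1_def u2_def)
  have uP: "u z \<le> P z" for z
    using le_funD[OF u(2), of z] q_le[OF zero, of z] by (simp add: zero_prod_def[symmetric])
  have lin: "linear u1" "linear u2"
    using linear_add[OF u(1), of "(_, 0)" "(_, 0)"] linear_add[OF u(1), of "(0, _)" "(0, _)"]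
      linear_scale[OF u(1), of _ "(_, 0)"] linear_scale[OF u(1), of _ "(0, _)"]
    by (auto simp: u1_def u2_def intro!: linearI)
  have le: "u1 x \<le> p x" "u2 y \<le> p' y" for x y
    using uP[of "(x, 0)"] uP[of "(0, y)"] by (auto simp: u1_def u2_def P_def seminorm_zero[OF sem(1)] seminorm_zero[OF sem(2)])
  note \<phi> = complexify(1)[OF lin(1) le(1) p(1)] and \<psi> = complexify(1)[OF lin(2) le(2) p'(1)]
  \<comment> \<open>\<open>u \<le> q\<close> and \<open>q\<close> vanishes at both \<open>z\<close>
    and \<open>- z\<close>.\<close>
  have uA: "u z = 0" if "z \<in> A" for z
    using le_funD[OF u(2), of z] le_funD[OF u(2), of "- z"] q0[OF that] q0[OF scaleA[OF that, of "-1"]] linear_neg[OF u(1), of z]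
    by simp
  \<comment> \<open>The real part vanishes since \<open>u\<close> does on \<open>A\<close>, the
    imaginary part since \<open>A\<close> is closed under multiplication by
    \<open>\<i>\<close>.\<close>
  have "complexify u1 x + complexify u2 y = 0" if "(x, y) \<in> A" for x y
    using uA[OF that] uA[OF scale[OF that, of \<i>]] u12[of x y] u12[of "\<i> *\<^sub>C x" "\<i> *\<^sub>C y"]
    by (simp add: complexify_def complex_eq_iff)
  then have "complexify u1 v + complexify u2 w = 0" by (rule ann[OF \<phi> \<psi>])
  then have "q (v, w) = 0" using u(3) u12[of v w] by (simp add: complexify_def complex_eq_iff)
  \<comment> \<open>No point of \<open>A\<close> is closer than 1 in \<open>P\<close> to
    \<open>(v, w)\<close>, because the unit ball of \<open>P\<close> around it stays in
    \<open>V \<times> W\<close>, outside \<open>A\<close>.\<close>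
  moreover have "1 \<le> q (v, w)"
  proof (rule q_ge)
    fix z assume z: "z \<in> A"
    show "1 \<le> P ((v, w) - z)"
    proof (rule ccontr)
      assume "\<not> ?thesis"
      then have "p (v - fst z) < 1" "p' (w - snd z) < 1"
        using seminorm_nonneg[OF sem(1), of "v - fst z"] seminorm_nonneg[OF sem(2), of "w - snd z"] by (auto simp: P_def)
      then have "(fst z, snd z) \<in> V \<times> W" using p(2) p'(2) by force
      then show False using z VW(5) by auto
    qed
  qed
  ultimately show False by simp
qed

section \<open>Integration\<close>

lemma cont_linear_imp_linear: "cont_linear T \<Longrightarrow> linear T"
  by (auto intro!: linearI simp: cont_linear_add cont_linear_scaleR)

lemma simple_bochner_integrable_cont_linear:
  assumes "Bochner_Integration.simple_bochner_integrable M s" "cont_linear T"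
  shows "Bochner_Integration.simple_bochner_integrable M (\<lambda>x. T (s x))"
  using Bochner_Integration.simple_bochner_integrable_compose2[of "\<lambda>x y. T x", OF _ assms(1) assms(1)] assms(2)
  by (simp add: cont_linear_zero)

text \<open>The modulus of \<open>\<phi>\<close> is one of the continuous seminorms in the
  definition, so the images of the simple functions under \<open>\<phi>\<close> form an
  approximating sequence for the scalar Bochner integral.\<close>

lemma has_lcs_integral_functional:
  fixes \<phi> :: "'x::complex_lcs \<Rightarrow> complex"
  assumes F: "has_lcs_integral M F v" and \<phi>: "cont_linear \<phi>" and meas: "(\<lambda>t. \<phi> (F t)) \<in> borel_measurable M"
  shows "has_bochner_integral M (\<lambda>t. \<phi> (F t)) (\<phi> v)"
proof -
  obtain s where s: "\<And>n::nat. Bochner_Integration.simple_bochner_integrable M (s n)"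
    and conv: "\<And>p. cont_seminorm p \<Longrightarrow> (\<lambda>n. \<integral>\<^sup>+ t. ennreal (p (F t - s n t)) \<partial>M) \<longlonglongrightarrow> 0"
    and v: "(\<lambda>n. Bochner_Integration.simple_bochner_integral M (s n)) \<longlonglongrightarrow> v"
    using F unfolding has_lcs_integral_def cont_seminorm_def by blast
  show ?thesis
  proof (rule has_bochner_integral.intros[OF meas])
    show "Bochner_Integration.simple_bochner_integrable M (\<lambda>t. \<phi> (s n t))" for n
      by (rule simple_bochner_integrable_cont_linear[OF s \<phi>])
    show "(\<lambda>n. \<integral>\<^sup>+ t. ennreal (norm (\<phi> (F t) - \<phi> (s n t))) \<partial>M) \<longlonglongrightarrow> 0"
      using conv[OF cont_linear_seminorm[OF \<phi> cont_seminorm_cmod]] by (simp add: cont_linear_diff[OF \<phi>])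
    have "isCont \<phi> v" using cont_linear_continuous[OF \<phi>] by (simp add: continuous_on_eq_continuous_at)
    then have "(\<lambda>n. \<phi> (Bochner_Integration.simple_bochner_integral M (s n))) \<longlonglongrightarrow> \<phi> v"
      using v by (rule isCont_tendsto_compose)
    then show "(\<lambda>n. Bochner_Integration.simple_bochner_integral M (\<lambda>t. \<phi> (s n t))) \<longlonglongrightarrow> \<phi> v"
      by (simp add: simple_bochner_integral_linear[OF cont_linear_imp_linear[OF \<phi>] s])
  qed
qed

text \<open>The triangle inequality for integrals, reduced to the scalar one by a functional that
  attains \<open>p\<close> at the integral.\<close>

lemma simple_integral_seminorm_bound:
  assumes s: "Bochner_Integration.simple_bochner_integrable M s" and p: "cont_seminorm p"
    and e: "integrable M e" and le: "\<And>t. t \<in> space M \<Longrightarrow> p (s t) \<le> e t"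
  shows "p (Bochner_Integration.simple_bochner_integral M s) \<le> (\<integral>t. e t \<partial>M)"
proof -
  let ?I = "Bochner_Integration.simple_bochner_integral M s"
  obtain \<phi> :: "'b \<Rightarrow> complex" where \<phi>: "cont_linear \<phi>" "\<And>x. cmod (\<phi> x) \<le> p x" "\<phi> ?I = of_real (p ?I)"
    by (rule Hahn_Banach_seminorm[OF p, where v = ?I]) blast
  have sem: "seminorm p" using p by (simp add: cont_seminorm_def)
  note \<phi>s = simple_bochner_integrable_cont_linear[OF s \<phi>(1)]
  have int: "integrable M (\<lambda>t. \<phi> (s t))" by (rule integrableI_simple_bochner_integrable[OF \<phi>s])
  have "p ?I = norm (\<phi> ?I)" using \<phi>(3) seminorm_nonneg[OF sem, of ?I] by simp
  also have "\<phi> ?I = (\<integral>t. \<phi> (s t) \<partial>M)"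
    by (simp add: simple_bochner_integral_linear[OF cont_linear_imp_linear[OF \<phi>(1)] s, symmetric]
        simple_bochner_integrable_eq_integral[OF \<phi>s])
  also have "norm \<dots> \<le> (\<integral>t. norm (\<phi> (s t)) \<partial>M)" by (rule integral_norm_bound)
  also have "\<dots> \<le> (\<integral>t. e t \<partial>M)"
    by (intro integral_mono integrable_norm int e) (use le \<phi>(2) order_trans in blast)
  finally show ?thesis .
qed

lemma floor_grid_Icc:
  fixes s c :: real
  assumes "s \<in> {0..c}"
  shows "real_of_int \<lfloor>real (Suc n) * s\<rfloor> / real (Suc n) \<in> {0..c}"
    "\<bar>s - real_of_int \<lfloor>real (Suc n) * s\<rfloor> / real (Suc n)\<bar> \<le> 1 / real (Suc n)"
proof -
  let ?N = "real (Suc n)"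
  have N: "?N > 0" by simp
  have 1: "real_of_int \<lfloor>?N * s\<rfloor> \<le> ?N * s" "?N * s < real_of_int \<lfloor>?N * s\<rfloor> + 1" by linarith+
  have 2: "real_of_int \<lfloor>?N * s\<rfloor> / ?N \<le> s" using 1(1) N by (simp only: pos_divide_le_eq mult.commute)
  have 3: "s \<le> (real_of_int \<lfloor>?N * s\<rfloor> + 1) / ?N" using 1(2) N by (simp only: pos_le_divide_eq mult.commute[of s])
  have "0 \<le> \<lfloor>?N * s\<rfloor>" using assms by simp
  then have 4: "0 \<le> real_of_int \<lfloor>?N * s\<rfloor> / ?N" by simp
  show "real_of_int \<lfloor>?N * s\<rfloor> / ?N \<in> {0..c}" using 2 4 assms unfolding atLeastAtMost_iff by linarith
  show "\<bar>s - real_of_int \<lfloor>?N * s\<rfloor> / ?N\<bar> \<le> 1 / ?N" using 2 3 unfolding add_divide_distrib by linarith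
qed

text \<open>The approximants multiply simple functions close to \<open>\<alpha>\<close> by values of
  \<open>g\<close> on a grid of mesh \<open>1 / Suc n\<close>. Since no seminorm enters their
  construction, one sequence serves all seminorms; sequential completeness provides the limit of
  their integrals.\<close>

lemma has_lcs_integral_scaleC_continuous:
  fixes g :: "real \<Rightarrow> 'x::sc_lcs"
  assumes \<alpha>: "integrable (lebesgue_on {0..c}) \<alpha>" and g: "continuous_on {0..c} g"
  obtains v where "has_lcs_integral (lebesgue_on {0..c}) (\<lambda>t. \<alpha> t *\<^sub>C g t) v"
proof -
  define M where "M = lebesgue_on {0..c}"
  have sp: "space M = {0..c}" by (simp add: M_def)
  interpret finite_measure M
    by (rule finite_measureI) (simp add: M_def emeasure_restrict_space emeasure_lborel_Icc_eq)
  have \<alpha>: "integrable M \<alpha>" using \<alpha> by (simp add: M_def)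
  obtain A where A: "\<And>n. simple_function M (A n)" "\<And>t. t \<in> space M \<Longrightarrow> (\<lambda>n. A n t) \<longlonglongrightarrow> \<alpha> t"
    and Ale: "\<And>n t. t \<in> space M \<Longrightarrow> cmod (A n t) \<le> 2 * cmod (\<alpha> t)"
    using borel_measurable_implies_sequence_metric[OF borel_measurable_integrable[OF \<alpha>], of 0]
    unfolding dist_norm diff_0_right by blast
  define h where "h n s = real_of_int \<lfloor>real (Suc n) * s\<rfloor> / real (Suc n)" for n s
  have h: "h n s \<in> {0..c}" "\<bar>s - h n s\<bar> \<le> 1 / real (Suc n)" if "s \<in> {0..c}" for n s
    using floor_grid_Icc[OF that, of n] unfolding h_def by auto
  have sf: "simple_function M (\<lambda>s. g (h n s))" for n
  proof -
    have meas: "(\<lambda>s. \<lfloor>real (Suc n) * s\<rfloor>) \<in> measurable M (count_space UNIV)"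
      unfolding M_def by (intro measurable_restrict_space1 measurable_completion) simp
    have "simple_function M (\<lambda>s. \<lfloor>real (Suc n) * s\<rfloor>)"
      unfolding simple_function_def
    proof (intro conjI ballI)
      have "\<lfloor>real (Suc n) * s\<rfloor> \<in> {0..\<lfloor>real (Suc n) * c\<rfloor>}" if "s \<in> {0..c}" for s
        using that by (auto intro!: floor_mono mult_left_mono simp del: of_nat_Suc)
      then have "(\<lambda>s. \<lfloor>real (Suc n) * s\<rfloor>) ` space M \<subseteq> {0..\<lfloor>real (Suc n) * c\<rfloor>}"
        unfolding sp by blast
      then show "finite ((\<lambda>s. \<lfloor>real (Suc n) * s\<rfloor>) ` space M)" by (rule finite_subset) simp
      show "(\<lambda>s. \<lfloor>real (Suc n) * s\<rfloor>) -` {x} \<inter> space M \<in> sets M" for x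
        by (rule measurable_sets[OF meas]) simp
    qed
    from simple_function_compose1[OF this, of "\<lambda>i. g (real_of_int i / real (Suc n))"]
    show ?thesis by (simp add: h_def)
  qed
  define s where "s n t = A n t *\<^sub>C g (h n t)" for n t
  define F where "F t = \<alpha> t *\<^sub>C g t" for t
  have sbi: "Bochner_Integration.simple_bochner_integrable M (s n)" for n
  proof (rule simple_bochner_integrable.intros)
    show "simple_function M (s n)" unfolding s_def by (rule simple_function_compose2[OF A(1) sf])
  qed simp
  have gconv: "(\<lambda>n. g (h n t)) \<longlonglongrightarrow> g t" if t: "t \<in> {0..c}" for t
  proof (rule continuous_on_tendsto_compose[OF g _ t])
    have "(\<lambda>n. h n t - t) \<longlonglongrightarrow> 0"
    proof (rule Lim_null_comparison[OF always_eventually])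
      show "(\<lambda>n. 1 / real (Suc n)) \<longlonglongrightarrow> 0" using LIMSEQ_inverse_real_of_nat by (simp add: inverse_eq_divide)
      show "\<forall>n. norm (h n t - t) \<le> 1 / real (Suc n)" using h(2)[OF t] by (simp add: abs_minus_commute)
    qed
    then show "(\<lambda>n. h n t) \<longlonglongrightarrow> t" by (rule LIM_zero_cancel)
    show "\<forall>\<^sub>F n in sequentially. h n t \<in> {0..c}" using h(1)[OF t] by simp
  qed
  have AE: "AE t in M. (\<lambda>n. s n t) \<longlonglongrightarrow> F t"
    by (rule AE_I2) (auto simp: s_def F_def sp intro!: tendsto_scaleC A gconv)
  \<comment> \<open>A scalar majorant of the error with integrals tending to 0. It is used twice,
    for the convergence in the mean and for the Cauchy property of the integrals.\<close>
  have key: "\<exists>e. (\<forall>n. integrable M (e n)) \<and> (\<forall>n. \<forall>t\<in>space M. p (F t - s n t) \<le> e n t) \<and> (\<lambda>n. \<integral>t. e n t \<partial>M) \<longlonglongrightarrow> 0"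
    if p: "cont_seminorm p" for p
  proof -
    have sem: "seminorm p" and pc: "continuous_on UNIV p" using p by (auto simp: cont_seminorm_def)
    have "compact ((\<lambda>t. p (g t)) ` {0..c})"
      by (intro compact_continuous_image compact_Icc continuous_on_compose2[OF pc g]) auto
    then have "bounded ((\<lambda>t. p (g t)) ` {0..c})" by (rule compact_imp_bounded)
    then obtain B where B: "\<And>t. t \<in> {0..c} \<Longrightarrow> p (g t) \<le> B" "B > 0"
      unfolding bounded_pos by (force dest: abs_le_D1)
    define d where "d n t = p (g t - g (h n t))" for n t
    \<comment> \<open>Largest sampling error on the interval. The inserted 0 keeps the supremum
      meaningful and nonnegative when \<open>{0..c}\<close> is empty.\<close>
    define D where "D n = Sup (insert 0 (d n ` {0..c}))" for n
    have dB: "d n t \<le> 2 * B" if "t \<in> {0..c}" for n t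
      using seminorm_diff[OF sem, of "g t" "g (h n t)"] B(1)[OF that] B(1)[OF h(1)[OF that, of n]] by (simp add: d_def)
    have bdd: "bdd_above (insert 0 (d n ` {0..c}))" for n
      by (rule bdd_aboveI[of _ "2 * B"]) (use dB B(2) in auto)
    have dD: "d n t \<le> D n" if "t \<in> {0..c}" for n t
      unfolding D_def by (rule cSup_upper[OF _ bdd]) (use that in auto)
    have D0: "0 \<le> D n" for n unfolding D_def by (rule cSup_upper[OF _ bdd]) auto
    have D2B: "D n \<le> 2 * B" for n unfolding D_def by (rule cSup_least) (use dB B(2) in auto)
    have Dlim: "D \<longlonglongrightarrow> 0"
    proof (rule LIMSEQ_I)
      fix r :: real assume r: "r > 0"
      \<comment> \<open>Without a metric on the target, uniform continuity is taken for the real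
        function \<open>p (g s - g t)\<close> on the square and then compared with its zeros on the
        diagonal.\<close>
      have "uniformly_continuous_on ({0..c} \<times> {0..c}) (\<lambda>z. p (g (fst z) - g (snd z)))"
        by (intro compact_uniformly_continuous compact_Times compact_Icc continuous_on_compose2[OF pc]
            continuous_on_diff continuous_on_compose2[OF g] continuous_on_fst continuous_on_snd continuous_on_id) auto
      then obtain \<delta> where \<delta>: "\<delta> > 0" "\<And>z z'. z \<in> {0..c} \<times> {0..c} \<Longrightarrow> z' \<in> {0..c} \<times> {0..c} \<Longrightarrow> dist z' z < \<delta> \<Longrightarrow>
          dist (p (g (fst z') - g (snd z'))) (p (g (fst z) - g (snd z))) < r / 2"
        using r half_gt_zero unfolding uniformly_continuous_on_def by metis
      obtain N where N: "1 / real (Suc N) < \<delta>" using \<delta>(1) nat_approx_posE by blast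
      have "norm (D n - 0) < r" if n: "n \<ge> N" for n
      proof -
        have "d n t \<le> r / 2" if t: "t \<in> {0..c}" for t
        proof -
          have "dist (t, h n t) (t, t) < \<delta>"
          proof -
            have "1 / real (Suc n) \<le> 1 / real (Suc N)" using n by (simp add: frac_le)
            then show ?thesis using h(2)[OF t, of n] N by (simp add: dist_prod_def dist_real_def abs_minus_commute)
          qed
          then have "dist (p (g t - g (h n t))) (p (g t - g t)) < r / 2"
            using \<delta>(2)[of "(t, t)" "(t, h n t)"] t h(1)[OF t] by simp
          then show ?thesis by (simp add: seminorm_zero[OF sem] d_def dist_real_def)
        qed
        then have "D n \<le> r / 2" unfolding D_def by (intro cSup_least) (use r in auto)
        then show ?thesis using D0[of n] r by simp
      qed
      then show "\<exists>no. \<forall>n\<ge>no. norm (D n - 0) < r" by blast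
    qed
    \<comment> \<open>Bounds the two terms of \<open>(\<alpha> - A n) g + A n (g - g (h n))\<close>,
      with \<open>cmod (A n t) \<le> 2 * cmod (\<alpha> t)\<close>.\<close>
    define e where "e n t = cmod (\<alpha> t - A n t) * B + 2 * cmod (\<alpha> t) * D n" for n t
    have Ameas: "A n \<in> borel_measurable M" for n by (rule borel_measurable_simple_function[OF A(1)])
    have \<alpha>meas: "\<alpha> \<in> borel_measurable M" by (rule borel_measurable_integrable[OF \<alpha>])
    have emeas: "e n \<in> borel_measurable M" for n
      unfolding e_def using Ameas \<alpha>meas by measurable
    \<comment> \<open>The constant is 3 from
      \<open>cmod (\<alpha> - A n) \<le> 3 * cmod \<alpha>\<close>, plus 4 from
      \<open>2 * cmod \<alpha> * D n\<close> with \<open>D n \<le> 2 * B\<close>.\<close>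
    have ebound: "norm (e n t) \<le> 7 * B * cmod (\<alpha> t)" if t: "t \<in> space M" for n t
    proof -
      have "cmod (\<alpha> t - A n t) \<le> 3 * cmod (\<alpha> t)"
        using norm_triangle_ineq4[of "\<alpha> t" "A n t"] Ale[OF t, of n] by simp
      then have "cmod (\<alpha> t - A n t) * B \<le> 3 * cmod (\<alpha> t) * B" using B(2) by (intro mult_right_mono) auto
      moreover have "2 * cmod (\<alpha> t) * D n \<le> 2 * cmod (\<alpha> t) * (2 * B)" using D2B[of n] by (intro mult_left_mono) auto
      moreover have "0 \<le> e n t" using B(2) D0[of n] by (simp add: e_def)
      ultimately show ?thesis by (simp add: e_def mult_ac)
    qed
    have dom: "integrable M (\<lambda>t. 7 * B * cmod (\<alpha> t))" by (intro integrable_mult_right integrable_norm \<alpha>)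
    have eint: "integrable M (e n)" for n
      by (rule Bochner_Integration.integrable_bound[OF dom emeas]) (intro AE_I2 order_trans[OF ebound], auto)
    have "(\<lambda>n. \<integral>t. e n t \<partial>M) \<longlonglongrightarrow> (\<integral>t. 0 \<partial>M)"
    proof (rule integral_dominated_convergence[OF _ emeas dom])
      show "AE t in M. (\<lambda>n. e n t) \<longlonglongrightarrow> 0"
      proof (rule AE_I2)
        fix t assume t: "t \<in> space M"
        have "(\<lambda>n. cmod (\<alpha> t - A n t) * B + 2 * cmod (\<alpha> t) * D n) \<longlonglongrightarrow> cmod (\<alpha> t - \<alpha> t) * B + 2 * cmod (\<alpha> t) * 0"
          by (intro tendsto_intros A(2) t Dlim)
        then show "(\<lambda>n. e n t) \<longlonglongrightarrow> 0" by (simp add: e_def)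
      qed
    qed (use ebound in auto)
    moreover have "p (F t - s n t) \<le> e n t" if t: "t \<in> space M" for n t
    proof -
      have t': "t \<in> {0..c}" using t sp by simp
      have "F t - s n t = (\<alpha> t - A n t) *\<^sub>C g t + A n t *\<^sub>C (g t - g (h n t))"
        by (simp add: F_def s_def scaleC_diff_left scaleC_diff_right)
      then have "p (F t - s n t) \<le> cmod (\<alpha> t - A n t) * p (g t) + cmod (A n t) * d n t"
        using seminorm_add[OF sem, of "(\<alpha> t - A n t) *\<^sub>C g t" "A n t *\<^sub>C (g t - g (h n t))"]
        by (simp add: seminorm_scaleC[OF sem] d_def)
      also have "\<dots> \<le> e n t"
        unfolding e_def using B(1)[OF t'] Ale[OF t, of n] dD[OF t', of n] seminorm_nonneg[OF sem]
        by (intro add_mono mult_mono) (auto simp: d_def)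
      finally show ?thesis .
    qed
    ultimately show ?thesis using eint by (intro exI[of _ e]) simp
  qed
  have L1: "(\<lambda>n. \<integral>\<^sup>+ t. ennreal (p (F t - s n t)) \<partial>M) \<longlonglongrightarrow> 0" if p: "cont_seminorm p" for p
  proof -
    obtain e where e: "\<And>n. integrable M (e n)" "\<And>n t. t \<in> space M \<Longrightarrow> p (F t - s n t) \<le> e n t"
      "(\<lambda>n. \<integral>t. e n t \<partial>M) \<longlonglongrightarrow> 0" using key[OF p] by blast
    have sem: "seminorm p" using p by (simp add: cont_seminorm_def)
    show ?thesis
    proof (rule tendsto_sandwich[OF _ _ tendsto_const])
      show "(\<lambda>n. ennreal (\<integral>t. e n t \<partial>M)) \<longlonglongrightarrow> 0" using tendsto_ennrealI[OF e(3)] by simp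
      have "(\<integral>\<^sup>+ t. ennreal (p (F t - s n t)) \<partial>M) \<le> ennreal (\<integral>t. e n t \<partial>M)" for n
      proof -
        have "(\<integral>\<^sup>+ t. ennreal (p (F t - s n t)) \<partial>M) \<le> (\<integral>\<^sup>+ t. ennreal (e n t) \<partial>M)"
          by (intro nn_integral_mono ennreal_leI e(2))
        also have "\<dots> = ennreal (\<integral>t. e n t \<partial>M)"
          by (intro nn_integral_eq_integral e AE_I2) (use e(2) seminorm_nonneg[OF sem] order_trans in blast)
        finally show ?thesis .
      qed
      then show "\<forall>\<^sub>F n in sequentially. (\<integral>\<^sup>+ t. ennreal (p (F t - s n t)) \<partial>M) \<le> ennreal (\<integral>t. e n t \<partial>M)" by simp
    qed simp
  qed
  let ?I = "\<lambda>n. Bochner_Integration.simple_bochner_integral M (s n)"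
  have "convergent ?I"
  proof (rule sequentially_complete)
    fix U :: "'x set" assume "open U" "0 \<in> U"
    then obtain p where p: "cont_seminorm p" "\<And>x. p x < 1 \<Longrightarrow> x \<in> U"
      by (rule cont_seminorm_in_neighbourhood) blast
    have sem: "seminorm p" using p by (simp add: cont_seminorm_def)
    obtain e where e: "\<And>n. integrable M (e n)" "\<And>n t. t \<in> space M \<Longrightarrow> p (F t - s n t) \<le> e n t"
      "(\<lambda>n. \<integral>t. e n t \<partial>M) \<longlonglongrightarrow> 0" using key[OF p(1)] by blast
    obtain N where N: "\<And>n. n \<ge> N \<Longrightarrow> (\<integral>t. e n t \<partial>M) < 1 / 2"
      using order_tendstoD(2)[OF e(3), of "1/2"] by (auto simp: eventually_sequentially)
    have "?I m - ?I n \<in> U" if mn: "m \<ge> N" "n \<ge> N" for m n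
    proof (rule p(2))
      have "?I m - ?I n = Bochner_Integration.simple_bochner_integral M (\<lambda>t. s m t - s n t)"
        by (rule simple_bochner_integral_diff[OF sbi sbi, symmetric])
      moreover have "p \<dots> \<le> (\<integral>t. e m t + e n t \<partial>M)"
      proof (rule simple_integral_seminorm_bound[OF _ p(1)])
        show "Bochner_Integration.simple_bochner_integrable M (\<lambda>t. s m t - s n t)"
          by (rule simple_bochner_integrable_compose2[OF _ sbi sbi]) simp
        show "integrable M (\<lambda>t. e m t + e n t)" using e(1) by simp
        fix t assume t: "t \<in> space M"
        have "p (s m t - s n t) \<le> p (F t - s n t) + p (F t - s m t)"
          using seminorm_diff[OF sem, of "F t - s n t" "F t - s m t"] by simp
        then show "p (s m t - s n t) \<le> e m t + e n t" using e(2)[OF t, of m] e(2)[OF t, of n] by simp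
      qed
      moreover have "(\<integral>t. e m t + e n t \<partial>M) < 1" using N[OF mn(1)] N[OF mn(2)] e(1) by simp
      ultimately show "p (?I m - ?I n) < 1" by simp
    qed
    then show "\<exists>N. \<forall>m\<ge>N. \<forall>n\<ge>N. ?I m - ?I n \<in> U" by blast
  qed
  then obtain v where "?I \<longlonglongrightarrow> v" by (auto simp: convergent_def)
  then have "has_lcs_integral M F v"
    unfolding has_lcs_integral_def using sbi AE L1 by (intro exI[of _ s]) (auto simp: cont_seminorm_def)
  then show ?thesis using that by (simp add: M_def F_def[abs_def])
qed

text \<open>Existence is the previous lemma and uniqueness holds because functionals separate
  points, so the description denotes. All later facts about \<open>lcs_integral\<close> go through
  this scalar form.\<close>

lemma lcs_integral_functional:
  fixes g :: "real \<Rightarrow> 'x::sc_lcs" and \<phi> :: "'x \<Rightarrow> complex"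
  assumes \<alpha>: "integrable (lebesgue_on {0..c}) \<alpha>" and g: "continuous_on {0..c} g" and \<phi>: "cont_linear \<phi>"
  shows "integrable (lebesgue_on {0..c}) (\<lambda>t. \<alpha> t * \<phi> (g t))"
    "\<phi> (lcs_integral (lebesgue_on {0..c}) (\<lambda>t. \<alpha> t *\<^sub>C g t)) = (\<integral>t. \<alpha> t * \<phi> (g t) \<partial>lebesgue_on {0..c})"
proof -
  let ?F = "\<lambda>t. \<alpha> t *\<^sub>C g t"
  have meas: "(\<lambda>t. \<alpha> t * \<psi> (g t)) \<in> borel_measurable (lebesgue_on {0..c})" if "cont_linear \<psi>" for \<psi> :: "'x \<Rightarrow> complex"
  proof -
    have "continuous_on {0..c} (\<lambda>t. \<psi> (g t))"
      by (rule continuous_on_compose2[OF cont_linear_continuous[OF that] g]) simp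
    then have "(\<lambda>t. \<psi> (g t)) \<in> borel_measurable (lebesgue_on {0..c})"
      by (intro continuous_imp_measurable_on_sets_lebesgue) auto
    then show ?thesis using borel_measurable_integrable[OF \<alpha>] by (intro borel_measurable_times)
  qed
  have *: "has_bochner_integral (lebesgue_on {0..c}) (\<lambda>t. \<alpha> t * \<psi> (g t)) (\<psi> w)"
    if "cont_linear \<psi>" "has_lcs_integral (lebesgue_on {0..c}) ?F w" for \<psi> :: "'x \<Rightarrow> complex" and w
    using has_lcs_integral_functional[OF that(2,1)] meas[OF that(1)] that(1)
    by (simp add: cont_linear_scaleC scaleC_complex_def)
  obtain v where v: "has_lcs_integral (lebesgue_on {0..c}) ?F v"
    by (rule has_lcs_integral_scaleC_continuous[OF \<alpha> g])
  have "w = v" if "has_lcs_integral (lebesgue_on {0..c}) ?F w" for w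
    by (rule eqI_functionals) (use *[OF _ that] *[OF _ v] has_bochner_integral_eq in blast)
  then have "lcs_integral (lebesgue_on {0..c}) ?F = v"
    unfolding lcs_integral_def using v by blast
  then show "\<phi> (lcs_integral (lebesgue_on {0..c}) ?F) = (\<integral>t. \<alpha> t * \<phi> (g t) \<partial>lebesgue_on {0..c})"
    using has_bochner_integral_integral_eq[OF *[OF \<phi> v]] by simp
  show "integrable (lebesgue_on {0..c}) (\<lambda>t. \<alpha> t * \<phi> (g t))"
    using *[OF \<phi> v] by (rule integrable.intros)
qed

section \<open>Laplace transforms of scalar functions\<close>

lemma has_laplace_unique: "has_laplace k z v \<Longrightarrow> has_laplace k z w \<Longrightarrow> v = w"
  unfolding has_laplace_def by (rule tendsto_unique[OF trivial_limit_at_top_linorder])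

lemma laplace_eqI: "has_laplace k z v \<Longrightarrow> laplace k z = v"
  unfolding laplace_def using has_laplace_unique by blast

text \<open>Extended by zero to negative times, so that absolute convergence is integrability on the
  line and convolution on the half-line becomes convolution on the line.\<close>

definition laplace_integrand :: "(real \<Rightarrow> complex) \<Rightarrow> complex \<Rightarrow> real \<Rightarrow> complex" where
  "laplace_integrand u z t = indicator {0..} t *\<^sub>R (exp (- z * of_real t) * u t)"

lemma has_laplace_absolute:
  assumes int: "integrable lebesgue (laplace_integrand u z)"
  shows "has_laplace u z (\<integral>t. laplace_integrand u z t \<partial>lebesgue)"
proof -
  let ?f = "\<lambda>t. exp (- z * of_real t) * u t"
  have si: "set_integrable lebesgue {0..} ?f"
    using int by (simp add: set_integrable_def laplace_integrand_def[abs_def])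
  have sic: "set_integrable lebesgue {0..c} ?f" for c
    by (rule set_integrable_subset[OF si]) auto
  have eq: "integral {0..c} ?f = (\<integral>t. indicator {0..c} t *\<^sub>R ?f t \<partial>lebesgue)" for c
    using set_lebesgue_integral_eq_integral(2)[OF sic] by (simp add: set_lebesgue_integral_def)
  have "((\<lambda>c. \<integral>t. indicator {0..c} t *\<^sub>R ?f t \<partial>lebesgue) \<longlongrightarrow> (\<integral>t. laplace_integrand u z t \<partial>lebesgue)) at_top"
  proof (rule integral_dominated_convergence_at_top)
    show "laplace_integrand u z \<in> borel_measurable lebesgue" using int by (rule borel_measurable_integrable)
    show "(\<lambda>t. indicator {0..c} t *\<^sub>R ?f t) \<in> borel_measurable lebesgue" for c
      using sic[of c] unfolding set_integrable_def by (rule borel_measurable_integrable)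
    show "integrable lebesgue (\<lambda>t. norm (laplace_integrand u z t))" using int by simp
    show "AE t in lebesgue. ((\<lambda>c. indicator {0..c} t *\<^sub>R ?f t) \<longlongrightarrow> laplace_integrand u z t) at_top"
    proof (rule AE_I2)
      fix t
      have "\<forall>\<^sub>F c in at_top. indicator {0..c} t *\<^sub>R ?f t = laplace_integrand u z t"
        using eventually_ge_at_top[of t] by eventually_elim (auto simp: laplace_integrand_def indicator_def)
      then show "((\<lambda>c. indicator {0..c} t *\<^sub>R ?f t) \<longlongrightarrow> laplace_integrand u z t) at_top"
        by (rule tendsto_eventually)
    qed
    show "\<forall>\<^sub>F c in at_top. AE t in lebesgue. norm (indicator {0..c} t *\<^sub>R ?f t) \<le> norm (laplace_integrand u z t)"
      by (intro always_eventually allI AE_I2) (auto simp: laplace_integrand_def indicator_def)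
  qed
  then show ?thesis unfolding has_laplace_def eq .
qed

lemma laplace_absolute:
  assumes "integrable lebesgue (laplace_integrand u z)"
  shows "laplace u z = (\<integral>t. laplace_integrand u z t \<partial>lebesgue)"
  by (rule laplace_eqI[OF has_laplace_absolute[OF assms]])

section \<open>Measurability, elementary rules and exponential growth\<close>

lemma locally_integrable_times_continuous:
  assumes u: "locally_integrable u" and w: "continuous_on {0..} w" and c: "c \<ge> 0"
  shows "(\<lambda>t. w t * u t) absolutely_integrable_on {0..c}"
proof (rule absolutely_integrable_bounded_measurable_product[where h = "(*)" and f = w and g = u])
  have wc: "continuous_on {0..c} w" using w by (rule continuous_on_subset) auto
  show "bilinear ((*) :: complex \<Rightarrow> complex \<Rightarrow> complex)" by (rule bilinear_times)
  show "w \<in> borel_measurable (lebesgue_on {0..c})"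
    by (rule continuous_imp_measurable_on_sets_lebesgue[OF wc]) simp
  show "bounded (w ` {0..c})" by (rule compact_imp_bounded[OF compact_continuous_image[OF wc compact_Icc]])
  show "u absolutely_integrable_on {0..c}" using u c by (simp add: locally_integrable_def)
qed simp

lemma continuous_imp_locally_integrable: "continuous_on {0..} u \<Longrightarrow> locally_integrable u"
  unfolding locally_integrable_def
  by (intro allI impI absolutely_integrable_continuous_real) (auto intro: continuous_on_subset)

lemma continuous_on_exp_weight: "continuous_on S (\<lambda>t. exp (- z * complex_of_real t))"
  by (intro continuous_intros)

lemma locally_integrable_weight: "locally_integrable u \<Longrightarrow> locally_integrable (\<lambda>t. exp (- z * of_real t) * u t)"
  using locally_integrable_times_continuous[OF _ continuous_on_exp_weight]
  by (auto simp: locally_integrable_def)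

lemma laplace_integrand_measurable:
  assumes u: "locally_integrable u"
  shows "laplace_integrand u z \<in> borel_measurable lebesgue"
proof (rule borel_measurable_LIMSEQ_metric)
  let ?f = "\<lambda>t. exp (- z * of_real t) * u t"
  show "(\<lambda>t. indicator {0..real n} t *\<^sub>R ?f t) \<in> borel_measurable lebesgue" for n
  proof -
    have "set_integrable lebesgue {0..real n} ?f"
      using locally_integrable_weight[OF u, of z] by (simp add: locally_integrable_def)
    then show ?thesis unfolding set_integrable_def by (rule borel_measurable_integrable)
  qed
  fix t :: real
  obtain N where N: "t \<le> real N" using real_arch_simple by blast
  have "\<forall>\<^sub>F n in sequentially. indicator {0..real n} t *\<^sub>R ?f t = laplace_integrand u z t"
    using eventually_ge_at_top[of N] by eventually_elim (use N in \<open>auto simp: laplace_integrand_def indicator_def\<close>)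
  then show "(\<lambda>n. indicator {0..real n} t *\<^sub>R ?f t) \<longlonglongrightarrow> laplace_integrand u z t"
    by (rule tendsto_eventually)
qed

lemma has_laplace_add:
  assumes u: "locally_integrable u" "has_laplace u z v" and w: "locally_integrable w" "has_laplace w z y"
  shows "has_laplace (\<lambda>t. u t + w t) z (v + y)"
proof -
  let ?E = "\<lambda>t. exp (- z * complex_of_real t)"
  have int: "(\<lambda>t. ?E t * u t) integrable_on {0..c}" "(\<lambda>t. ?E t * w t) integrable_on {0..c}" if "c \<ge> 0" for c
    using locally_integrable_weight[OF u(1), of z] locally_integrable_weight[OF w(1), of z] that
    by (auto simp: locally_integrable_def absolutely_integrable_on_def)
  have "((\<lambda>c. integral {0..c} (\<lambda>t. ?E t * u t) + integral {0..c} (\<lambda>t. ?E t * w t)) \<longlongrightarrow> v + y) at_top"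
    using u(2) w(2) unfolding has_laplace_def by (rule tendsto_add)
  moreover have "\<forall>\<^sub>F c in at_top. integral {0..c} (\<lambda>t. ?E t * u t) + integral {0..c} (\<lambda>t. ?E t * w t)
      = integral {0..c} (\<lambda>t. ?E t * (u t + w t))"
    using eventually_ge_at_top[of 0]
    by eventually_elim (simp only: distrib_left integral_add[OF int])
  ultimately show ?thesis unfolding has_laplace_def by (rule Lim_transform_eventually)
qed

lemma has_laplace_cmult:
  assumes "has_laplace u z v"
  shows "has_laplace (\<lambda>t. c * u t) z (c * v)"
proof -
  have "((\<lambda>s. c * integral {0..s} (\<lambda>t. exp (- z * complex_of_real t) * u t)) \<longlongrightarrow> c * v) at_top"
    using assms unfolding has_laplace_def by (rule tendsto_mult_left)
  then show ?thesis unfolding has_laplace_def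
    by (simp add: mult.left_commute flip: integral_mult_right)
qed

lemma exp_growth_integrable:
  assumes u: "locally_integrable u" and bd: "\<And>t. t \<ge> 0 \<Longrightarrow> cmod (u t) \<le> M * exp (\<sigma> * t)" and z: "Re z > \<sigma>"
  shows "integrable lebesgue (laplace_integrand u z)"
proof (rule Bochner_Integration.integrable_bound[OF _ laplace_integrand_measurable[OF u]])
  let ?x = "Re z - \<sigma>"
  have "((\<lambda>t. exp (- ?x * t)) has_integral exp (- ?x * 0) / ?x) {0..}"
    using z by (intro has_integral_exp_minus_to_infinity) simp
  then have "(\<lambda>t. exp (- ?x * t)) integrable_on {0..}" by blast
  then have "(\<lambda>t. exp (- ?x * t)) absolutely_integrable_on {0..}"
    by (intro nonnegative_absolutely_integrable_1) auto
  then show "integrable lebesgue (\<lambda>t. M * (indicator {0..} t *\<^sub>R exp (- ?x * t)))"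
    unfolding set_integrable_def by (rule integrable_mult_right)
  have "norm (laplace_integrand u z t) \<le> norm (M * (indicator {0..} t *\<^sub>R exp (- ?x * t)))" for t
  proof (cases "t \<ge> 0")
    case True
    have "cmod (exp (- z * of_real t) * u t) \<le> exp (- Re z * t) * (M * exp (\<sigma> * t))"
      using bd[OF True] by (simp add: norm_mult)
    also have "\<dots> = M * exp (- ?x * t)" by (simp add: exp_add[symmetric] algebra_simps)
    finally show ?thesis using True by (simp add: laplace_integrand_def)
  qed (simp add: laplace_integrand_def)
  then show "AE t in lebesgue. norm (laplace_integrand u z t) \<le> norm (M * (indicator {0..} t *\<^sub>R exp (- ?x * t)))"
    by simp
qed

section \<open>Convolution\<close>

definition conv :: "(real \<Rightarrow> complex) \<Rightarrow> (real \<Rightarrow> complex) \<Rightarrow> real \<Rightarrow> complex" where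
  "conv b g t = (\<integral>s. b (t - s) * g s \<partial>lebesgue_on {0..t})"

text \<open>Prepares Fubini's theorem: composing with \<open>t - s\<close> preserves Borel
  measurability on the product, so Lebesgue measurable integrands are first replaced by Borel
  ones.\<close>

lemma ex_borel_version:
  fixes f :: "real \<Rightarrow> complex"
  assumes f: "integrable lebesgue f"
  obtains g where "g \<in> borel_measurable borel" "integrable lborel g" "AE x in lborel. f x = g x"
    "(\<integral>x. g x \<partial>lborel) = (\<integral>x. f x \<partial>lebesgue)"
proof -
  have meas: "f \<in> borel_measurable lebesgue" using f by (rule borel_measurable_integrable)
  then have "(\<lambda>x. Re (f x)) \<in> borel_measurable lebesgue" "(\<lambda>x. Im (f x)) \<in> borel_measurable lebesgue"
    by simp_all
  from this[THEN completion_ex_borel_measurable_real] obtain r i where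
    r: "r \<in> borel_measurable lborel" "AE x in lborel. Re (f x) = r x" and
    i: "i \<in> borel_measurable lborel" "AE x in lborel. Im (f x) = i x" by blast
  define g where "g x = Complex (r x) (i x)" for x
  have g_eq: "g = (\<lambda>x. of_real (r x) + \<i> * of_real (i x))" by (simp add: g_def complex_eq_iff fun_eq_iff)
  have gm: "g \<in> borel_measurable borel" unfolding g_eq using r(1) i(1) by simp
  have AE: "AE x in lborel. f x = g x" using r(2) i(2) by eventually_elim (simp add: g_def complex_eq_iff)
  have gm': "g \<in> borel_measurable lebesgue" using gm by (simp add: measurable_completion)
  have "integrable lebesgue g"
    using integrable_cong_AE[OF meas gm' AE_completion[OF AE]] f by simp
  then have int: "integrable lborel g" using gm by (simp add: integrable_completion)
  have "(\<integral>x. g x \<partial>lborel) = (\<integral>x. g x \<partial>lebesgue)" using gm by (simp add: integral_completion)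
  also have "\<dots> = (\<integral>x. f x \<partial>lebesgue)" by (rule integral_cong_AE[OF gm' meas]) (use AE_completion[OF AE] in auto)
  finally show ?thesis using that gm int AE by blast
qed

lemma AE_lborel_reflect:
  assumes "AE x in lborel. P (x :: real)"
  shows "AE x in lborel. P (t - x)"
proof -
  obtain N where N: "N \<in> null_sets lborel" "{x. \<not> P x} \<subseteq> N"
    using assms by (auto elim!: AE_E simp: null_sets_def)
  have "AE x in lborel. x \<notin> N" by (rule AE_not_in[OF N(1)])
  then have "AE x in lborel. t + (-1) * x \<notin> N"
    using N(1) by (intro AE_borel_affine) (auto simp: null_sets_def)
  then show ?thesis by eventually_elim (use N(2) in auto)
qed

text \<open>Fubini's theorem; translation invariance makes the inner integral over \<open>t\<close>
  independent of \<open>s\<close>.\<close>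

lemma convolution_lborel:
  fixes B G :: "real \<Rightarrow> complex"
  assumes [measurable]: "B \<in> borel_measurable borel" "G \<in> borel_measurable borel"
    and B: "integrable lborel B" and G: "integrable lborel G"
  shows "integrable lborel (\<lambda>t. \<integral>s. B (t - s) * G s \<partial>lborel)"
    "(\<integral>t. (\<integral>s. B (t - s) * G s \<partial>lborel) \<partial>lborel) = (\<integral>t. B t \<partial>lborel) * (\<integral>t. G t \<partial>lborel)"
proof -
  have shift: "integrable lborel (\<lambda>t. B (t - s))" for s
    using lborel_integrable_real_affine[OF B, of 1 "-s"] by (simp add: algebra_simps)
  have norm_shift: "(\<integral>t. norm (B (t - s)) \<partial>lborel) = (\<integral>t. norm (B t) \<partial>lborel)" for s
    using lborel_integral_real_affine[of 1 "\<lambda>t. norm (B t)" "-s"] by (simp add: algebra_simps)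
  have int_shift: "(\<integral>t. B (t - s) \<partial>lborel) = (\<integral>t. B t \<partial>lborel)" for s
    using lborel_integral_real_affine[of 1 B "-s"] by (simp add: algebra_simps)
  have prod: "integrable (lborel \<Otimes>\<^sub>M lborel) (\<lambda>(s, t). B (t - s) * G s)"
  proof (rule lborel_pair.Fubini_integrable)
    show "(\<lambda>(s, t). B (t - s) * G s) \<in> borel_measurable (lborel \<Otimes>\<^sub>M lborel)" by measurable
    show "AE s in lborel. integrable lborel (\<lambda>t. case (s, t) of (s, t) \<Rightarrow> B (t - s) * G s)"
      using shift by simp
    have "(\<lambda>s. \<integral>t. norm (B (t - s) * G s) \<partial>lborel) = (\<lambda>s. (\<integral>t. norm (B t) \<partial>lborel) * norm (G s))"
      by (simp add: norm_mult norm_shift)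
    then show "integrable lborel (\<lambda>s. \<integral>t. norm (case (s, t) of (s, t) \<Rightarrow> B (t - s) * G s) \<partial>lborel)"
      using G by simp
  qed
  show "integrable lborel (\<lambda>t. \<integral>s. B (t - s) * G s \<partial>lborel)"
    by (rule lborel_pair.integrable_snd[OF prod])
  have "(\<integral>t. (\<integral>s. B (t - s) * G s \<partial>lborel) \<partial>lborel) = (\<integral>s. (\<integral>t. B (t - s) * G s \<partial>lborel) \<partial>lborel)"
    by (rule lborel_pair.Fubini_integral[OF prod])
  then show "(\<integral>t. (\<integral>s. B (t - s) * G s \<partial>lborel) \<partial>lborel) = (\<integral>t. B t \<partial>lborel) * (\<integral>t. G t \<partial>lborel)"
    by (simp add: int_shift)
qed

text \<open>The weights at \<open>t - s\<close> and \<open>s\<close> multiply to the weight at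
  \<open>t\<close>, and extension by zero confines \<open>s\<close> to \<open>{0..t}\<close>. So the
  integrand of the convolution is the convolution of the integrands at every \<open>t\<close>: for
  fixed \<open>t\<close>, passing to Borel versions changes a null set of \<open>s\<close>.\<close>

lemma laplace_integrand_conv:
  assumes b: "integrable lebesgue (laplace_integrand b z)" and g: "integrable lebesgue (laplace_integrand g z)"
  shows "integrable lebesgue (laplace_integrand (conv b g) z)"
    "(\<integral>t. laplace_integrand (conv b g) z t \<partial>lebesgue) =
      (\<integral>t. laplace_integrand b z t \<partial>lebesgue) * (\<integral>t. laplace_integrand g z t \<partial>lebesgue)"
proof -
  obtain B where B: "B \<in> borel_measurable borel" "integrable lborel B" "AE x in lborel. laplace_integrand b z x = B x"
    "(\<integral>x. B x \<partial>lborel) = (\<integral>x. laplace_integrand b z x \<partial>lebesgue)" by (rule ex_borel_version[OF b])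
  obtain G where G: "G \<in> borel_measurable borel" "integrable lborel G" "AE x in lborel. laplace_integrand g z x = G x"
    "(\<integral>x. G x \<partial>lborel) = (\<integral>x. laplace_integrand g z x \<partial>lebesgue)" by (rule ex_borel_version[OF g])
  note [measurable] = B(1) G(1)
  have eq: "laplace_integrand (conv b g) z t = (\<integral>s. B (t - s) * G s \<partial>lborel)" for t
  proof -
    define f where "f s = laplace_integrand b z (t - s) * laplace_integrand g z s" for s
    have AE: "AE s in lborel. B (t - s) * G s = f s"
      using AE_lborel_reflect[OF B(3), of t] G(3) by eventually_elim (simp add: f_def)
    have m: "(\<lambda>s. B (t - s) * G s) \<in> borel_measurable borel" by measurable
    then have m': "(\<lambda>s. B (t - s) * G s) \<in> borel_measurable lebesgue" by (simp add: measurable_completion)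
    have f_eq: "f s = (indicator {0..} t *\<^sub>R exp (- z * of_real t)) * (indicator {0..t} s *\<^sub>R (b (t - s) * g s))" for s
    proof -
      have "exp (- z * of_real (t - s)) * exp (- z * of_real s) = exp (- z * of_real t)"
        by (simp add: exp_add[symmetric] algebra_simps)
      then have "exp (- z * of_real (t - s)) * b (t - s) * (exp (- z * of_real s) * g s) = exp (- z * of_real t) * (b (t - s) * g s)"
        by (simp only: mult_ac)
      then show ?thesis by (auto simp: f_def laplace_integrand_def indicator_def)
    qed
    have "(\<integral>s. B (t - s) * G s \<partial>lborel) = (\<integral>s. B (t - s) * G s \<partial>lebesgue)"
      using m by (simp add: integral_completion)
    also have "\<dots> = (\<integral>s. f s \<partial>lebesgue)"
      by (rule integral_cong_AE[OF m' borel_measurable_AE[OF m']]) (rule AE_completion[OF AE])+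
    also have "\<dots> = (indicator {0..} t *\<^sub>R exp (- z * of_real t)) * conv b g t"
      unfolding f_eq integral_mult_right_zero conv_def by (simp add: integral_restrict_space)
    finally show ?thesis by (simp add: laplace_integrand_def)
  qed
  have fe: "laplace_integrand (conv b g) z = (\<lambda>t. \<integral>s. B (t - s) * G s \<partial>lborel)" using eq by auto
  note c = convolution_lborel[OF B(1) G(1) B(2) G(2)]
  have cm: "(\<lambda>t. \<integral>s. B (t - s) * G s \<partial>lborel) \<in> borel_measurable lborel" using c(1) by (rule borel_measurable_integrable)
  show "integrable lebesgue (laplace_integrand (conv b g) z)"
    unfolding fe integrable_completion[OF cm] by (rule c(1))
  show "(\<integral>t. laplace_integrand (conv b g) z t \<partial>lebesgue) =
      (\<integral>t. laplace_integrand b z t \<partial>lebesgue) * (\<integral>t. laplace_integrand g z t \<partial>lebesgue)"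
    unfolding fe integral_completion[OF cm] c(2) B(4) G(4) ..
qed

lemma integrable_reflected:
  assumes b: "locally_integrable b" and t: "t \<ge> 0"
  shows "integrable (lebesgue_on {0..t}) (\<lambda>s. b (t - s))"
proof -
  have "integrable lebesgue (\<lambda>s. indicator {0..t} s *\<^sub>R b s)"
    using b t by (simp add: locally_integrable_def set_integrable_def)
  then have "integrable lebesgue (\<lambda>s. indicator {0..t} (t + (-1) * s) *\<^sub>R b (t + (-1) * s))"
    by (rule lebesgue_integrable_real_affine) simp
  also have "(\<lambda>s. indicator {0..t} (t + (-1) * s) *\<^sub>R b (t + (-1) * s)) = (\<lambda>s. indicator {0..t} s *\<^sub>R b (t - s))"
    by (auto simp: indicator_def fun_eq_iff)
  finally show ?thesis by (simp add: integrable_restrict_space)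
qed

text \<open>After reflection the time variable sits in the continuous factor, so dominated
  convergence along sequences applies even though \<open>b\<close> is merely locally
  integrable.\<close>

lemma continuous_on_conv:
  assumes b: "locally_integrable b" and g: "continuous_on {0..} g"
  shows "continuous_on {0..} (conv b g)"
  unfolding continuous_on_sequentially
proof (intro ballI allI impI, elim conjE)
  fix t :: real and X :: "nat \<Rightarrow> real"
  assume t: "t \<in> {0..}" and X: "\<forall>n. X n \<in> {0..}" "X \<longlonglongrightarrow> t"
  \<comment> \<open>Extension by zero allows all the integrals, whose upper limits vary, to be taken
    over the fixed interval \<open>{0..T}\<close>.\<close>
  define g' where "g' x = (if x \<ge> 0 then g x else 0)" for x
  obtain T where T: "T > 0" "\<And>n. X n \<le> T" "t \<le> T"
  proof -
    have "bounded (range X)" using X(2) by (rule convergent_imp_bounded)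
    then obtain T where "T > 0" "\<And>n. \<bar>X n\<bar> \<le> T" by (auto simp: bounded_pos)
    then show thesis using that[of "max T t"] by (metis abs_le_D1 less_max_iff_disj max.coboundedI1 max.cobounded2)
  qed
  have cont: "continuous_on {0..T} g" using g by (rule continuous_on_subset) auto
  then obtain M where M: "M > 0" "\<And>x. x \<in> {0..T} \<Longrightarrow> cmod (g x) \<le> M"
    using compact_imp_bounded[OF compact_continuous_image[OF cont compact_Icc]] by (auto simp: bounded_pos)
  have eq: "conv b g r = (\<integral>s. (indicator {0..T} s *\<^sub>R b s) * g' (r - s) \<partial>lebesgue)"
    and meas: "(\<lambda>s. (indicator {0..T} s *\<^sub>R b s) * g' (r - s)) \<in> borel_measurable lebesgue"
    if r: "0 \<le> r" "r \<le> T" for r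
  proof -
    have fun_eq: "(\<lambda>s. indicator {0..r} s *\<^sub>R (b s * g (r - s))) = (\<lambda>s. (indicator {0..T} s *\<^sub>R b s) * g' (r - s))"
      using r by (auto simp: indicator_def g'_def fun_eq_iff)
    have "conv b g r = (\<integral>s. indicator {0..r} s *\<^sub>R (b (r - s) * g s) \<partial>lebesgue)"
      by (simp add: conv_def integral_restrict_space)
    also have "\<dots> = (\<integral>s. indicator {0..r} (r - s) *\<^sub>R (b (r - (r - s)) * g (r - s)) \<partial>lebesgue)"
      using lebesgue_integral_real_affine[where c = "-1" and f = "\<lambda>s. indicator {0..r} s *\<^sub>R (b (r - s) * g s)" and t = r] by simp
    also have "(\<lambda>s. indicator {0..r} (r - s) *\<^sub>R (b (r - (r - s)) * g (r - s))) = (\<lambda>s. indicator {0..r} s *\<^sub>R (b s * g (r - s)))"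
      by (auto simp: indicator_def fun_eq_iff)
    finally show "conv b g r = (\<integral>s. (indicator {0..T} s *\<^sub>R b s) * g' (r - s) \<partial>lebesgue)"
      unfolding fun_eq .
    have gc: "continuous_on {0..r} (\<lambda>s. g (r - s))"
      by (rule continuous_on_compose2[OF g]) (auto intro!: continuous_intros)
    have "b \<in> borel_measurable (lebesgue_on {0..r})"
      using b r(1) by (intro borel_measurable_integrable) (simp add: locally_integrable_def integrable_restrict_space set_integrable_def)
    moreover have "(\<lambda>s. g (r - s)) \<in> borel_measurable (lebesgue_on {0..r})"
      by (rule continuous_imp_measurable_on_sets_lebesgue[OF gc]) simp
    ultimately have "(\<lambda>s. b s * g (r - s)) \<in> borel_measurable (lebesgue_on {0..r})" by (rule borel_measurable_times)
    then have "(\<lambda>s. indicator {0..r} s *\<^sub>R (b s * g (r - s))) \<in> borel_measurable lebesgue"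
      by (simp add: borel_measurable_restrict_space_iff)
    then show "(\<lambda>s. (indicator {0..T} s *\<^sub>R b s) * g' (r - s)) \<in> borel_measurable lebesgue"
      unfolding fun_eq .
  qed
  have rng: "0 \<le> X n" "X n \<le> T" "0 \<le> t" for n using X(1) T(2) t by auto
  have "(\<lambda>n. \<integral>s. (indicator {0..T} s *\<^sub>R b s) * g' (X n - s) \<partial>lebesgue)
      \<longlonglongrightarrow> (\<integral>s. (indicator {0..T} s *\<^sub>R b s) * g' (t - s) \<partial>lebesgue)"
  proof (rule integral_dominated_convergence)
    have "set_integrable lebesgue {0..T} b" using b T(1) by (simp add: locally_integrable_def)
    then show "integrable lebesgue (\<lambda>s. norm (indicator {0..T} s *\<^sub>R b s) * M)"
      unfolding set_integrable_def by (intro integrable_mult_left integrable_norm)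
    show "AE s in lebesgue. norm ((indicator {0..T} s *\<^sub>R b s) * g' (X n - s)) \<le> norm (indicator {0..T} s *\<^sub>R b s) * M" for n
    proof (rule AE_I2)
      fix s
      show "norm ((indicator {0..T} s *\<^sub>R b s) * g' (X n - s)) \<le> norm (indicator {0..T} s *\<^sub>R b s) * M"
      proof (cases "s \<in> {0..T}")
        case True
        then have "cmod (g' (X n - s)) \<le> M" using M rng(1)[of n] rng(2)[of n] by (auto simp: g'_def)
        then show ?thesis unfolding norm_mult by (intro mult_left_mono) auto
      qed simp
    qed
    \<comment> \<open>At \<open>s = t\<close> the argument of \<open>g'\<close> tends to 0, where
      the extension may jump.\<close>
    have "AE s in lebesgue. s \<noteq> t" by (rule AE_completion[OF AE_lborel_singleton])
    then show "AE s in lebesgue. (\<lambda>n. (indicator {0..T} s *\<^sub>R b s) * g' (X n - s)) \<longlonglongrightarrow> (indicator {0..T} s *\<^sub>R b s) * g' (t - s)"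
    proof eventually_elim
      fix s assume "s \<noteq> t"
      have Xs: "(\<lambda>n. X n - s) \<longlonglongrightarrow> t - s" by (intro tendsto_diff X(2) tendsto_const)
      have "(\<lambda>n. g' (X n - s)) \<longlonglongrightarrow> g' (t - s)"
      proof (cases "s < t")
        case True
        have ev: "\<forall>\<^sub>F n in sequentially. 0 < X n - s" by (rule order_tendstoD(1)[OF Xs]) (use True in simp)
        have "(\<lambda>n. g (X n - s)) \<longlonglongrightarrow> g (t - s)"
          by (rule continuous_on_tendsto_compose[OF g Xs]) (use True in simp, use ev in \<open>eventually_elim, simp\<close>)
        moreover have "\<forall>\<^sub>F n in sequentially. g (X n - s) = g' (X n - s)"
          using ev by eventually_elim (simp add: g'_def)
        ultimately have "(\<lambda>n. g' (X n - s)) \<longlonglongrightarrow> g (t - s)" by (rule Lim_transform_eventually)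
        then show ?thesis using True by (simp add: g'_def)
      next
        case False
        then have lt: "t - s < 0" using \<open>s \<noteq> t\<close> by simp
        have "\<forall>\<^sub>F n in sequentially. X n - s < 0" by (rule order_tendstoD(2)[OF Xs lt])
        then have "\<forall>\<^sub>F n in sequentially. g' (X n - s) = g' (t - s)"
          by eventually_elim (use lt in \<open>auto simp: g'_def\<close>)
        then show ?thesis by (rule tendsto_eventually)
      qed
      then show "(\<lambda>n. (indicator {0..T} s *\<^sub>R b s) * g' (X n - s)) \<longlonglongrightarrow> (indicator {0..T} s *\<^sub>R b s) * g' (t - s)"
        by (rule tendsto_mult_left)
    qed
  qed (use meas rng T(3) in auto)
  then show "(conv b g \<circ> X) \<longlonglongrightarrow> conv b g t"
    using eq rng T(3) by (simp add: o_def)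
qed

text \<open>
  Convergence of a Laplace integral at one point makes the integral \<open>H\<close> of \<open>exp (- z0 t) k t\<close> bounded.
  Truncating at \<open>c\<close> and convolving with \<open>1\<close> replaces the integration by parts that expresses the
  transform at \<open>z\<close> through the absolutely convergent transform of \<open>H\<close> at \<open>z - z0\<close>.
\<close>

lemma has_laplace_half_plane:
  assumes k: "locally_integrable k" and z0: "has_laplace k z0 v0" and z: "Re z > Re z0"
  shows "\<exists>v. has_laplace k z v"
proof -
  define w where "w = z - z0"
  have w: "Re w > 0" using z by (simp add: w_def)
  then have w0: "w \<noteq> 0" by auto
  define h where "h t = exp (- z0 * of_real t) * k t" for t
  have h: "locally_integrable h" unfolding h_def by (rule locally_integrable_weight[OF k])
  define H where "H = conv (\<lambda>_. 1) h"
  have H_eq: "H c = integral {0..c} h" if "c \<ge> 0" for c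
  proof -
    have "set_integrable lebesgue {0..c} h" using h that by (simp add: locally_integrable_def)
    from set_lebesgue_integral_eq_integral(2)[OF this] show ?thesis
      by (simp add: H_def conv_def integral_restrict_space set_lebesgue_integral_def)
  qed
  have Hlim: "(H \<longlongrightarrow> v0) at_top"
  proof (rule Lim_transform_eventually)
    show "((\<lambda>c. integral {0..c} h) \<longlongrightarrow> v0) at_top" using z0 by (simp add: has_laplace_def h_def[abs_def])
    show "\<forall>\<^sub>F c in at_top. integral {0..c} h = H c"
      using eventually_ge_at_top[of 0] by eventually_elim (simp add: H_eq)
  qed
  have Hcont: "continuous_on {0..c} H" for c
  proof (rule continuous_on_eq)
    show "continuous_on {0..c} (\<lambda>t. integral {0..t} h)"
    proof (cases "c \<ge> 0")
      case True
      have "h integrable_on {0..c}" using h True by (auto simp: locally_integrable_def absolutely_integrable_on_def)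
      then show ?thesis by (rule indefinite_integral_continuous_1)
    qed simp
  qed (simp add: H_eq)
  obtain N where N: "\<And>t. t \<ge> N \<Longrightarrow> cmod (H t) < cmod v0 + 1"
    using order_tendstoD(2)[OF tendsto_norm[OF Hlim], of "cmod v0 + 1"] by (auto simp: eventually_at_top_linorder)
  have "bounded (H ` {0..N})" by (rule compact_imp_bounded[OF compact_continuous_image[OF Hcont compact_Icc]])
  then obtain M0 where M0: "\<And>t. t \<in> {0..N} \<Longrightarrow> cmod (H t) \<le> M0" by (force simp: bounded_iff)
  define M where "M = max M0 (cmod v0 + 1)"
  have M: "cmod (H t) \<le> M" if "t \<ge> 0" for t
    using M0[of t] N[of t] that by (cases "t \<le> N") (auto simp: M_def)
  have li1: "integrable lebesgue (laplace_integrand (\<lambda>_. 1) w)"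
    by (rule exp_growth_integrable[where M = 1 and \<sigma> = 0])
       (use w in \<open>auto intro: continuous_imp_locally_integrable\<close>)
  have lap1: "has_laplace (\<lambda>_. 1) w (1 / w)"
  proof -
    have ic: "integral {0..c} (\<lambda>t. exp (- w * of_real t) * 1) = (1 - exp (- w * of_real c)) / w" if "c \<ge> 0" for c
    proof -
      have "((\<lambda>t. exp (- w * of_real t)) has_integral - exp (- w * of_real c) / w - (- exp (- w * of_real 0) / w)) {0..c}"
        using that w0
        by (intro fundamental_theorem_of_calculus)
           (auto intro!: derivative_eq_intros has_vector_derivative_real_field simp: field_simps)
      then have "integral {0..c} (\<lambda>t. exp (- w * of_real t)) = - exp (- w * of_real c) / w - (- exp (- w * of_real 0) / w)"
        by (rule integral_unique)
      then show ?thesis by (simp add: diff_divide_distrib)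
    qed
    have ev: "\<forall>\<^sub>F c in at_top. (1 - exp (- w * of_real c)) / w = integral {0..c} (\<lambda>t. exp (- w * of_real t) * 1)"
      using eventually_ge_at_top[of 0] by eventually_elim (simp only: ic)
    have "((\<lambda>c. exp (- Re w * c)) \<longlongrightarrow> 0) at_top"
      using w by (intro filterlim_compose[OF exp_at_bot] filterlim_tendsto_neg_mult_at_bot[OF tendsto_const] filterlim_ident) auto
    then have "((\<lambda>c. exp (- w * of_real c)) \<longlongrightarrow> 0) at_top"
      by (subst tendsto_norm_zero_iff[symmetric]) simp
    then have "((\<lambda>c. (1 - exp (- w * of_real c)) / w) \<longlongrightarrow> (1 - 0) / w) at_top"
      by (intro tendsto_intros w0)
    then show ?thesis unfolding has_laplace_def using Lim_transform_eventually[OF _ ev] by simp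
  qed
  have L1: "(\<integral>t. laplace_integrand (\<lambda>_. 1) w t \<partial>lebesgue) = 1 / w"
    by (rule has_laplace_unique[OF has_laplace_absolute[OF li1] lap1])
  have trunc: "integrable lebesgue (laplace_integrand (\<lambda>t. H (min t c)) w)"
    "integral {0..c} (\<lambda>t. exp (- z * of_real t) * k t) = w * (\<integral>t. laplace_integrand (\<lambda>t. H (min t c)) w t \<partial>lebesgue)"
    if c: "c \<ge> 0" for c
  proof -
    \<comment> \<open>The transform of \<open>hc\<close> at \<open>w\<close> is the truncated
      Laplace integral of \<open>k\<close> at \<open>z\<close>, and the convolution of 1 with
      \<open>hc\<close> is \<open>H\<close> frozen from time \<open>c\<close> on.\<close>
    define hc where "hc t = indicator {0..c} t *\<^sub>R h t" for t
    have ez: "exp (- w * of_real t) * h t = exp (- z * of_real t) * k t" for t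
      by (simp add: h_def w_def exp_add[symmetric] mult.assoc[symmetric] algebra_simps)
    have lihc: "laplace_integrand hc w = (\<lambda>t. indicator {0..c} t *\<^sub>R (exp (- z * of_real t) * k t))"
      using ez by (auto simp: laplace_integrand_def hc_def indicator_def fun_eq_iff)
    have si: "set_integrable lebesgue {0..c} (\<lambda>t. exp (- z * of_real t) * k t)"
      using locally_integrable_weight[OF k, of z] c by (simp add: locally_integrable_def)
    then have ihc: "integrable lebesgue (laplace_integrand hc w)" unfolding lihc set_integrable_def .
    have conv_eq: "laplace_integrand (conv (\<lambda>_. 1) hc) w = laplace_integrand (\<lambda>t. H (min t c)) w"
    proof
      fix t
      show "laplace_integrand (conv (\<lambda>_. 1) hc) w t = laplace_integrand (\<lambda>t. H (min t c)) w t"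
      proof (cases "t \<ge> 0")
        case True
        have "(\<lambda>s. indicator {0..t} s *\<^sub>R hc s) = (\<lambda>s. indicator {0..min t c} s *\<^sub>R h s)"
          by (auto simp: hc_def indicator_def fun_eq_iff)
        then have "conv (\<lambda>_. 1) hc t = H (min t c)" by (simp add: conv_def H_def integral_restrict_space)
        then show ?thesis by (simp add: laplace_integrand_def)
      qed (simp add: laplace_integrand_def)
    qed
    note cv = laplace_integrand_conv[OF li1 ihc]
    show "integrable lebesgue (laplace_integrand (\<lambda>t. H (min t c)) w)" using cv(1) unfolding conv_eq .
    have "(\<integral>t. laplace_integrand (\<lambda>t. H (min t c)) w t \<partial>lebesgue) = 1 / w * (\<integral>t. laplace_integrand hc w t \<partial>lebesgue)"
      using cv(2) unfolding conv_eq L1 .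
    also have "(\<integral>t. laplace_integrand hc w t \<partial>lebesgue) = integral {0..c} (\<lambda>t. exp (- z * of_real t) * k t)"
      using set_lebesgue_integral_eq_integral(2)[OF si] by (simp add: lihc set_lebesgue_integral_def)
    finally show "integral {0..c} (\<lambda>t. exp (- z * of_real t) * k t) = w * (\<integral>t. laplace_integrand (\<lambda>t. H (min t c)) w t \<partial>lebesgue)"
      using w0 by simp
  qed
  have liH: "laplace_integrand H w \<in> borel_measurable lebesgue"
  proof (rule borel_measurable_LIMSEQ_metric)
    show "laplace_integrand (\<lambda>t. H (min t (real n))) w \<in> borel_measurable lebesgue" for n
      by (rule borel_measurable_integrable[OF trunc(1)]) simp
    show "(\<lambda>n. laplace_integrand (\<lambda>t. H (min t (real n))) w t) \<longlonglongrightarrow> laplace_integrand H w t" for t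
    proof (rule tendsto_eventually)
      obtain n0 where "t \<le> real n0" using real_arch_simple by blast
      show "\<forall>\<^sub>F n in sequentially. laplace_integrand (\<lambda>t. H (min t (real n))) w t = laplace_integrand H w t"
        using eventually_ge_at_top[of n0] by eventually_elim (use \<open>t \<le> real n0\<close> in \<open>simp add: laplace_integrand_def min_def\<close>)
    qed
  qed
  \<comment> \<open>\<open>max 0 c\<close> because the truncation facts are stated for
    \<open>c \<ge> 0\<close>, while the limit theorem asks for measurability at every
    \<open>c\<close>.\<close>
  have "((\<lambda>c. \<integral>t. laplace_integrand (\<lambda>t. H (min t (max 0 c))) w t \<partial>lebesgue) \<longlongrightarrow> (\<integral>t. laplace_integrand H w t \<partial>lebesgue)) at_top"
  proof (rule integral_dominated_convergence_at_top[OF liH])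
    show "laplace_integrand (\<lambda>t. H (min t (max 0 c))) w \<in> borel_measurable lebesgue" for c
      by (rule borel_measurable_integrable[OF trunc(1)]) simp
    show "integrable lebesgue (\<lambda>t. M * norm (laplace_integrand (\<lambda>_. 1) w t))"
      by (intro integrable_mult_right integrable_norm li1)
    show "AE t in lebesgue. ((\<lambda>c. laplace_integrand (\<lambda>t. H (min t (max 0 c))) w t) \<longlongrightarrow> laplace_integrand H w t) at_top"
    proof (rule AE_I2, rule tendsto_eventually)
      fix t
      show "\<forall>\<^sub>F c in at_top. laplace_integrand (\<lambda>t. H (min t (max 0 c))) w t = laplace_integrand H w t"
        using eventually_ge_at_top[of t] by eventually_elim (auto simp: laplace_integrand_def min_def max_def)
    qed
    have "norm (laplace_integrand (\<lambda>t. H (min t (max 0 c))) w t) \<le> M * norm (laplace_integrand (\<lambda>_. 1) w t)" for c t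
    proof (cases "t \<ge> 0")
      case True
      then have "cmod (H (min t (max 0 c))) \<le> M" by (intro M) auto
      then show ?thesis using True by (simp add: laplace_integrand_def norm_mult mult.commute mult_right_mono)
    qed (simp add: laplace_integrand_def)
    then show "\<forall>\<^sub>F c in at_top. AE t in lebesgue. norm (laplace_integrand (\<lambda>t. H (min t (max 0 c))) w t) \<le> M * norm (laplace_integrand (\<lambda>_. 1) w t)"
      by simp
  qed
  then have "((\<lambda>c. w * (\<integral>t. laplace_integrand (\<lambda>t. H (min t (max 0 c))) w t \<partial>lebesgue)) \<longlongrightarrow> w * (\<integral>t. laplace_integrand H w t \<partial>lebesgue)) at_top"
    by (rule tendsto_mult_left)
  moreover have "\<forall>\<^sub>F c in at_top. w * (\<integral>t. laplace_integrand (\<lambda>t. H (min t (max 0 c))) w t \<partial>lebesgue) = integral {0..c} (\<lambda>t. exp (- z * of_real t) * k t)"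
    using eventually_ge_at_top[of 0] by eventually_elim (simp only: trunc(2) max.absorb2)
  ultimately show ?thesis unfolding has_laplace_def by (blast intro: Lim_transform_eventually)
qed

section \<open>Convergence and absolute convergence right of the abscissa\<close>

lemma laplace_absD:
  assumes "ereal \<sigma> \<ge> laplace_abs k" "Re z > \<sigma>"
  obtains z0 v0 where "has_laplace k z0 v0" "Re z0 < Re z"
proof -
  have "laplace_abs k < ereal (Re z)" using assms by (metis le_less_trans less_ereal.simps(1))
  then show ?thesis using that unfolding laplace_abs_def Inf_less_iff by auto
qed

lemma has_laplace_laplace:
  assumes "locally_integrable k" "ereal \<sigma> \<ge> laplace_abs k" "Re z > \<sigma>"
  shows "has_laplace k z (laplace k z)"
proof -
  obtain z0 v0 where "has_laplace k z0 v0" "Re z0 < Re z" by (rule laplace_absD[OF assms(2,3)])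
  then obtain v where "has_laplace k z v" using has_laplace_half_plane[OF assms(1)] by blast
  then show ?thesis using laplace_eqI by blast
qed

text \<open>At the real point \<open>Re z\<close> the truncated transforms of
  \<open>modulus a\<close> are increasing integrals of the modulus of the integrand. Their
  convergence is integrability, by monotone convergence.\<close>

lemma integrable_laplace_integrand_modulus:
  assumes a: "locally_integrable a" and \<sigma>: "ereal \<sigma> \<ge> laplace_abs (modulus a)" and z: "Re z > \<sigma>"
  shows "integrable lebesgue (laplace_integrand a z)"
proof -
  define x where "x = Re z"
  define r where "r t = exp (- x * t) * cmod (a t)" for t
  have am: "locally_integrable (modulus a)"
    unfolding locally_integrable_def
  proof (intro allI impI)
    fix c :: real assume "0 \<le> c"
    then have "a absolutely_integrable_on {0..c}" using a by (simp add: locally_integrable_def)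
    then have "(\<lambda>t. norm (a t)) absolutely_integrable_on {0..c}" by (rule set_integrable_norm)
    then show "modulus a absolutely_integrable_on {0..c}"
      using absolutely_integrable_linear[OF _ bounded_linear_of_real] by (fastforce simp: o_def)
  qed
  obtain v where v: "has_laplace (modulus a) (of_real x) v"
    using has_laplace_laplace[OF am \<sigma>, of "of_real x"] z by (auto simp: x_def)
  have si: "set_integrable lebesgue {0..real n} r" for n
  proof -
    have "set_integrable lebesgue {0..real n} (\<lambda>t. exp (- of_real x * complex_of_real t) * a t)"
      using locally_integrable_weight[OF a, of "of_real x"] by (simp add: locally_integrable_def)
    from set_integrable_norm[OF this] show ?thesis by (simp add: r_def[abs_def] norm_mult)
  qed
  have "integrable lebesgue (\<lambda>t. indicator {0..} t *\<^sub>R r t)"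
  proof (rule integrable_monotone_convergence)
    show "integrable lebesgue (\<lambda>t. indicator {0..real n} t *\<^sub>R r t)" for n
      using si unfolding set_integrable_def .
    show "AE t in lebesgue. mono (\<lambda>n. indicator {0..real n} t *\<^sub>R r t)"
      by (intro AE_I2 monoI) (auto simp: indicator_def r_def)
    show lim: "AE t in lebesgue. (\<lambda>n. indicator {0..real n} t *\<^sub>R r t) \<longlonglongrightarrow> indicator {0..} t *\<^sub>R r t"
    proof (intro AE_I2 tendsto_eventually)
      fix t
      obtain N where N: "t \<le> real N" using real_arch_simple by blast
      show "\<forall>\<^sub>F n in sequentially. indicator {0..real n} t *\<^sub>R r t = indicator {0..} t *\<^sub>R r t"
        using eventually_ge_at_top[of N] by eventually_elim (use N in \<open>auto simp: indicator_def\<close>)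
    qed
    have eq: "exp (- of_real x * complex_of_real t) * modulus a t = of_real (r t)" for t
      by (simp add: r_def exp_of_real[symmetric])
    have "((\<lambda>c. integral {0..c} (\<lambda>t. complex_of_real (r t))) \<longlongrightarrow> v) at_top"
      using v unfolding has_laplace_def eq .
    then have lim: "(\<lambda>n. Re (integral {0..real n} (\<lambda>t. complex_of_real (r t)))) \<longlonglongrightarrow> Re v"
      by (intro tendsto_Re) (rule filterlim_compose[OF _ filterlim_real_sequentially])
    have "Re (integral {0..real n} (\<lambda>t. complex_of_real (r t))) = (\<integral>t. indicator {0..real n} t *\<^sub>R r t \<partial>lebesgue)" for n
    proof -
      have hi: "(r has_integral (\<integral>t. indicator {0..real n} t *\<^sub>R r t \<partial>lebesgue)) {0..real n}"
        using has_integral_set_lebesgue[OF si] by (simp add: set_lebesgue_integral_def)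
      from has_integral_of_real[OF this, where 'b = complex] show ?thesis
        by (simp add: integral_unique)
    qed
    then show "(\<lambda>n. \<integral>t. indicator {0..real n} t *\<^sub>R r t \<partial>lebesgue) \<longlonglongrightarrow> Re v" using lim by simp
    show "(\<lambda>t. indicator {0..} t *\<^sub>R r t) \<in> borel_measurable lebesgue"
    proof -
      have "(\<lambda>t. norm (laplace_integrand a z t)) \<in> borel_measurable lebesgue"
        using laplace_integrand_measurable[OF a, of z] by measurable
      also have "(\<lambda>t. norm (laplace_integrand a z t)) = (\<lambda>t. indicator {0..} t *\<^sub>R r t)"
        by (auto simp: laplace_integrand_def r_def x_def norm_mult indicator_def fun_eq_iff)
      finally show ?thesis .
    qed
  qed
  then show ?thesis
    by (rule Bochner_Integration.integrable_bound[OF _ laplace_integrand_measurable[OF a]])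
       (auto simp: laplace_integrand_def r_def x_def norm_mult indicator_def)
qed

section \<open>Uniqueness of the Laplace transform\<close>

text \<open>Translates the values of the transform at \<open>x + n\<close> into moments in the
  variable \<open>exp (- t)\<close>.\<close>

lemma laplace_integrand_shift:
  "exp (- real n * t) *\<^sub>R laplace_integrand u (of_real x) t = laplace_integrand u (of_real (x + real n)) t"
proof -
  have "complex_of_real (exp (- real n * t)) * exp (- of_real x * of_real t) = exp (- of_real (x + real n) * of_real t)"
    by (simp add: exp_of_real[symmetric] exp_add[symmetric] algebra_simps)
  then have "complex_of_real (exp (- real n * t)) * (exp (- of_real x * of_real t) * u t) = exp (- of_real (x + real n) * of_real t) * u t"
    by (simp only: mult.assoc[symmetric])
  then show ?thesis
    unfolding laplace_integrand_def scaleR_conv_of_real by (subst mult.left_commute) (simp only:)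
qed

text \<open>Linear combinations of vanishing moments cover polynomials in \<open>exp (- t)\<close>,
  and Weierstrass approximation on \<open>{0..1}\<close> covers continuous functions.\<close>

lemma laplace_moment_continuous:
  fixes h :: "real \<Rightarrow> real"
  assumes int: "\<And>n. integrable lebesgue (laplace_integrand u (of_real (x + real n)))"
    and zero: "\<And>n. (\<integral>t. laplace_integrand u (of_real (x + real n)) t \<partial>lebesgue) = 0"
    and h: "continuous_on {0..1} h"
  shows "integrable lebesgue (\<lambda>t. (indicator {0..} t * h (exp (- t))) *\<^sub>R laplace_integrand u (of_real x) t)"
    "(\<integral>t. (indicator {0..} t * h (exp (- t))) *\<^sub>R laplace_integrand u (of_real x) t \<partial>lebesgue) = 0"
proof -
  let ?v = "laplace_integrand u (of_real x)"
  have v: "integrable lebesgue ?v" using int[of 0] by simp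
  have integ: "integrable lebesgue (\<lambda>t. (indicator {0..} t * g (exp (- t))) *\<^sub>R ?v t)"
    if g: "continuous_on {0..1} g" for g :: "real \<Rightarrow> real"
  proof -
    have "continuous_on {0..} (\<lambda>t. g (exp (- t)))"
      by (rule continuous_on_compose2[OF g]) (auto intro!: continuous_intros)
    then have "(\<lambda>t. indicator {0..} t *\<^sub>R g (exp (- t))) \<in> borel_measurable borel"
      by (intro borel_measurable_continuous_on_indicator) auto
    then have m: "(\<lambda>t. indicator {0..} t * g (exp (- t))) \<in> borel_measurable lebesgue"
      by (simp add: measurable_completion)
    obtain B where B: "\<And>y. y \<in> {0..1} \<Longrightarrow> \<bar>g y\<bar> \<le> B"
      using compact_imp_bounded[OF compact_continuous_image[OF g compact_Icc]] by (force simp: bounded_iff)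
    have B0: "0 \<le> B" using B[of 0] by simp
    show ?thesis
    proof (rule Bochner_Integration.integrable_bound)
      show "integrable lebesgue (\<lambda>t. B * norm (?v t))" using v by simp
      show "(\<lambda>t. (indicator {0..} t * g (exp (- t))) *\<^sub>R ?v t) \<in> borel_measurable lebesgue"
        using m borel_measurable_integrable[OF v] by (rule borel_measurable_scaleR)
      show "AE t in lebesgue. norm ((indicator {0..} t * g (exp (- t))) *\<^sub>R ?v t) \<le> norm (B * norm (?v t))"
      proof (rule AE_I2)
        fix t
        show "norm ((indicator {0..} t * g (exp (- t))) *\<^sub>R ?v t) \<le> norm (B * norm (?v t))"
          using B[of "exp (- t)"] B0 by (cases "t \<ge> 0") (auto simp: abs_mult intro: mult_right_mono)
      qed
    qed
  qed
  show "integrable lebesgue (\<lambda>t. (indicator {0..} t * h (exp (- t))) *\<^sub>R ?v t)" by (rule integ[OF h])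
  have poly: "(\<integral>t. (indicator {0..} t * p (exp (- t))) *\<^sub>R ?v t \<partial>lebesgue) = 0"
    if p: "real_polynomial_function p" for p
  proof -
    obtain c n where p_eq: "p = (\<lambda>y. \<Sum>i\<le>n. c i * y ^ i)"
      using p unfolding real_polynomial_function_iff_sum by blast
    have "(indicator {0..} t * p (exp (- t))) *\<^sub>R ?v t = (\<Sum>i\<le>n. c i *\<^sub>R laplace_integrand u (of_real (x + real i)) t)" for t
    proof -
      have "(\<Sum>i\<le>n. c i *\<^sub>R laplace_integrand u (of_real (x + real i)) t) = p (exp (- t)) *\<^sub>R ?v t"
        unfolding laplace_integrand_shift[symmetric] p_eq
        by (simp add: scaleR_sum_left exp_of_nat_mult[symmetric])
      then show ?thesis by (cases "t \<ge> 0") (simp, simp add: laplace_integrand_def)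
    qed
    then show ?thesis using int zero by (simp add: Bochner_Integration.integral_sum)
  qed
  let ?K = "\<integral>t. norm (?v t) \<partial>lebesgue"
  let ?I = "\<integral>t. (indicator {0..} t * h (exp (- t))) *\<^sub>R ?v t \<partial>lebesgue"
  have K: "?K \<ge> 0" by simp
  have bound: "norm ?I \<le> e * ?K" if e: "e > 0" for e
  proof -
    obtain p where p: "real_polynomial_function p" "\<And>y. y \<in> {0..1} \<Longrightarrow> \<bar>h y - p y\<bar> < e"
      using Stone_Weierstrass_real_polynomial_function[OF compact_Icc h e] by blast
    have pc: "continuous_on {0..1} p"
      using p(1) continuous_on_polymonial_function[of p] by (simp add: real_polynomial_function_eq)
    have "?I = (\<integral>t. (indicator {0..} t * h (exp (- t))) *\<^sub>R ?v t \<partial>lebesgue) - (\<integral>t. (indicator {0..} t * p (exp (- t))) *\<^sub>R ?v t \<partial>lebesgue)"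
      using poly[OF p(1)] by simp
    also have "\<dots> = (\<integral>t. (indicator {0..} t * h (exp (- t))) *\<^sub>R ?v t - (indicator {0..} t * p (exp (- t))) *\<^sub>R ?v t \<partial>lebesgue)"
      by (rule Bochner_Integration.integral_diff[symmetric, OF integ[OF h] integ[OF pc]])
    also have "norm \<dots> \<le> (\<integral>t. e * norm (?v t) \<partial>lebesgue)"
    proof (rule Bochner_Integration.integral_norm_bound_integral)
      show "integrable lebesgue (\<lambda>t. (indicator {0..} t * h (exp (- t))) *\<^sub>R ?v t - (indicator {0..} t * p (exp (- t))) *\<^sub>R ?v t)"
        using integ[OF h] integ[OF pc] by (rule Bochner_Integration.integrable_diff)
      show "integrable lebesgue (\<lambda>t. e * norm (?v t))" using v by simp
      fix t
      show "norm ((indicator {0..} t * h (exp (- t))) *\<^sub>R ?v t - (indicator {0..} t * p (exp (- t))) *\<^sub>R ?v t) \<le> e * norm (?v t)"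
      proof (cases "t \<ge> 0")
        case True
        have "(indicator {0..} t * h (exp (- t))) *\<^sub>R ?v t - (indicator {0..} t * p (exp (- t))) *\<^sub>R ?v t
          = (h (exp (- t)) - p (exp (- t))) *\<^sub>R ?v t" using True by (simp add: scaleR_diff_left)
        also have "norm \<dots> \<le> e * norm (?v t)"
          using p(2)[of "exp (- t)"] True by (simp add: mult_right_mono)
        finally show ?thesis .
      qed (use e in simp)
    qed
    finally show ?thesis by simp
  qed
  have "norm ?I \<le> 0"
  proof (rule field_le_epsilon)
    fix e :: real assume e: "e > 0"
    \<comment> \<open>\<open>?K + 1\<close> instead of \<open>?K\<close> as divisor, since
      \<open>?K\<close> may be 0.\<close>
    have K1: "0 < ?K + 1" using K by linarith
    have "norm ?I \<le> e / (?K + 1) * ?K" by (intro bound divide_pos_pos e K1)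
    also have "\<dots> \<le> e / (?K + 1) * (?K + 1)" using e K1 by (intro mult_left_mono) auto
    also have "\<dots> = e" using K1 by simp
    finally show "norm ?I \<le> 0 + e" by simp
  qed
  then show "?I = 0" by simp
qed

text \<open>
  The moments of \<open>u\<close> in the variable \<open>exp (- t)\<close> vanish, hence so does the integral of \<open>u\<close> against the
  bounded function \<open>cnj u / (1 + |u|\<^sup>2)\<close>.
\<close>

lemma laplace_zero_imp_zero:
  assumes u: "continuous_on {0..} u"
    and int: "\<And>x. x > \<sigma> \<Longrightarrow> integrable lebesgue (laplace_integrand u (of_real x))"
    and zero: "\<And>x. x > \<sigma> \<Longrightarrow> laplace u (of_real x) = 0"
    and t: "t \<ge> 0"
  shows "u t = 0"
proof -
  define x where "x = \<sigma> + 1"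
  let ?v = "laplace_integrand u (of_real x)"
  have int': "integrable lebesgue (laplace_integrand u (of_real (x + real n)))" for n
    by (rule int) (simp add: x_def)
  have zero': "(\<integral>t. laplace_integrand u (of_real (x + real n)) t \<partial>lebesgue) = 0" for n
    using laplace_absolute[OF int'] zero[of "x + real n"] by (simp add: x_def)
  define w where "w t = cnj (u t) / of_real (1 + (cmod (u t))\<^sup>2)" for t
  have pos: "0 < 1 + (cmod y)\<^sup>2" for y by (simp add: add_pos_nonneg)
  have w1: "cmod (w t) \<le> 1" for t
  proof -
    have "0 \<le> (cmod (u t) - 1)\<^sup>2" by simp
    then have "2 * cmod (u t) \<le> 1 + (cmod (u t))\<^sup>2" by (simp add: power2_diff)
    then have "cmod (u t) \<le> 1 + (cmod (u t))\<^sup>2" using norm_ge_zero[of "u t"] by linarith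
    then show ?thesis using pos[of "u t"] by (simp add: w_def norm_divide del: of_real_add)
  qed
  have wc: "continuous_on {0..} w"
    unfolding w_def using u pos by (intro continuous_intros) (auto simp del: of_real_add simp: less_imp_neq[symmetric])
  \<comment> \<open>In the variable \<open>y = exp (- t)\<close>, time infinity is
    \<open>y = 0\<close>. There \<open>w\<close> is known only to be bounded, and the factor
    \<open>y\<close> makes \<open>h\<close> continuous.\<close>
  define h where "h y = (if y = 0 then 0 else of_real y * w (- ln y))" for y
  have hc: "continuous_on {0..1} h"
    unfolding continuous_on_def
  proof
    fix y :: real assume y: "y \<in> {0..1}"
    show "(h \<longlongrightarrow> h y) (at y within {0..1})"
    proof (cases "y = 0")
      case True
      have id0: "((\<lambda>s. s) \<longlongrightarrow> 0) (at y within {0..1})" using tendsto_ident_at[of y "{0..1}"] True by simp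
      have "norm (h s) \<le> s" if "s \<in> {0..1}" for s
        using that mult_left_mono[OF w1, of s "- ln s"] by (simp add: h_def norm_mult)
      then have "\<forall>\<^sub>F s in at y within {0..1}. norm (h s) \<le> s"
        unfolding eventually_at_filter by (intro always_eventually allI impI)
      then have "(h \<longlongrightarrow> 0) (at y within {0..1})" by (rule Lim_null_comparison[OF _ id0])
      then show ?thesis using True by (simp add: h_def)
    next
      case False
      have "continuous_on {0<..1} (\<lambda>s. of_real s * w (- ln s))"
        by (intro continuous_intros continuous_on_compose2[OF wc]) auto
      then have "continuous_on {0<..1} h"
        by (rule continuous_on_eq) (simp add: h_def)
      then have "(h \<longlongrightarrow> h y) (at y within {0<..1})" using y False by (auto simp: continuous_on_def)
      also have "at y within {0<..1} = at y within {0..1}"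
        by (rule at_within_nhd[of _ "{0<..}"]) (use y False in auto)
      finally show ?thesis .
    qed
  qed
  \<comment> \<open>The product of \<open>h (exp (- s))\<close> and the integrand; the 1 in
    \<open>1 + x\<close> stems from the factor \<open>y\<close> in \<open>h\<close>.\<close>
  define r where "r s = exp (- ((1 + x) * s)) * ((cmod (u s))\<^sup>2 / (1 + (cmod (u s))\<^sup>2))" for s
  have r0: "0 \<le> r s" for s using pos[of "u s"] by (simp add: r_def)
  have rc: "continuous_on {0..} r"
    unfolding r_def using u pos by (intro continuous_intros) (auto simp: less_imp_neq[symmetric])
  \<comment> \<open>The moment lemma is for real functions, so \<open>h\<close> enters through its
    real and imaginary parts.\<close>
  have pw: "(indicator {0..} s * Re (h (exp (- s)))) *\<^sub>R ?v s + \<i> * ((indicator {0..} s * Im (h (exp (- s)))) *\<^sub>R ?v s)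
      = of_real (indicator {0..} s *\<^sub>R r s)" for s
  proof (cases "s \<ge> 0")
    case True
    have "(indicator {0..} s * Re (h (exp (- s)))) *\<^sub>R ?v s + \<i> * ((indicator {0..} s * Im (h (exp (- s)))) *\<^sub>R ?v s)
      = h (exp (- s)) * ?v s"
      using True complex_eq[of "h (exp (- s))"] by (simp add: scaleR_conv_of_real) (metis distrib_right mult.assoc)
    also have "\<dots> = of_real (exp (- s)) * of_real (exp (- x * s)) * (cnj (u s) * u s / of_real (1 + (cmod (u s))\<^sup>2))"
      using True by (simp add: h_def w_def laplace_integrand_def exp_of_real[symmetric] mult_ac del: of_real_add)
    also have "cnj (u s) * u s = of_real ((cmod (u s))\<^sup>2)"
      by (metis complex_norm_square mult.commute of_real_power)
    also have "of_real (exp (- s)) * of_real (exp (- x * s)) * (of_real ((cmod (u s))\<^sup>2) / of_real (1 + (cmod (u s))\<^sup>2)) = complex_of_real (r s)"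
    proof -
      have "exp (- s) * exp (- x * s) = exp (- ((1 + x) * s))" by (simp add: exp_add[symmetric] algebra_simps)
      then show ?thesis by (simp only: r_def of_real_mult[symmetric] of_real_divide[symmetric])
    qed
    finally show ?thesis using True by simp
  qed (simp add: laplace_integrand_def)
  note mR = laplace_moment_continuous[OF int' zero' continuous_on_Re[OF hc]]
  note mI = laplace_moment_continuous[OF int' zero' continuous_on_Im[OF hc]]
  have "integrable lebesgue (\<lambda>s. complex_of_real (indicator {0..} s *\<^sub>R r s))"
    "(\<integral>s. complex_of_real (indicator {0..} s *\<^sub>R r s) \<partial>lebesgue) = 0"
    unfolding pw[symmetric]
    by (rule Bochner_Integration.integrable_add[OF mR(1) integrable_mult_right[OF mI(1)]])
       (simp only: Bochner_Integration.integral_add[OF mR(1) integrable_mult_right[OF mI(1)]]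
          integral_mult_right_zero mR(2) mI(2) mult_zero_right add_0)
  then have ri: "integrable lebesgue (\<lambda>s. indicator {0..} s *\<^sub>R r s)" "(\<integral>s. indicator {0..} s *\<^sub>R r s \<partial>lebesgue) = 0"
    unfolding complex_of_real_integrable_eq integral_complex_of_real by simp_all
  \<comment> \<open>A nonnegative continuous function with integral 0 vanishes on the interval;
    \<open>t + 1\<close> keeps it nondegenerate for \<open>t = 0\<close>.\<close>
  have si: "set_integrable lebesgue {0..t + 1} r"
    by (rule set_integrable_subset[of _ "{0..}"]) (use ri(1) in \<open>auto simp: set_integrable_def\<close>)
  have "(\<integral>s. indicator {0..t + 1} s *\<^sub>R r s \<partial>lebesgue) \<le> (\<integral>s. indicator {0..} s *\<^sub>R r s \<partial>lebesgue)"
    using si ri(1) r0 unfolding set_integrable_def by (intro integral_mono) (auto simp: indicator_def)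
  moreover have "0 \<le> (\<integral>s. indicator {0..t + 1} s *\<^sub>R r s \<partial>lebesgue)" using r0 by (intro Bochner_Integration.integral_nonneg) simp
  ultimately have "(r has_integral 0) (cbox 0 (t + 1))"
    using has_integral_set_lebesgue[OF si] ri(2) by (simp add: set_lebesgue_integral_def)
  moreover have "continuous_on (cbox 0 (t + 1)) r" using rc by (rule continuous_on_subset) auto
  ultimately have "r t = 0"
    using t by (intro has_integral_0_cbox_imp_0[of 0 "t + 1" r t]) (auto simp: r0)
  then show ?thesis using pos[of "u t"] by (simp add: r_def)
qed

section \<open>Laplace transforms of vector-valued functions\<close>

definition exp_bounded :: "real \<Rightarrow> (real \<Rightarrow> 'x::complex_lcs) \<Rightarrow> bool" where
  "exp_bounded \<sigma> F \<longleftrightarrow> (\<forall>p. cont_seminorm p \<longrightarrow> (\<exists>M. \<forall>t\<ge>0. p (F t) \<le> M * exp (\<sigma> * t)))"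

lemma exp_bounded_functional:
  assumes "exp_bounded \<sigma> F" "cont_linear (\<phi> :: 'x::complex_lcs \<Rightarrow> complex)"
  obtains M where "\<And>t. t \<ge> 0 \<Longrightarrow> cmod (\<phi> (F t)) \<le> M * exp (\<sigma> * t)"
  using assms(1) cont_linear_seminorm[OF assms(2) cont_seminorm_cmod] unfolding exp_bounded_def by blast

lemma continuous_on_functional:
  assumes "continuous_on S F" "cont_linear (\<phi> :: 'x::complex_lcs \<Rightarrow> 'y::complex_lcs)"
  shows "continuous_on S (\<lambda>t. \<phi> (F t))"
  by (rule continuous_on_compose2[OF cont_linear_continuous[OF assms(2)] assms(1)]) simp

text \<open>Some \<open>y / (n + 1)\<close> lies in the neighbourhood that equicontinuity provides
  for the unit ball of \<open>p\<close>; by homogeneity \<open>n + 1\<close> is then a bound for the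
  weighted orbit of \<open>y\<close>.\<close>

lemma equicontinuous_orbit_bounded:
  fixes R :: "real \<Rightarrow> 'y::complex_lcs \<Rightarrow> 'x::complex_lcs"
  assumes eq: "equicontinuous {(\<lambda>y. exp (- \<omega> * t) *\<^sub>R R t y) | t. t \<ge> 0}"
    and R: "strongly_continuous_family R"
  shows "exp_bounded \<omega> (\<lambda>t. R t y)"
  unfolding exp_bounded_def
proof (intro allI impI)
  fix p :: "'x \<Rightarrow> real" assume p: "cont_seminorm p"
  then have sem: "seminorm p" by (simp add: cont_seminorm_def)
  have "open {x. p x < 1} \<and> 0 \<in> {x. p x < 1}"
    using open_seminorm_ball[OF p] by (simp add: seminorm_zero[OF sem])
  from eq[unfolded equicontinuous_def, rule_format, OF this] obtain V where V: "open V" "0 \<in> V"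
    and sub: "\<forall>T\<in>{(\<lambda>y. exp (- \<omega> * t) *\<^sub>R R t y) | t. t \<ge> 0}. T ` V \<subseteq> {x. p x < 1}" by (elim exE conjE)
  have V3: "p (exp (- \<omega> * t) *\<^sub>R R t v) < 1" if "t \<ge> 0" "v \<in> V" for t v
  proof -
    have "(\<lambda>y. exp (- \<omega> * t) *\<^sub>R R t y) ` V \<subseteq> {x. p x < 1}" using that(1) by (intro bspec[OF sub]) blast
    then show ?thesis using that(2) by auto
  qed
  have "((\<lambda>n. complex_of_real (1 / real (Suc n)) *\<^sub>C y) \<longlongrightarrow> complex_of_real 0 *\<^sub>C y) sequentially"
    by (intro tendsto_scaleC tendsto_of_real tendsto_const) (use LIMSEQ_inverse_real_of_nat in \<open>simp add: inverse_eq_divide\<close>)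
  then have "\<forall>\<^sub>F n in sequentially. complex_of_real (1 / real (Suc n)) *\<^sub>C y \<in> V"
    using V by (intro topological_tendstoD[OF _ V(1)]) (auto simp: scaleC_zero_left)
  then obtain n where n: "(1 / real (Suc n)) *\<^sub>R y \<in> V"
    by (auto simp: eventually_sequentially scaleR_scaleC)
  have "p (R t y) \<le> real (Suc n) * exp (\<omega> * t)" if t: "t \<ge> 0" for t
  proof -
    have "p (exp (- \<omega> * t) *\<^sub>R R t ((1 / real (Suc n)) *\<^sub>R y)) < 1" by (rule V3[OF t n])
    moreover have "cont_linear (R t)" using R t by (simp add: strongly_continuous_family_def)
    ultimately have "exp (- (\<omega> * t)) * (1 / real (Suc n)) * p (R t y) < 1"
      by (simp add: cont_linear_scaleR seminorm_scaleR[OF sem] mult.assoc)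
    then have "real (Suc n) * exp (\<omega> * t) * (exp (- (\<omega> * t)) * (1 / real (Suc n)) * p (R t y)) \<le> real (Suc n) * exp (\<omega> * t) * 1"
      by (intro mult_left_mono) auto
    then show ?thesis by (simp add: exp_minus inverse_eq_divide pos_divide_le_eq del: of_nat_Suc)
  qed
  then show "\<exists>M. \<forall>t\<ge>0. p (R t y) \<le> M * exp (\<omega> * t)" by blast
qed

lemma lcs_convolution_functional:
  fixes F :: "real \<Rightarrow> 'x::sc_lcs" and \<phi> :: "'x \<Rightarrow> complex"
  assumes a: "locally_integrable a" and F: "continuous_on {0..} F" and \<phi>: "cont_linear \<phi>" and t: "t \<ge> 0"
  shows "\<phi> (lcs_convolution a F t) = conv a (\<lambda>s. \<phi> (F s)) t"
  unfolding lcs_convolution_def conv_def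
  by (rule lcs_integral_functional(2)[OF integrable_reflected[OF a t] _ \<phi>]) (use F in \<open>auto intro: continuous_on_subset\<close>)

text \<open>\<open>lcs_laplace\<close> is a \<open>Lim\<close>, so convergence has to be shown
  before \<open>\<phi>\<close> passes through it. The truncated integrals are Cauchy at an
  exponential rate in every seminorm.\<close>

lemma has_laplace_functional:
  fixes F :: "real \<Rightarrow> 'x::sc_lcs" and \<phi> :: "'x \<Rightarrow> complex"
  assumes F: "continuous_on {0..} F" and bd: "exp_bounded \<sigma> F" and z: "Re z > \<sigma>" and \<phi>: "cont_linear \<phi>"
  shows "has_laplace (\<lambda>t. \<phi> (F t)) z (\<phi> (lcs_laplace F z))"
proof -
  define x where "x = Re z - \<sigma>"
  have x: "x > 0" using z by (simp add: x_def)
  let ?E = "\<lambda>t. exp (- z * complex_of_real t)"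
  define I where "I c = lcs_integral (lebesgue_on {0..c}) (\<lambda>t. ?E t *\<^sub>C F t)" for c
  have Eint: "integrable (lebesgue_on {0..c}) ?E" for c
    using absolutely_integrable_continuous_real[OF continuous_on_exp_weight, of 0 c z]
    by (simp add: set_integrable_def integrable_restrict_space)
  have FC: "continuous_on {0..c} F" for c using F by (rule continuous_on_subset) auto
  have I: "integrable lebesgue (\<lambda>t. indicator {0..c} t *\<^sub>R (?E t * \<psi> (F t)))"
    "\<psi> (I c) = (\<integral>t. indicator {0..c} t *\<^sub>R (?E t * \<psi> (F t)) \<partial>lebesgue)"
    if "cont_linear \<psi>" for c and \<psi> :: "'x \<Rightarrow> complex"
    using lcs_integral_functional[OF Eint FC that, of c] unfolding I_def
    by (simp_all add: integrable_restrict_space integral_restrict_space)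
  have tail_int: "integrable lebesgue (\<lambda>t. indicator {c..} t *\<^sub>R exp (- x * t))"
    and tail: "(\<integral>t. indicator {c..} t *\<^sub>R exp (- x * t) \<partial>lebesgue) = exp (- x * c) / x" for c
  proof -
    have hi: "((\<lambda>t. exp (- x * t)) has_integral exp (- x * c) / x) {c..}"
      by (rule has_integral_exp_minus_to_infinity[OF x])
    then have si: "set_integrable lebesgue {c..} (\<lambda>t. exp (- x * t))"
      by (intro nonnegative_absolutely_integrable_1) auto
    then show "integrable lebesgue (\<lambda>t. indicator {c..} t *\<^sub>R exp (- x * t))" by (simp add: set_integrable_def)
    show "(\<integral>t. indicator {c..} t *\<^sub>R exp (- x * t) \<partial>lebesgue) = exp (- x * c) / x"
      using set_lebesgue_integral_eq_integral(2)[OF si] integral_unique[OF hi] by (simp add: set_lebesgue_integral_def)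
  qed
  have cauchy: "\<exists>M. \<forall>c\<ge>0. \<forall>d\<ge>c. p (I d - I c) \<le> M * exp (- x * c)" if p: "cont_seminorm p" for p
  proof -
    obtain M where M: "\<And>t. t \<ge> 0 \<Longrightarrow> p (F t) \<le> M * exp (\<sigma> * t)" using bd p unfolding exp_bounded_def by blast
    have "p (I d - I c) \<le> (M / x) * exp (- x * c)" if cd: "0 \<le> c" "c \<le> d" for c d
    proof -
      \<comment> \<open>A functional attaining \<open>p\<close> at the difference reduces the
        estimate to a scalar integral over the tail.\<close>
      obtain \<psi> :: "'x \<Rightarrow> complex" where \<psi>: "cont_linear \<psi>" "\<And>v. cmod (\<psi> v) \<le> p v" "\<psi> (I d - I c) = of_real (p (I d - I c))"
        by (rule Hahn_Banach_seminorm[OF p, where v = "I d - I c"]) blast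
      let ?g = "\<lambda>c t. indicator {0..c} t *\<^sub>R (?E t * \<psi> (F t))"
      have "p (I d - I c) \<le> cmod (\<psi> (I d - I c))" by (simp add: \<psi>(3))
      also have "\<psi> (I d - I c) = (\<integral>t. ?g d t \<partial>lebesgue) - (\<integral>t. ?g c t \<partial>lebesgue)"
        by (simp only: cont_linear_diff[OF \<psi>(1)] I(2)[OF \<psi>(1)])
      also have "\<dots> = (\<integral>t. ?g d t - ?g c t \<partial>lebesgue)"
        by (rule Bochner_Integration.integral_diff[symmetric, OF I(1)[OF \<psi>(1)] I(1)[OF \<psi>(1)]])
      also have "cmod \<dots> \<le> (\<integral>t. M * (indicator {c..} t *\<^sub>R exp (- x * t)) \<partial>lebesgue)"
      proof (rule Bochner_Integration.integral_norm_bound_integral)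
        show "integrable lebesgue (\<lambda>t. ?g d t - ?g c t)"
          by (rule Bochner_Integration.integrable_diff[OF I(1)[OF \<psi>(1)] I(1)[OF \<psi>(1)]])
        show "integrable lebesgue (\<lambda>t. M * (indicator {c..} t *\<^sub>R exp (- x * t)))"
          by (rule integrable_mult_right[OF tail_int])
        fix t
        have M0: "0 \<le> M" using M[of 0] seminorm_nonneg[of p "F 0"] p by (simp add: cont_seminorm_def)
        have *: "cmod (?E t * \<psi> (F t)) \<le> M * exp (- x * t)" if "t \<ge> 0"
        proof -
          have "cmod (?E t * \<psi> (F t)) = exp (- Re z * t) * cmod (\<psi> (F t))" by (simp add: norm_mult)
          also have "\<dots> \<le> exp (- Re z * t) * (M * exp (\<sigma> * t))"
            using order_trans[OF \<psi>(2) M[OF that]] by (intro mult_left_mono) auto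
          also have "\<dots> = M * exp (- x * t)" by (simp add: x_def exp_add[symmetric] algebra_simps)
          finally show ?thesis .
        qed
        consider "t \<in> {c<..d}" | "t \<notin> {c<..d}" by blast
        then show "cmod (?g d t - ?g c t) \<le> M * (indicator {c..} t *\<^sub>R exp (- x * t))"
        proof cases
          case 1
          then show ?thesis using cd * by simp
        next
          case 2
          then have z0: "?g d t - ?g c t = 0" using cd by (auto simp: indicator_def)
          show ?thesis unfolding z0 using M0 by simp
        qed
      qed
      also have "\<dots> = (M / x) * exp (- x * c)" by (simp only: integral_mult_right_zero tail) simp
      finally show ?thesis .
    qed
    then show ?thesis by blast
  qed
  have decay: "((\<lambda>c. M * exp (- x * c)) \<longlongrightarrow> 0) at_top" for M
  proof -
    have "((\<lambda>c. exp (- x * c)) \<longlongrightarrow> 0) at_top"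
      using x by (intro filterlim_compose[OF exp_at_bot] filterlim_tendsto_neg_mult_at_bot[OF tendsto_const] filterlim_ident) auto
    then show ?thesis by (rule tendsto_mult_right_zero)
  qed
  \<comment> \<open>Sequential completeness yields a limit along the integers; the explicit rate
    then carries it over to real \<open>c\<close>.\<close>
  have "convergent (\<lambda>n. I (real n))"
  proof (rule sequentially_complete)
    fix U :: "'x set" assume "open U" "0 \<in> U"
    then obtain p where p: "cont_seminorm p" "\<And>x. p x < 1 \<Longrightarrow> x \<in> U"
      by (rule cont_seminorm_in_neighbourhood) blast
    have sem: "seminorm p" using p by (simp add: cont_seminorm_def)
    obtain M where M: "\<And>c d. c \<ge> 0 \<Longrightarrow> d \<ge> c \<Longrightarrow> p (I d - I c) \<le> M * exp (- x * c)" using cauchy[OF p(1)] by blast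
    obtain c0 where c0: "\<And>c. c \<ge> c0 \<Longrightarrow> M * exp (- x * c) < 1 / 2"
      using order_tendstoD(2)[OF decay, of "1 / 2" M] by (auto simp: eventually_at_top_linorder)
    define N where "N = nat \<lceil>max 0 c0\<rceil>"
    have N: "real N \<ge> c0" unfolding N_def by linarith
    have "p (I (real m) - I (real n)) < 1" if mn: "m \<ge> N" "n \<ge> N" for m n
    proof -
      have half: "p (I (real j) - I (real N)) < 1 / 2" if "j \<ge> N" for j
        using M[of "real N" "real j"] c0[OF N] that by simp
      have "I (real m) - I (real n) = (I (real m) - I (real N)) - (I (real n) - I (real N))" by simp
      then have "p (I (real m) - I (real n)) \<le> p (I (real m) - I (real N)) + p (I (real n) - I (real N))"
        using seminorm_diff[OF sem] by metis
      then show ?thesis using half[OF mn(1)] half[OF mn(2)] by simp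
    qed
    then show "\<exists>N. \<forall>m\<ge>N. \<forall>n\<ge>N. I (real m) - I (real n) \<in> U" using p(2) by blast
  qed
  then obtain v where v: "(\<lambda>n. I (real n)) \<longlonglongrightarrow> v" by (auto simp: convergent_def)
  have lim: "(I \<longlongrightarrow> v) at_top"
  proof (rule tendsto_seminorms)
    fix p :: "'x \<Rightarrow> real" assume p: "cont_seminorm p"
    have sem: "seminorm p" using p by (simp add: cont_seminorm_def)
    obtain M where M: "\<And>c d. c \<ge> 0 \<Longrightarrow> d \<ge> c \<Longrightarrow> p (I d - I c) \<le> M * exp (- x * c)" using cauchy[OF p] by blast
    have bound: "p (I c - v) \<le> M * exp (- x * c)" if c: "c \<ge> 0" for c
    proof (rule tendsto_le[OF sequentially_bot _ tendsto_const])
      show "(\<lambda>n. M * exp (- x * c) + p (I (real n) - v)) \<longlonglongrightarrow> M * exp (- x * c)"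
        using tendsto_add[OF tendsto_const cont_seminorm_tendsto[OF p v], of "M * exp (- x * c)"] by simp
      obtain N where N: "c \<le> real N" using real_arch_simple by blast
      show "\<forall>\<^sub>F n in sequentially. p (I c - v) \<le> M * exp (- x * c) + p (I (real n) - v)"
        using eventually_ge_at_top[of N]
      proof eventually_elim
        case (elim n)
        have "p (I c - v) \<le> p (I (real n) - v) + p (I (real n) - I c)"
          using seminorm_diff[OF sem, of "I (real n) - v" "I (real n) - I c"] by simp
        moreover have "p (I (real n) - I c) \<le> M * exp (- x * c)" using M[of c "real n"] c N elim by simp
        ultimately show ?case by simp
      qed
    qed
    show "((\<lambda>c. p (I c - v)) \<longlongrightarrow> 0) at_top"
    proof (rule tendsto_sandwich[OF _ _ tendsto_const decay])
      show "\<forall>\<^sub>F c in at_top. 0 \<le> p (I c - v)" by (simp add: seminorm_nonneg[OF sem])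
      show "\<forall>\<^sub>F c in at_top. p (I c - v) \<le> M * exp (- x * c)"
        using eventually_ge_at_top[of 0] by eventually_elim (rule bound)
    qed
  qed
  then have L: "lcs_laplace F z = v"
    unfolding lcs_laplace_def I_def[symmetric] by (rule tendsto_Lim[OF trivial_limit_at_top_linorder])
  have "isCont \<phi> v" using cont_linear_continuous[OF \<phi>] by (simp add: continuous_on_eq_continuous_at)
  then have "((\<lambda>c. \<phi> (I c)) \<longlongrightarrow> \<phi> v) at_top" using lim by (rule isCont_tendsto_compose)
  moreover have "\<phi> (I c) = integral {0..c} (\<lambda>t. ?E t * \<phi> (F t))" for c
    using set_lebesgue_integral_eq_integral(2)[of "{0..c}" "\<lambda>t. ?E t * \<phi> (F t)"] I[OF \<phi>, of c]
    by (simp add: set_integrable_def set_lebesgue_integral_def)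
  ultimately show ?thesis unfolding has_laplace_def L by simp
qed

section \<open>Transformed kernels\<close>

lemma laplace_integrand_linear:
  "laplace_integrand (\<lambda>t. u t - v t) z = (\<lambda>t. laplace_integrand u z t - laplace_integrand v z t)"
  "laplace_integrand (\<lambda>t. u t * c) z = (\<lambda>t. laplace_integrand u z t * c)"
  by (auto simp: laplace_integrand_def fun_eq_iff algebra_simps)

lemma has_laplace_cong: "(\<And>t. t \<ge> 0 \<Longrightarrow> u t = v t) \<Longrightarrow> has_laplace u z w \<longleftrightarrow> has_laplace v z w"
  unfolding has_laplace_def
  by (intro tendsto_cong always_eventually allI Henstock_Kurzweil_Integration.integral_cong) simp

text \<open>\<open>a\<close> and \<open>b\<close> are convolved and \<open>k1\<close> occurs inside
  a convolution, whence integrability; for \<open>k\<close> the locale records convergence of the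
  transform.\<close>

locale transformed_kernels =
  fixes a k b k1 :: "real \<Rightarrow> complex" and \<omega>0 \<omega>0' :: real and f G :: "complex \<Rightarrow> complex"
  assumes a: "locally_integrable a" and k: "continuous_on {0..} k"
    and b: "locally_integrable b" and k1: "continuous_on {0..} k1"
    and a_int: "\<And>z. Re z > \<omega>0' \<Longrightarrow> integrable lebesgue (laplace_integrand a z)"
    and k_lap: "\<And>z. Re z > \<omega>0' \<Longrightarrow> has_laplace k z (laplace k z)"
    and b_int: "\<And>z. Re z > \<omega>0 \<Longrightarrow> integrable lebesgue (laplace_integrand b z)"
    and k1_int: "\<And>z. Re z > \<omega>0 \<Longrightarrow> integrable lebesgue (laplace_integrand k1 z)"
    and f: "\<And>z. Re z > \<omega>0 \<Longrightarrow> Re (f z) > \<omega>0'"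
    and a_nz: "\<And>z. Re z > \<omega>0' \<Longrightarrow> laplace a z \<noteq> 0"
    and b_lap: "\<And>z. Re z > \<omega>0 \<Longrightarrow> laplace b z = 1 / laplace a (f z)"
    and k1_lap: "\<And>z. Re z > \<omega>0 \<Longrightarrow> laplace k1 z = G z * laplace k (f z)"
begin

text \<open>What is left of the pair \<open>R\<close>, \<open>S0\<close> after a vector is fixed and
  a functional applied. The rate of \<open>g\<close> may be any number above
  \<open>\<omega>0'\<close>, that of \<open>s\<close> is \<open>\<omega>0\<close> itself.\<close>

definition scalar_related :: "(real \<Rightarrow> complex) \<Rightarrow> (real \<Rightarrow> complex) \<Rightarrow> bool" where
  "scalar_related g s \<longleftrightarrow> continuous_on {0..} g \<and> continuous_on {0..} s \<and>
     (\<forall>\<omega>>\<omega>0'. \<exists>M. \<forall>t\<ge>0. cmod (g t) \<le> M * exp (\<omega> * t)) \<and>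
     (\<exists>M. \<forall>t\<ge>0. cmod (s t) \<le> M * exp (\<omega>0 * t)) \<and>
     (\<forall>z. Re z > \<omega>0 \<longrightarrow> laplace s z = G z * laplace g (f z))"

lemma scalar_relatedD:
  assumes "scalar_related g s"
  shows "continuous_on {0..} g" "continuous_on {0..} s"
    "Re z > \<omega>0' \<Longrightarrow> integrable lebesgue (laplace_integrand g z)"
    "Re y > \<omega>0 \<Longrightarrow> integrable lebesgue (laplace_integrand s y)"
    "Re y > \<omega>0 \<Longrightarrow> laplace s y = G y * laplace g (f y)"
proof -
  show c: "continuous_on {0..} g" "continuous_on {0..} s"
    and "Re y > \<omega>0 \<Longrightarrow> laplace s y = G y * laplace g (f y)"
    using assms by (auto simp: scalar_related_def)
  show "integrable lebesgue (laplace_integrand g z)" if z: "Re z > \<omega>0'"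
  proof -
    have "\<omega>0' < (\<omega>0' + Re z) / 2" using z by simp
    then obtain M where "\<And>t. t \<ge> 0 \<Longrightarrow> cmod (g t) \<le> M * exp ((\<omega>0' + Re z) / 2 * t)"
      using assms unfolding scalar_related_def by blast
    then show ?thesis
      by (rule exp_growth_integrable[OF continuous_imp_locally_integrable[OF c(1)]]) (use z in simp_all)
  qed
  show "integrable lebesgue (laplace_integrand s y)" if y: "Re y > \<omega>0"
  proof -
    obtain M where "\<And>t. t \<ge> 0 \<Longrightarrow> cmod (s t) \<le> M * exp (\<omega>0 * t)"
      using assms unfolding scalar_related_def by blast
    then show ?thesis
      by (rule exp_growth_integrable[OF continuous_imp_locally_integrable[OF c(2)]]) (use y in simp_all)
  qed
qed

text \<open>At \<open>f z\<close> the hypothesis says that the transform of \<open>a\<close> times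
  that of \<open>g1\<close> equals \<open>c\<close> times that of \<open>k\<close> minus that of
  \<open>g2\<close>. The factor \<open>G z / laplace a (f z)\<close> turns this into the vanishing
  of the transform of \<open>u\<close>, and \<open>u\<close> is continuous.\<close>

lemma scalar_resolvent_equation:
  assumes g1: "scalar_related g1 s1" and g2: "scalar_related g2 s2"
    and eq: "\<And>t. t \<ge> 0 \<Longrightarrow> conv a g1 t + g2 t = k t * c" and t: "t \<ge> 0"
  shows "conv b (\<lambda>r. k1 r * c - s2 r) t = s1 t"
proof -
  let ?q = "\<lambda>r. k1 r * c - s2 r"
  define u where "u r = conv b ?q r - s1 r" for r
  note D1 = scalar_relatedD[OF g1] and D2 = scalar_relatedD[OF g2]
  have qc: "continuous_on {0..} ?q" using k1 D2(2) by (intro continuous_intros)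
  have cont: "continuous_on {0..} u"
    unfolding u_def using continuous_on_conv[OF b qc] D1(2) by (intro continuous_on_diff)
  have u: "integrable lebesgue (laplace_integrand u z)" "laplace u z = 0" if z: "Re z > \<omega>0" for z
  proof -
    let ?m = "f z"
    have m: "Re ?m > \<omega>0'" by (rule f[OF z])
    have qi: "integrable lebesgue (laplace_integrand ?q z)"
      unfolding laplace_integrand_linear using k1_int[OF z] D2(4)[OF z] by simp
    have ql: "(\<integral>t. laplace_integrand ?q z t \<partial>lebesgue) = laplace k1 z * c - laplace s2 z"
      unfolding laplace_integrand_linear laplace_absolute[OF k1_int[OF z]] laplace_absolute[OF D2(4)[OF z]]
      using k1_int[OF z] D2(4)[OF z] by (subst Bochner_Integration.integral_diff) simp_all
    note cq = laplace_integrand_conv[OF b_int[OF z] qi]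
    show int: "integrable lebesgue (laplace_integrand u z)"
      unfolding u_def laplace_integrand_linear using cq(1) D1(4)[OF z] by simp
    have "laplace u z = laplace b z * (laplace k1 z * c - laplace s2 z) - laplace s1 z"
      unfolding laplace_absolute[OF int] laplace_absolute[OF D1(4)[OF z]] laplace_absolute[OF b_int[OF z]]
      unfolding u_def laplace_integrand_linear(1)[of "conv b ?q"]
      by (subst Bochner_Integration.integral_diff[OF cq(1) D1(4)[OF z]]) (simp only: cq(2) ql)
    also have "\<dots> = 1 / laplace a ?m * (G z * laplace k ?m * c - G z * laplace g2 ?m) - G z * laplace g1 ?m"
      by (simp only: b_lap[OF z] k1_lap[OF z] D1(5)[OF z] D2(5)[OF z])
    finally have lu: "laplace u z = 1 / laplace a ?m * (G z * laplace k ?m * c - G z * laplace g2 ?m) - G z * laplace g1 ?m" .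
    note ca = laplace_integrand_conv[OF a_int[OF m] D1(3)[OF m]]
    have "has_laplace (conv a g1) ?m (laplace a ?m * laplace g1 ?m)"
      using has_laplace_absolute[OF ca(1)] unfolding ca(2) laplace_absolute[OF a_int[OF m]] laplace_absolute[OF D1(3)[OF m]] .
    moreover have "has_laplace g2 ?m (laplace g2 ?m)"
      using has_laplace_absolute[OF D2(3)[OF m]] unfolding laplace_absolute[OF D2(3)[OF m]] .
    \<comment> \<open>The comparison with \<open>k\<close> is made on limits of truncated integrals,
      the only form in which the transform of \<open>k\<close> is available.\<close>
    ultimately have "has_laplace (\<lambda>t. conv a g1 t + g2 t) ?m (laplace a ?m * laplace g1 ?m + laplace g2 ?m)"
      using continuous_on_conv[OF a D1(1)] D2(1) by (intro has_laplace_add continuous_imp_locally_integrable)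
    then have "has_laplace (\<lambda>t. c * k t) ?m (laplace a ?m * laplace g1 ?m + laplace g2 ?m)"
      by (subst (asm) has_laplace_cong[where v = "\<lambda>t. c * k t"]) (simp_all add: eq mult.commute)
    from has_laplace_unique[OF this has_laplace_cmult[OF k_lap[OF m]]]
    have "laplace k ?m * c - laplace g2 ?m = laplace a ?m * laplace g1 ?m" by (simp add: algebra_simps)
    moreover have "laplace u z = G z * ((laplace k ?m * c - laplace g2 ?m) / laplace a ?m - laplace g1 ?m)"
      unfolding lu by (simp add: algebra_simps diff_divide_distrib)
    ultimately show "laplace u z = 0" using a_nz[OF m] by simp
  qed
  have "u t = 0"
    by (rule laplace_zero_imp_zero[OF cont _ _ t, of \<omega>0]) (use u in simp_all)
  then show ?thesis by (simp add: u_def)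
qed

text \<open>Carries linear relations between orbits of \<open>R\<close> over to \<open>S0\<close>;
  both commutation properties of a resolvent family have this form.\<close>

lemma scalar_related_transfer:
  assumes g1: "scalar_related g1 s1" and g2: "scalar_related g2 s2"
    and eq: "\<And>t. t \<ge> 0 \<Longrightarrow> g1 t = c * g2 t" and t: "t \<ge> 0"
  shows "s1 t = c * s2 t"
proof -
  define u where "u r = s1 r - s2 r * c" for r
  note D1 = scalar_relatedD[OF g1] and D2 = scalar_relatedD[OF g2]
  have cont: "continuous_on {0..} u" unfolding u_def using D1(2) D2(2) by (intro continuous_intros)
  have u: "integrable lebesgue (laplace_integrand u z)" "laplace u z = 0" if z: "Re z > \<omega>0" for z
  proof -
    have m: "Re (f z) > \<omega>0'" by (rule f[OF z])
    show int: "integrable lebesgue (laplace_integrand u z)"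
      unfolding u_def laplace_integrand_linear using D1(4)[OF z] D2(4)[OF z] by simp
    have "laplace u z = laplace s1 z - laplace s2 z * c"
      unfolding laplace_absolute[OF int] laplace_absolute[OF D1(4)[OF z]] laplace_absolute[OF D2(4)[OF z]]
      unfolding u_def laplace_integrand_linear
      using D1(4)[OF z] D2(4)[OF z] by (subst Bochner_Integration.integral_diff) simp_all
    moreover have "has_laplace g2 (f z) (laplace g2 (f z))"
      using has_laplace_absolute[OF D2(3)[OF m]] unfolding laplace_absolute[OF D2(3)[OF m]] .
    then have "has_laplace g1 (f z) (c * laplace g2 (f z))"
      using has_laplace_cmult has_laplace_cong[of g1 "\<lambda>t. c * g2 t"] eq by blast
    then have "laplace g1 (f z) = c * laplace g2 (f z)" by (rule laplace_eqI)
    ultimately show "laplace u z = 0" by (simp add: D1(5)[OF z] D2(5)[OF z])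
  qed
  have "u t = 0"
    by (rule laplace_zero_imp_zero[OF cont _ _ t, of \<omega>0]) (use u in simp_all)
  then show ?thesis by (simp add: u_def mult.commute)
qed

definition related :: "(real \<Rightarrow> 'y::sc_lcs \<Rightarrow> 'x::sc_lcs) \<Rightarrow> (real \<Rightarrow> 'y \<Rightarrow> 'x) \<Rightarrow> bool" where
  "related R S \<longleftrightarrow> strongly_continuous_family R \<and>
    (\<forall>\<omega>>\<omega>0'. equicontinuous {(\<lambda>y. exp (- \<omega> * t) *\<^sub>R R t y) | t. t \<ge> 0}) \<and>
    strongly_continuous_family S \<and>
    equicontinuous {(\<lambda>y. exp (- \<omega>0 * t) *\<^sub>R S t y) | t. t \<ge> 0} \<and>
    (\<forall>y z. Re z > \<omega>0 \<longrightarrow> lcs_laplace (\<lambda>t. S t y) z = G z *\<^sub>C lcs_laplace (\<lambda>s. R s y) (f z))"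

lemma related_continuous:
  assumes "related R S"
  shows "continuous_on {0..} (\<lambda>t. R t y)" "continuous_on {0..} (\<lambda>t. S t y)"
  using assms by (auto simp: related_def strongly_continuous_family_def)

lemma related_scalar:
  fixes R S :: "real \<Rightarrow> 'y::sc_lcs \<Rightarrow> 'x::sc_lcs" and \<phi> :: "'x \<Rightarrow> complex"
  assumes RS: "related R S" and \<phi>: "cont_linear \<phi>"
  shows "scalar_related (\<lambda>t. \<phi> (R t y)) (\<lambda>t. \<phi> (S t y))"
proof -
  have bR: "exp_bounded \<omega> (\<lambda>t. R t y)" if "\<omega> > \<omega>0'" for \<omega>
    using RS that by (intro equicontinuous_orbit_bounded) (auto simp: related_def)
  have bS: "exp_bounded \<omega>0 (\<lambda>t. S t y)"
    using RS by (intro equicontinuous_orbit_bounded) (auto simp: related_def)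
  have "laplace (\<lambda>t. \<phi> (S t y)) z = G z * laplace (\<lambda>t. \<phi> (R t y)) (f z)" if z: "Re z > \<omega>0" for z
  proof -
    \<comment> \<open>\<open>R\<close> is controlled at rates above \<open>\<omega>0'\<close>, so a
      rate strictly between \<open>\<omega>0'\<close> and \<open>Re (f z)\<close> is chosen.\<close>
    obtain \<omega> where \<omega>: "\<omega>0' < \<omega>" "\<omega> < Re (f z)" using f[OF z] dense by blast
    have "laplace (\<lambda>t. \<phi> (S t y)) z = \<phi> (lcs_laplace (\<lambda>t. S t y) z)"
      by (rule laplace_eqI[OF has_laplace_functional[OF related_continuous(2)[OF RS] bS z \<phi>]])
    also have "\<dots> = G z * \<phi> (lcs_laplace (\<lambda>t. R t y) (f z))"
      using RS z by (simp add: related_def cont_linear_scaleC[OF \<phi>] scaleC_complex_def)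
    also have "\<phi> (lcs_laplace (\<lambda>t. R t y) (f z)) = laplace (\<lambda>t. \<phi> (R t y)) (f z)"
      by (rule laplace_eqI[OF has_laplace_functional[OF related_continuous(1)[OF RS] bR[OF \<omega>(1)] \<omega>(2) \<phi>], symmetric])
    finally show ?thesis .
  qed
  moreover have "\<exists>M. \<forall>t\<ge>0. cmod (\<phi> (R t y)) \<le> M * exp (\<omega> * t)" if "\<omega> > \<omega>0'" for \<omega>
    using exp_bounded_functional[OF bR[OF that] \<phi>] by blast
  moreover have "\<exists>M. \<forall>t\<ge>0. cmod (\<phi> (S t y)) \<le> M * exp (\<omega>0 * t)"
    using exp_bounded_functional[OF bS \<phi>] by blast
  ultimately show ?thesis
    unfolding scalar_related_def using continuous_on_functional[OF related_continuous(1)[OF RS] \<phi>]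
      continuous_on_functional[OF related_continuous(2)[OF RS] \<phi>] by blast
qed

end

section \<open>Multivalued linear operators\<close>

lemma mlo_add: "mlo A \<Longrightarrow> (x, u) \<in> A \<Longrightarrow> (y, v) \<in> A \<Longrightarrow> (x + y, u + v) \<in> A"
  unfolding mlo_def by (metis DomainI Image_singleton_iff)

lemma mlo_scaleC: "mlo A \<Longrightarrow> (x, u) \<in> A \<Longrightarrow> (c *\<^sub>C x, c *\<^sub>C u) \<in> A"
  unfolding mlo_def by (metis DomainI Image_singleton_iff)

lemma mlo_zero:
  assumes "mlo A" shows "(0, 0) \<in> A"
proof -
  obtain u where "(0, u) \<in> A" using assms by (auto simp: mlo_def)
  from mlo_scaleC[OF assms this, of 0] show ?thesis by (simp add: scaleC_zero_left)
qed

lemma mloI: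
  assumes zero: "(0, 0) \<in> A" and add: "\<And>x u y v. (x, u) \<in> A \<Longrightarrow> (y, v) \<in> A \<Longrightarrow> (x + y, u + v) \<in> A"
    and scale: "\<And>c x u. (x, u) \<in> A \<Longrightarrow> (c *\<^sub>C x, c *\<^sub>C u) \<in> A"
  shows "mlo A"
  unfolding mlo_def
proof (intro conjI ballI allI)
  show "0 \<in> Domain A" using zero by blast
  show "x + y \<in> Domain A" if "x \<in> Domain A" "y \<in> Domain A" for x y using that add by blast
  show "c *\<^sub>C x \<in> Domain A" if "x \<in> Domain A" for c x using that scale by blast
  show "u + v \<in> A `` {x + y}" if "u \<in> A `` {x}" "v \<in> A `` {y}" for x y u v using that add by blast
  show "c *\<^sub>C u \<in> A `` {c *\<^sub>C x}" if "u \<in> A `` {x}" for c x u using that scale by blast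
qed

lemma mlo_converse: "mlo A \<Longrightarrow> mlo (A\<inverse>)"
  by (rule mloI) (auto intro: mlo_zero mlo_add mlo_scaleC)

lemma commutes_with_iff: "commutes_with T A \<longleftrightarrow> (\<forall>x y. (x, y) \<in> A \<longrightarrow> (T x, T y) \<in> A)"
  unfolding commutes_with_def graph_of_def relcomp_unfold by blast

lemma closed_mlo_memI:
  fixes A :: "('x::complex_lcs \<times> 'x) set"
  assumes "closed A" "mlo A"
    and "\<And>\<phi> \<psi> :: 'x \<Rightarrow> complex. cont_linear \<phi> \<Longrightarrow> cont_linear \<psi> \<Longrightarrow>
      (\<And>x y. (x, y) \<in> A \<Longrightarrow> \<phi> x + \<psi> y = 0) \<Longrightarrow> \<phi> v + \<psi> w = 0"
  shows "(v, w) \<in> A"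
  by (rule closed_subspace_Times_memI[OF assms(1) mlo_zero[OF assms(2)] mlo_add[OF assms(2)] mlo_scaleC[OF assms(2)] assms(3)])

lemma cont_linear_scaled_diff:
  assumes "cont_linear D" "cont_linear T"
  shows "cont_linear (\<lambda>y. c *\<^sub>C D y - T y)"
  using assms unfolding cont_linear_def
  by (auto simp: scaleC_add_right scaleC_diff_right scaleC_scaleC mult.commute
      intro!: continuous_on_diff continuous_on_scaleC continuous_on_const)

lemma strongly_continuous_scaled_diff:
  assumes k1: "continuous_on {0..} k1" and D: "cont_linear D" and S: "strongly_continuous_family S"
  shows "strongly_continuous_family (\<lambda>t y. k1 t *\<^sub>C D y - S t y)"
  using S unfolding strongly_continuous_family_def
  by (auto intro!: cont_linear_scaled_diff[OF D] continuous_on_diff continuous_on_scaleC k1 continuous_on_const)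

section \<open>Families with transformed kernels\<close>

context transformed_kernels
begin

text \<open>Each pair of functionals vanishing on \<open>A\<close> turns the inclusion for
  \<open>R\<close> into the scalar equation. Its transformed version says that the pair also
  vanishes at the point claimed to lie in \<open>A\<close>.\<close>

lemma mild_existence_family_transform:
  fixes R S :: "real \<Rightarrow> 'y::sc_lcs \<Rightarrow> 'x::sc_lcs"
  assumes A: "mlo A" "closed A" and C1: "cont_linear C1"
    and R: "mild_existence_family A a k C1 R" and RS: "related R S"
  shows "mild_existence_family (A\<inverse>) b k1 C1 (\<lambda>t y. k1 t *\<^sub>C C1 y - S t y)"
  unfolding mild_existence_family_def
proof (intro conjI allI impI)
  show "mlo (A\<inverse>)" using A(1) by (rule mlo_converse)
  show "strongly_continuous_family (\<lambda>t y. k1 t *\<^sub>C C1 y - S t y)"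
    using RS by (intro strongly_continuous_scaled_diff k1 C1) (simp add: related_def)
  fix t :: real and y assume t: "0 \<le> t"
  let ?S = "\<lambda>s. k1 s *\<^sub>C C1 y - S s y"
  have Sc: "continuous_on {0..} ?S"
    by (intro continuous_on_diff continuous_on_scaleC k1 continuous_on_const related_continuous(2)[OF RS])
  \<comment> \<open>The first entry is \<open>?S t - k1 t *\<^sub>C C1 y\<close>, so this is the
    inclusion for the inverse with the entries swapped.\<close>
  have "(- S t y, lcs_convolution b ?S t) \<in> A"
  proof (rule closed_mlo_memI[OF A(2,1)])
    fix \<phi> \<psi> :: "'x \<Rightarrow> complex"
    assume \<phi>: "cont_linear \<phi>" and \<psi>: "cont_linear \<psi>" and ann: "\<And>x y. (x, y) \<in> A \<Longrightarrow> \<phi> x + \<psi> y = 0"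
    have "conv b (\<lambda>r. k1 r * \<psi> (C1 y) - \<psi> (S r y)) t = \<phi> (S t y)"
    proof (rule scalar_resolvent_equation[OF related_scalar[OF RS \<phi>] related_scalar[OF RS \<psi>] _ t])
      fix r :: real assume r: "r \<ge> 0"
      have "(lcs_convolution a (\<lambda>s. R s y) r, R r y - k r *\<^sub>C C1 y) \<in> A"
        using R r by (simp add: mild_existence_family_def)
      from ann[OF this] show "conv a (\<lambda>t. \<phi> (R t y)) r + \<psi> (R r y) = k r * \<psi> (C1 y)"
        by (simp add: lcs_convolution_functional[OF a related_continuous(1)[OF RS] \<phi> r]
            cont_linear_diff[OF \<psi>] cont_linear_scaleC[OF \<psi>] scaleC_complex_def add_diff_eq)
    qed
    then show "\<phi> (- S t y) + \<psi> (lcs_convolution b ?S t) = 0"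
      by (simp add: lcs_convolution_functional[OF b Sc \<psi> t] cont_linear_minus[OF \<phi>]
          cont_linear_diff[OF \<psi>] cont_linear_scaleC[OF \<psi>] scaleC_complex_def)
  qed
  then show "(lcs_convolution b ?S t, ?S t - k1 t *\<^sub>C C1 y) \<in> A\<inverse>" by simp
qed

text \<open>The same scalar equation, now for two orbits: \<open>- \<phi>\<close> on the orbit of
  \<open>y\<close> and \<open>\<phi>\<close> on that of \<open>x\<close>, where
  \<open>(x, y) \<in> A\<close>. The sign brings the convolution to the side of
  \<open>\<phi> (R r x)\<close>.\<close>

lemma mild_uniqueness_family_transform:
  fixes R S :: "real \<Rightarrow> 'x::sc_lcs \<Rightarrow> 'x"
  assumes A: "mlo A" and C2: "cont_linear C2"
    and R: "mild_uniqueness_family A a k C2 R" and RS: "related R S"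
  shows "mild_uniqueness_family (A\<inverse>) b k1 C2 (\<lambda>t x. k1 t *\<^sub>C C2 x - S t x)"
  unfolding mild_uniqueness_family_def
proof (intro conjI allI impI ballI)
  show "mlo (A\<inverse>)" using A by (rule mlo_converse)
  show "strongly_continuous_family (\<lambda>t x. k1 t *\<^sub>C C2 x - S t x)"
    using RS by (intro strongly_continuous_scaled_diff k1 C2) (simp add: related_def)
  fix t :: real and z assume t: "0 \<le> t" and z: "z \<in> A\<inverse>"
  then obtain x y where xy: "(x, y) \<in> A" and z_eq: "z = (y, x)" by auto
  let ?S = "\<lambda>s. k1 s *\<^sub>C C2 x - S s x"
  have Sc: "continuous_on {0..} ?S"
    by (intro continuous_on_diff continuous_on_scaleC k1 continuous_on_const related_continuous(2)[OF RS])
  have "lcs_convolution b ?S t = - S t y"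
  proof (rule eqI_functionals)
    fix \<phi> :: "'x \<Rightarrow> complex" assume \<phi>: "cont_linear \<phi>"
    have \<phi>m: "cont_linear (\<lambda>v. - \<phi> v)"
      using \<phi> by (auto simp: cont_linear_def scaleC_complex_def intro: continuous_on_minus)
    have "conv b (\<lambda>r. k1 r * \<phi> (C2 x) - \<phi> (S r x)) t = - \<phi> (S t y)"
    proof (rule scalar_resolvent_equation[OF related_scalar[OF RS \<phi>m] related_scalar[OF RS \<phi>] _ t])
      fix r :: real assume r: "r \<ge> 0"
      have "lcs_convolution a (\<lambda>s. R s y) r = R r x - k r *\<^sub>C C2 x"
        using R r xy by (auto simp: mild_uniqueness_family_def)
      then have "conv a (\<lambda>s. \<phi> (R s y)) r = \<phi> (R r x) - k r * \<phi> (C2 x)"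
        using lcs_convolution_functional[OF a related_continuous(1)[OF RS] \<phi> r, of y]
        by (simp add: cont_linear_diff[OF \<phi>] cont_linear_scaleC[OF \<phi>] scaleC_complex_def)
      moreover have "conv a (\<lambda>s. - \<phi> (R s y)) r = - conv a (\<lambda>s. \<phi> (R s y)) r" by (simp add: conv_def)
      ultimately show "conv a (\<lambda>t. - \<phi> (R t y)) r + \<phi> (R r x) = k r * \<phi> (C2 x)" by simp
    qed
    then show "\<phi> (lcs_convolution b ?S t) = \<phi> (- S t y)"
      by (simp add: lcs_convolution_functional[OF b Sc \<phi> t] cont_linear_minus[OF \<phi>]
          cont_linear_diff[OF \<phi>] cont_linear_scaleC[OF \<phi>] scaleC_complex_def)
  qed
  then show "case z of (x, y) \<Rightarrow> lcs_convolution b (\<lambda>s. k1 s *\<^sub>C C2 y - S s y) t = k1 t *\<^sub>C C2 x - S t x - k1 t *\<^sub>C C2 x"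
    by (simp add: z_eq)
qed

text \<open>Commutation passes from \<open>R\<close> to \<open>S\<close> as scalar relations:
  \<open>\<phi> (R t x) = - \<psi> (R t y)\<close> for functionals vanishing on \<open>A\<close>,
  and equality of \<open>\<phi>\<close> along the orbit of \<open>C x\<close> with
  \<open>\<phi>\<close> after \<open>C\<close> along the orbit of \<open>x\<close>.\<close>

lemma resolvent_family_transform:
  fixes R S :: "real \<Rightarrow> 'x::sc_lcs \<Rightarrow> 'x"
  assumes A: "mlo A" "closed A" and C: "cont_linear C"
    and R: "resolvent_family A a k C R" and RS: "related R S"
  shows "resolvent_family (A\<inverse>) b k1 C (\<lambda>t x. k1 t *\<^sub>C C x - S t x)"
proof -
  have CA: "(C x, C y) \<in> A" if "(x, y) \<in> A" for x y
    using R that by (auto simp: resolvent_family_def commutes_with_iff)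
  have RA: "(R t x, R t y) \<in> A" if "(x, y) \<in> A" "t \<ge> 0" for x y t
    using R that by (auto simp: resolvent_family_def commutes_with_iff)
  have RC: "R t (C x) = C (R t x)" if "t \<ge> 0" for x t
    using R that by (auto simp: resolvent_family_def o_def dest: fun_cong)
  have SA: "(S t x, S t y) \<in> A" if xy: "(x, y) \<in> A" and t: "t \<ge> 0" for x y t
  proof (rule closed_mlo_memI[OF A(2,1)])
    fix \<phi> \<psi> :: "'x \<Rightarrow> complex"
    assume \<phi>: "cont_linear \<phi>" and \<psi>: "cont_linear \<psi>" and ann: "\<And>x y. (x, y) \<in> A \<Longrightarrow> \<phi> x + \<psi> y = 0"
    have "\<phi> (S t x) = - 1 * \<psi> (S t y)"
      by (rule scalar_related_transfer[OF related_scalar[OF RS \<phi>] related_scalar[OF RS \<psi>] _ t])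
         (use ann[OF RA[OF xy]] in \<open>simp add: eq_neg_iff_add_eq_0\<close>)
    then show "\<phi> (S t x) + \<psi> (S t y) = 0" by simp
  qed
  have SC: "S t (C x) = C (S t x)" if t: "t \<ge> 0" for x t
  proof (rule eqI_functionals)
    fix \<phi> :: "'x \<Rightarrow> complex" assume \<phi>: "cont_linear \<phi>"
    have "\<phi> (S t (C x)) = 1 * \<phi> (C (S t x))"
      by (rule scalar_related_transfer[OF related_scalar[OF RS \<phi>] related_scalar[OF RS cont_linear_compose[OF \<phi> C]] _ t])
         (simp add: RC)
    then show "\<phi> (S t (C x)) = \<phi> (C (S t x))" by simp
  qed
  have diff: "(k1 t *\<^sub>C C x - S t x, k1 t *\<^sub>C C y - S t y) \<in> A" if xy: "(x, y) \<in> A" and t: "t \<ge> 0" for x y t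
    using mlo_add[OF A(1) mlo_scaleC[OF A(1) CA[OF xy], of "k1 t"] mlo_scaleC[OF A(1) SA[OF xy t], of "- 1"]]
    by (simp add: scaleC_minus_left scaleC_one)
  show ?thesis
    unfolding resolvent_family_def commutes_with_iff
  proof (intro conjI allI impI)
    show "mild_uniqueness_family (A\<inverse>) b k1 C (\<lambda>t x. k1 t *\<^sub>C C x - S t x)"
      using R by (intro mild_uniqueness_family_transform[OF A(1) C _ RS]) (simp add: resolvent_family_def)
    show "(C x, C y) \<in> A\<inverse>" if "(x, y) \<in> A\<inverse>" for x y using that CA by simp
    show "(k1 t *\<^sub>C C x - S t x, k1 t *\<^sub>C C y - S t y) \<in> A\<inverse>" if "0 \<le> t" "(x, y) \<in> A\<inverse>" for t x y
      using that diff by simp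
    show "(\<lambda>x. k1 t *\<^sub>C C x - S t x) \<circ> C = C \<circ> (\<lambda>x. k1 t *\<^sub>C C x - S t x)" if "0 \<le> t" for t
      using SC[OF that] by (simp add: fun_eq_iff cont_linear_diff[OF C] cont_linear_scaleC[OF C])
  qed
qed

end

section \<open>The weight\<close>

lemma rpow_nonneg: "0 \<le> t \<Longrightarrow> 0 \<le> rpow t z"
  by (simp add: rpow_def)

lemma rpow_pos: "0 < t \<Longrightarrow> 0 < rpow t z"
  by (simp add: rpow_def)

lemma rpow_mono: "0 \<le> s \<Longrightarrow> s \<le> t \<Longrightarrow> 0 \<le> z \<Longrightarrow> rpow s z \<le> rpow t z"
  by (simp add: rpow_def powr_mono2)

lemma rpow_exp_bound:
  assumes z: "0 \<le> z" and e: "0 < e"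
  obtains M where "\<And>t. 0 \<le> t \<Longrightarrow> rpow t z \<le> M * exp (e * t)"
proof (cases "z = 0")
  case True
  then show thesis using that[of 1] e by (simp add: rpow_def)
next
  case False
  then have z: "z > 0" using z by simp
  \<comment> \<open>The constant is \<open>(z / e)\<close> to the power \<open>z\<close>; it comes
    from \<open>ln r \<le> r - 1\<close> at \<open>r = e * t / z\<close>.\<close>
  have "rpow t z \<le> exp (z * ln (z / e)) * exp (e * t)" if t: "0 \<le> t" for t
  proof (cases "t = 0")
    case False
    then have t: "t > 0" using t by simp
    have "ln (e * t / z) \<le> e * t / z - 1" using t e z by (intro ln_le_minus_one) simp
    moreover have "ln (e * t / z) = ln t - ln (z / e)" using t e z by (simp add: ln_div ln_mult)
    ultimately have "ln t \<le> e * t / z + ln (z / e)" by linarith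
    then have "z * ln t \<le> z * (e * t / z + ln (z / e))" using z by (intro mult_left_mono) auto
    also have "\<dots> = z * ln (z / e) + e * t" using z by (simp add: distrib_left)
    finally have "exp (z * ln t) \<le> exp (z * ln (z / e) + e * t)" by simp
    then show ?thesis using t z by (simp add: rpow_def powr_def exp_add)
  qed (use z in \<open>simp add: rpow_def\<close>)
  then show thesis using that by blast
qed

locale power_weight =
  fixes P :: "real \<Rightarrow> real" and l :: nat and \<alpha> \<zeta> :: "nat \<Rightarrow> real"
  assumes nonneg: "\<And>j. j \<le> l \<Longrightarrow> 0 \<le> \<alpha> j \<and> 0 \<le> \<zeta> j"
    and P: "\<And>t. 0 \<le> t \<Longrightarrow> P t = (\<Sum>j\<le>l. \<alpha> j * rpow t (\<zeta> j))"
begin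

lemma weight_nonneg: "0 \<le> t \<Longrightarrow> 0 \<le> P t"
  using nonneg by (auto simp: P intro!: sum_nonneg mult_nonneg_nonneg rpow_nonneg)

lemma weight_mono: "0 \<le> s \<Longrightarrow> s \<le> t \<Longrightarrow> P s \<le> P t"
  using nonneg by (auto simp: P intro!: sum_mono mult_left_mono rpow_mono)

lemma weight_exp_bound:
  assumes e: "0 < e"
  obtains M where "\<And>t. 0 \<le> t \<Longrightarrow> P t \<le> M * exp (e * t)"
proof -
  have "\<exists>M. \<forall>t\<ge>0. rpow t (\<zeta> j) \<le> M * exp (e * t)" if "j \<le> l" for j
    using rpow_exp_bound[OF _ e, of "\<zeta> j"] nonneg[OF that] by metis
  then obtain M where M: "\<And>j t. j \<le> l \<Longrightarrow> 0 \<le> t \<Longrightarrow> rpow t (\<zeta> j) \<le> M j * exp (e * t)" by metis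
  have "P t \<le> (\<Sum>j\<le>l. \<alpha> j * M j) * exp (e * t)" if t: "0 \<le> t" for t
  proof -
    have "P t \<le> (\<Sum>j\<le>l. \<alpha> j * (M j * exp (e * t)))"
      unfolding P[OF t] using nonneg M t by (intro sum_mono mult_left_mono) auto
    then show ?thesis by (simp add: sum_distrib_right mult.assoc)
  qed
  then show thesis using that by blast
qed

text \<open>Monotonicity of \<open>P\<close> settles the case \<open>P s > 0\<close>. If
  \<open>P s = 0\<close> with \<open>s > 0\<close>, all coefficients vanish, so
  \<open>P t = 0\<close> as well and both inverses take the default value 0.\<close>

lemma weight_inverse_bound:
  assumes s: "0 < s \<or> 0 < P 0 \<and> s = 0" and t: "s \<le> t"
  shows "inverse (P t) \<le> inverse (P s)"
proof (cases "P s = 0")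
  case True
  with s have s: "0 < s" by auto
  have "\<forall>j\<in>{..l}. \<alpha> j * rpow s (\<zeta> j) = 0"
    using True s nonneg by (subst sum_nonneg_eq_0_iff[symmetric]) (auto simp: P intro!: mult_nonneg_nonneg rpow_nonneg)
  then have "\<alpha> j = 0" if "j \<le> l" for j using that rpow_pos[OF s, of "\<zeta> j"] by force
  then have "P t = 0" using s t by (simp add: P)
  then show ?thesis using True by simp
next
  case False
  have s0: "0 \<le> s" using s by auto
  then have "0 < P s" using weight_nonneg[OF s0] False by simp
  then show ?thesis using weight_mono[OF s0 t] by (intro le_imp_inverse_le) auto
qed

text \<open>The bound on \<open>k1\<close> cancels the weight up to the constant \<open>K\<close>.
  The term with \<open>S\<close> lacks the factor \<open>P t\<close> and costs
  \<open>inverse (P t)\<close>, at most \<open>inverse (P s)\<close> for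
  \<open>t \<ge> s\<close>.\<close>

lemma weighted_equicontinuous_scaled_diff:
  fixes D :: "'y::complex_lcs \<Rightarrow> 'x::complex_lcs"
  assumes k1: "\<And>t. 0 \<le> t \<Longrightarrow> cmod (k1 t) \<le> K * (exp (\<omega> * t) * P t)"
    and D: "cont_linear D"
    and S: "equicontinuous {(\<lambda>y. exp (- \<omega> * t) *\<^sub>R S t y) | t. t \<ge> 0}"
  shows "weighted_equicontinuous \<omega> P (\<lambda>t y. k1 t *\<^sub>C D y - S t y)"
proof -
  let ?T = "\<lambda>t y. (exp (- \<omega> * t) * inverse (P t)) *\<^sub>R (k1 t *\<^sub>C D y - S t y)"
  \<comment> \<open>Covers both clauses of the definition: \<open>s\<close> is
    \<open>\<delta>\<close> in the first and 0 in the second.\<close>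
  have main: "equicontinuous F"
    if F: "F \<subseteq> {?T t | t. t \<ge> s}" and s: "0 < s \<or> 0 < P 0 \<and> s = 0" for F s
    unfolding equicontinuous_def
  proof (intro allI impI)
    fix U :: "'x set" assume U: "open U \<and> 0 \<in> U"
    then obtain p where p: "cont_seminorm p" "\<And>x. p x < 1 \<Longrightarrow> x \<in> U"
      using cont_seminorm_in_neighbourhood[of U] by blast
    have sem: "seminorm p" using p by (simp add: cont_seminorm_def)
    define L where "L = inverse (P s)"
    have L: "0 \<le> L" using s weight_nonneg[of s] by (auto simp: L_def)
    \<comment> \<open>Chosen so that \<open>L * e\<close> and \<open>\<bar>K\<bar> * e'\<close> are
      each below \<open>1 / 2\<close>; the added 1 keeps the denominators positive.\<close>
    define e where "e = 1 / (2 * (L + 1))"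
    define e' where "e' = 1 / (2 * (\<bar>K\<bar> + 1))"
    have e: "0 < e" "0 < e'" using L by (auto simp: e_def e'_def)
    have "open {x. p x < e} \<and> 0 \<in> {x. p x < e}"
      using open_seminorm_ball[OF p(1)] e by (simp add: seminorm_zero[OF sem])
    from S[unfolded equicontinuous_def, rule_format, OF this] obtain V where V: "open V" "0 \<in> V"
      and sub: "\<forall>T\<in>{(\<lambda>y. exp (- \<omega> * t) *\<^sub>R S t y) | t. t \<ge> 0}. T ` V \<subseteq> {x. p x < e}" by (elim exE conjE)
    have V3: "p (exp (- \<omega> * t) *\<^sub>R S t v) < e" if "t \<ge> 0" "v \<in> V" for t v
    proof -
      have "(\<lambda>y. exp (- \<omega> * t) *\<^sub>R S t y) ` V \<subseteq> {x. p x < e}" using that(1) by (intro bspec[OF sub]) blast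
      then show ?thesis using that(2) by auto
    qed
    define W where "W = V \<inter> {y. p (D y) < e'}"
    have W: "open W" "0 \<in> W"
      using V e open_seminorm_ball[OF cont_linear_seminorm[OF D p(1)]]
      by (auto simp: W_def cont_linear_zero[OF D] seminorm_zero[OF sem])
    have small: "p (?T t y) < 1" if t: "t \<ge> s" and y: "y \<in> W" for t y
    proof -
      have t0: "0 \<le> t" using s t by auto
      have inv: "0 \<le> inverse (P t)" "inverse (P t) \<le> L"
        using weight_nonneg[OF t0] weight_inverse_bound[OF s t] by (auto simp: L_def)
      have "exp (- \<omega> * t) * inverse (P t) * cmod (k1 t) \<le> exp (- \<omega> * t) * inverse (P t) * (\<bar>K\<bar> * (exp (\<omega> * t) * P t))"
        using k1[OF t0] inv(1) weight_nonneg[OF t0]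
        by (intro mult_left_mono order_trans[OF k1[OF t0]] mult_right_mono) auto
      also have "\<dots> = \<bar>K\<bar> * (inverse (P t) * P t)" by (simp add: exp_minus)
      \<comment> \<open>\<open>inverse (P t) * P t\<close> is 0 instead of 1 when
        \<open>P t = 0\<close>.\<close>
      also have "\<dots> \<le> \<bar>K\<bar>" by (cases "P t = 0") auto
      finally have K: "exp (- \<omega> * t) * inverse (P t) * cmod (k1 t) \<le> \<bar>K\<bar>" .
      have "?T t y = (exp (- \<omega> * t) * inverse (P t)) *\<^sub>R (k1 t *\<^sub>C D y) - inverse (P t) *\<^sub>R exp (- \<omega> * t) *\<^sub>R S t y"
        by (simp add: scaleR_diff_right mult.commute)
      then have "p (?T t y) \<le> p ((exp (- \<omega> * t) * inverse (P t)) *\<^sub>R (k1 t *\<^sub>C D y)) + p (inverse (P t) *\<^sub>R exp (- \<omega> * t) *\<^sub>R S t y)"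
        using seminorm_diff[OF sem] by metis
      also have "\<dots> = exp (- \<omega> * t) * inverse (P t) * cmod (k1 t) * p (D y) + inverse (P t) * p (exp (- \<omega> * t) *\<^sub>R S t y)"
        using inv(1) by (simp add: seminorm_scaleR[OF sem] seminorm_scaleC[OF sem])
      also have "\<dots> \<le> \<bar>K\<bar> * e' + L * e"
        using K inv L V3[OF t0, of y] y seminorm_nonneg[OF sem] e by (intro add_mono mult_mono) (auto simp: W_def)
      also have "\<dots> < 1"
      proof -
        have "\<bar>K\<bar> * e' < 1 / 2" by (simp add: e'_def field_simps)
        moreover have "L * e < 1 / 2" using L by (simp add: e_def field_simps)
        ultimately show ?thesis by linarith
      qed
      finally show ?thesis .
    qed
    show "\<exists>V. open V \<and> 0 \<in> V \<and> (\<forall>T\<in>F. T ` V \<subseteq> U)"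
    proof (intro exI[of _ W] conjI W ballI)
      fix T assume "T \<in> F"
      then obtain t where "t \<ge> s" "T = ?T t" using F by blast
      then show "T ` W \<subseteq> U" using small p(2) by blast
    qed
  qed
  show ?thesis
    unfolding weighted_equicontinuous_def
  proof (intro conjI allI impI)
    show "equicontinuous {?T t | t. t \<ge> \<delta>}" if "0 < \<delta>" for \<delta>
      by (rule main[of _ \<delta>]) (use that in auto)
    show "equicontinuous {?T t | t. t > 0}" if "0 < P 0"
    proof (rule main[of _ 0])
      show "{?T t | t. t > 0} \<subseteq> {?T t | t. t \<ge> 0}" by (auto intro: less_imp_le)
    qed (use that in simp)
  qed
qed

end

theorem theorem2p10:
  fixes A :: "('x::sc_lcs \<times> 'x) set"
    and C C2 :: "'x \<Rightarrow> 'x"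
    and C1 :: "'y::sc_lcs \<Rightarrow> 'x"
    and a k b k1 :: "real \<Rightarrow> complex"
    and \<omega>0 \<omega>0' :: real
    and P :: "real \<Rightarrow> real" and l :: nat and \<alpha> \<zeta> :: "nat \<Rightarrow> real"
    and f G :: "complex \<Rightarrow> complex"
  assumes "mlo A" and "closed A"
    and "cont_linear C" and "cont_linear C1" and "cont_linear C2"
    and "commutes_with C A"
    and "kernel_pair a k" and "kernel_pair b k1"
    and "P1 (modulus a)" and "P1 k"
    and "ereal \<omega>0' \<ge> max (max (laplace_abs (modulus a)) (laplace_abs k)) 0"
    and "P1 b" and "P1 k1"
    and "ereal \<omega>0 \<ge> max 0 (laplace_abs (modulus b))"
    and "\<forall>j\<le>l. \<alpha> j \<ge> 0 \<and> \<zeta> j \<ge> 0"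
    and "\<forall>t\<ge>0. P t = (\<Sum>j\<le>l. \<alpha> j * rpow t (\<zeta> j))"
    and "\<exists>K. \<forall>t\<ge>0. cmod (k1 t) \<le> K * (exp (\<omega>0 * t) * P t)"
    and "\<forall>z. Re z > \<omega>0 \<longrightarrow> Re (f z) > \<omega>0'"
    and "\<forall>z. Re z > \<omega>0' \<longrightarrow> laplace a z \<noteq> 0"
    and "\<forall>z. Re z > \<omega>0 \<longrightarrow> laplace b z = 1 / laplace a (f z)"
    and "\<forall>z. Re z > \<omega>0 \<longrightarrow> laplace k1 z = G z * laplace k (f z)"
  shows
    "(\<forall>R1 S0 :: real \<Rightarrow> 'y \<Rightarrow> 'x.
        mild_existence_family A a k C1 R1 \<and>
        (\<forall>\<omega>>\<omega>0'. equicontinuous {(\<lambda>y. exp (- \<omega> * t) *\<^sub>R R1 t y) | t. t \<ge> 0}) \<and>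
        strongly_continuous_family S0 \<and>
        equicontinuous {(\<lambda>y. exp (- \<omega>0 * t) *\<^sub>R S0 t y) | t. t \<ge> 0} \<and>
        (\<forall>y z. Re z > \<omega>0 \<longrightarrow>
           lcs_laplace (\<lambda>t. S0 t y) z = G z *\<^sub>C lcs_laplace (\<lambda>s. R1 s y) (f z))
      \<longrightarrow>
        mild_existence_family (A\<inverse>) b k1 C1 (\<lambda>t y. k1 t *\<^sub>C C1 y - S0 t y) \<and>
        weighted_equicontinuous \<omega>0 P (\<lambda>t y. k1 t *\<^sub>C C1 y - S0 t y))
   \<and> (\<forall>R2 S0 :: real \<Rightarrow> 'x \<Rightarrow> 'x.
        mild_uniqueness_family A a k C2 R2 \<and>
        (\<forall>\<omega>>\<omega>0'. equicontinuous {(\<lambda>x. exp (- \<omega> * t) *\<^sub>R R2 t x) | t. t \<ge> 0}) \<and>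
        strongly_continuous_family S0 \<and>
        equicontinuous {(\<lambda>x. exp (- \<omega>0 * t) *\<^sub>R S0 t x) | t. t \<ge> 0} \<and>
        (\<forall>x z. Re z > \<omega>0 \<longrightarrow>
           lcs_laplace (\<lambda>t. S0 t x) z = G z *\<^sub>C lcs_laplace (\<lambda>s. R2 s x) (f z))
      \<longrightarrow>
        mild_uniqueness_family (A\<inverse>) b k1 C2 (\<lambda>t x. k1 t *\<^sub>C C2 x - S0 t x) \<and>
        weighted_equicontinuous \<omega>0 P (\<lambda>t x. k1 t *\<^sub>C C2 x - S0 t x))
   \<and> (\<forall>R S0 :: real \<Rightarrow> 'x \<Rightarrow> 'x.
        resolvent_family A a k C R \<and>
        (\<forall>\<omega>>\<omega>0'. equicontinuous {(\<lambda>x. exp (- \<omega> * t) *\<^sub>R R t x) | t. t \<ge> 0}) \<and>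
        strongly_continuous_family S0 \<and>
        equicontinuous {(\<lambda>x. exp (- \<omega>0 * t) *\<^sub>R S0 t x) | t. t \<ge> 0} \<and>
        (\<forall>x z. Re z > \<omega>0 \<longrightarrow>
           lcs_laplace (\<lambda>t. S0 t x) z = G z *\<^sub>C lcs_laplace (\<lambda>s. R s x) (f z))
      \<longrightarrow>
        resolvent_family (A\<inverse>) b k1 C (\<lambda>t x. k1 t *\<^sub>C C x - S0 t x) \<and>
        weighted_equicontinuous \<omega>0 P (\<lambda>t x. k1 t *\<^sub>C C x - S0 t x))"
proof -
  interpret W: power_weight P l \<alpha> \<zeta>
    using assms(15,16) by unfold_locales auto
  have a: "locally_integrable a" and k: "continuous_on {0..} k" and b: "locally_integrable b" and k1: "continuous_on {0..} k1"
    using assms(7,8) by (auto simp: kernel_pair_def)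
  have abs: "ereal \<omega>0' \<ge> laplace_abs (modulus a)" "ereal \<omega>0' \<ge> laplace_abs k" "ereal \<omega>0 \<ge> laplace_abs (modulus b)"
    using assms(11,14) by simp_all
  obtain K where K: "\<And>t. 0 \<le> t \<Longrightarrow> cmod (k1 t) \<le> K * (exp (\<omega>0 * t) * P t)" using assms(17) by blast
  have k1_int: "integrable lebesgue (laplace_integrand k1 z)" if z: "Re z > \<omega>0" for z
  proof -
    \<comment> \<open>Half of the gap absorbs the powers in \<open>P\<close>; the other half makes
      the transform of \<open>k1\<close> converge absolutely.\<close>
    define e where "e = (Re z - \<omega>0) / 2"
    have e: "e > 0" using z by (simp add: e_def)
    obtain M where M: "\<And>t. 0 \<le> t \<Longrightarrow> P t \<le> M * exp (e * t)" by (rule W.weight_exp_bound[OF e]) blast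
    have "cmod (k1 t) \<le> (\<bar>K\<bar> * M) * exp ((\<omega>0 + e) * t)" if t: "t \<ge> 0" for t
    proof -
      have "cmod (k1 t) \<le> \<bar>K\<bar> * (exp (\<omega>0 * t) * P t)"
        using K[OF t] W.weight_nonneg[OF t] by (elim order_trans) (intro mult_right_mono, auto)
      also have "\<dots> \<le> \<bar>K\<bar> * (exp (\<omega>0 * t) * (M * exp (e * t)))" using M[OF t] by (intro mult_left_mono) auto
      also have "\<dots> = (\<bar>K\<bar> * M) * exp ((\<omega>0 + e) * t)" unfolding distrib_right exp_add by simp
      finally show ?thesis .
    qed
    then show ?thesis
      by (rule exp_growth_integrable[OF continuous_imp_locally_integrable[OF k1]]) (use z in \<open>simp_all add: e_def field_simps\<close>)
  qed
  interpret T: transformed_kernels a k b k1 \<omega>0 \<omega>0' f G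
    using a k b k1 assms(18-21) k1_int integrable_laplace_integrand_modulus[OF a abs(1)]
      integrable_laplace_integrand_modulus[OF b abs(3)]
      has_laplace_laplace[OF continuous_imp_locally_integrable[OF k] abs(2)]
    by unfold_locales auto
  note weighted = W.weighted_equicontinuous_scaled_diff[OF K]
  show ?thesis
  proof (intro conjI allI impI; (elim conjE)?)
    fix R1 S0 :: "real \<Rightarrow> 'y \<Rightarrow> 'x"
    assume *: "mild_existence_family A a k C1 R1"
      "\<forall>\<omega>>\<omega>0'. equicontinuous {(\<lambda>y. exp (- \<omega> * t) *\<^sub>R R1 t y) | t. t \<ge> 0}"
      "strongly_continuous_family S0"
      "equicontinuous {(\<lambda>y. exp (- \<omega>0 * t) *\<^sub>R S0 t y) | t. t \<ge> 0}"
      "\<forall>y z. Re z > \<omega>0 \<longrightarrow> lcs_laplace (\<lambda>t. S0 t y) z = G z *\<^sub>C lcs_laplace (\<lambda>s. R1 s y) (f z)"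
    then have "T.related R1 S0" unfolding T.related_def by (auto simp: mild_existence_family_def)
    then show "mild_existence_family (A\<inverse>) b k1 C1 (\<lambda>t y. k1 t *\<^sub>C C1 y - S0 t y)"
      by (rule T.mild_existence_family_transform[OF assms(1,2,4) *(1)])
    show "weighted_equicontinuous \<omega>0 P (\<lambda>t y. k1 t *\<^sub>C C1 y - S0 t y)" by (rule weighted[OF _ assms(4) *(4)])
  next
    fix R2 S0 :: "real \<Rightarrow> 'x \<Rightarrow> 'x"
    assume *: "mild_uniqueness_family A a k C2 R2"
      "\<forall>\<omega>>\<omega>0'. equicontinuous {(\<lambda>y. exp (- \<omega> * t) *\<^sub>R R2 t y) | t. t \<ge> 0}"
      "strongly_continuous_family S0"
      "equicontinuous {(\<lambda>y. exp (- \<omega>0 * t) *\<^sub>R S0 t y) | t. t \<ge> 0}"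
      "\<forall>y z. Re z > \<omega>0 \<longrightarrow> lcs_laplace (\<lambda>t. S0 t y) z = G z *\<^sub>C lcs_laplace (\<lambda>s. R2 s y) (f z)"
    then have "T.related R2 S0" unfolding T.related_def by (auto simp: mild_uniqueness_family_def)
    then show "mild_uniqueness_family (A\<inverse>) b k1 C2 (\<lambda>t x. k1 t *\<^sub>C C2 x - S0 t x)"
      by (rule T.mild_uniqueness_family_transform[OF assms(1,5) *(1)])
    show "weighted_equicontinuous \<omega>0 P (\<lambda>t x. k1 t *\<^sub>C C2 x - S0 t x)" by (rule weighted[OF _ assms(5) *(4)])
  next
    fix R S0 :: "real \<Rightarrow> 'x \<Rightarrow> 'x"
    assume *: "resolvent_family A a k C R"
      "\<forall>\<omega>>\<omega>0'. equicontinuous {(\<lambda>y. exp (- \<omega> * t) *\<^sub>R R t y) | t. t \<ge> 0}"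
      "strongly_continuous_family S0"
      "equicontinuous {(\<lambda>y. exp (- \<omega>0 * t) *\<^sub>R S0 t y) | t. t \<ge> 0}"
      "\<forall>y z. Re z > \<omega>0 \<longrightarrow> lcs_laplace (\<lambda>t. S0 t y) z = G z *\<^sub>C lcs_laplace (\<lambda>s. R s y) (f z)"
    then have "T.related R S0" unfolding T.related_def by (auto simp: resolvent_family_def mild_uniqueness_family_def)
    then show "resolvent_family (A\<inverse>) b k1 C (\<lambda>t x. k1 t *\<^sub>C C x - S0 t x)"
      by (rule T.resolvent_family_transform[OF assms(1,2,3) *(1)])
    show "weighted_equicontinuous \<omega>0 P (\<lambda>t x. k1 t *\<^sub>C C x - S0 t x)" by (rule weighted[OF _ assms(3) *(4)])
  qed
qed

end
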